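(* Suppose $\mu_1\le\mu_2\le\mu_3<0$, and consider the system $$u_i''+2(u_1^2+u_2^2+u_3^2)u_i=-\mu_iu_i\quad\text{in }\mathbb{R},\qquad i=1,2,3.\qquad( * )$$ Then $( * )$ admits normalized solutions $u=(u_1,u_2,u_3)\in H^1(\mathbb{R})^3$, i.e. solutions satisfying $\int_{\mathbb{R}}u_i^2\,dx=1$ for all $i=1,2,3$, if and only if one of the following conditions holds: (i) $\mu_1=\mu_2=\mu_3=-\frac94$; (ii) $\mu_1=\mu_2=-1$ and $\mu_3=-\frac14$. Moreover, if (i) holds, then up to translations $( * )$ admits a unique normalized solution, in the sense that $$u_1(x)\equiv\pm\frac{\sqrt3}{2\cosh(\frac{3x}{2})},\quad u_2(x)\equiv\pm\frac{\sqrt3}{2\cosh(\frac{3x}{2})},\quad u_3(x)\equiv\pm\frac{\sqrt3}{2\cosh(\frac{3x}{2})}$$ hold for three uncorrelated signs $\pm$. If (ii) holds, then up to translations $( * )$ admits infinitely many normalized solutions, which satisfy $$u_1(x)=\frac{Ae^{x}}{f(x)}\Big(1+\frac{B^2}{3}e^x\Big),\qquad u_2(x)=\pm\frac{Ae^{x}}{f(x)}\Big(1+\frac{B^2}{3}e^x\Big),\qquad u_3(x)=\frac{Be^{\frac12x}}{f(x)}\Big(1-\frac{A^2}{6}e^{2x}\Big),$$ with $$f(x)=1+B^2e^{x}+\frac{A^2}{2}e^{2x}+\frac{A^2B^2}{18}e^{3x},$$ where $A\ne0$ and $B\neq0$ are arbitrary real numbers.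
   Context: All functions are real-valued. "Up to translations" refers to a common translation $x\mapsto x+x_0$ of all three components. *)

theory Defs
  imports "HOL-Analysis.Analysis"
begin

definition test_function :: "(real \<Rightarrow> real) \<Rightarrow> bool" where
  "test_function \<phi> \<longleftrightarrow> \<phi> C1_differentiable_on UNIV \<and> compact (closure {x. \<phi> x \<noteq> 0})"

definition locally_integrable :: "(real \<Rightarrow> real) \<Rightarrow> bool" where
  "locally_integrable f \<longleftrightarrow> (\<forall>a b. set_integrable lborel {a..b} f)"

definition square_integrable :: "(real \<Rightarrow> real) \<Rightarrow> bool" where
  "square_integrable f \<longleftrightarrow> f \<in> borel_measurable lborel \<and> integrable lborel (\<lambda>x. (f x)\<^sup>2)"

text \<open>Weak derivatives on the real line are tested against compactly supported
  \<open>C\<^sup>1\<close> functions, as in Brezis' definition of \<open>W\<^sup>1\<^sup>,\<^sup>p\<close>; testing against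
  compactly supported \<open>C\<^sup>\<infinity>\<close> functions gives the same notion.\<close>

definition has_weak_deriv :: "(real \<Rightarrow> real) \<Rightarrow> (real \<Rightarrow> real) \<Rightarrow> bool" where
  "has_weak_deriv u v \<longleftrightarrow>
     locally_integrable u \<and> locally_integrable v \<and>
     (\<forall>\<phi>. test_function \<phi> \<longrightarrow>
        (LINT x|lborel. u x * deriv \<phi> x) = - (LINT x|lborel. v x * \<phi> x))"

text \<open>Every class in \<open>H\<^sup>1(\<real>)\<close> has exactly one continuous representative. The elements of
  \<open>H1\<close> are these representatives, so that equality of functions is equality in
  \<open>H\<^sup>1(\<real>)\<close>.\<close>

definition H1 :: "(real \<Rightarrow> real) set" where
  "H1 = {u. continuous_on UNIV u \<and> square_integrable u \<and>
            (\<exists>v. square_integrable v \<and> has_weak_deriv u v)}"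

text \<open>The equation \<open>u\<^sub>i'' + 2 (u\<^sub>1\<^sup>2 + u\<^sub>2\<^sup>2 + u\<^sub>3\<^sup>2) u\<^sub>i = - \<mu>\<^sub>i u\<^sub>i\<close> is understood in
  the weak sense. The components are indexed by the three-element type \<open>3\<close>, in which
  \<open>1\<close>, \<open>2\<close> and \<open>3\<close> (\<open>= 0\<close>) are distinct.\<close>

definition is_solution :: "(3 \<Rightarrow> real) \<Rightarrow> (3 \<Rightarrow> real \<Rightarrow> real) \<Rightarrow> bool" where
  "is_solution \<mu> u \<longleftrightarrow>
     (\<forall>i. \<exists>u' u''. has_weak_deriv (u i) u' \<and> has_weak_deriv u' u'' \<and>
        (AE x in lborel. u'' x + 2 * ((u 1 x)\<^sup>2 + (u 2 x)\<^sup>2 + (u 3 x)\<^sup>2) * u i x = - \<mu> i * u i x))"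

definition normalized_solution :: "(3 \<Rightarrow> real) \<Rightarrow> (3 \<Rightarrow> real \<Rightarrow> real) \<Rightarrow> bool" where
  "normalized_solution \<mu> u \<longleftrightarrow>
     (\<forall>i. u i \<in> H1) \<and> is_solution \<mu> u \<and> (\<forall>i. (LINT x|lborel. (u i x)\<^sup>2) = 1)"

definition translation_rel :: "((3 \<Rightarrow> real \<Rightarrow> real) \<times> (3 \<Rightarrow> real \<Rightarrow> real)) set" where
  "translation_rel = {(u, w). \<exists>x0. \<forall>i x. w i x = u i (x + x0)}"

definition soliton_denom :: "real \<Rightarrow> real \<Rightarrow> real \<Rightarrow> real" where
  "soliton_denom A B x =
     1 + B\<^sup>2 * exp x + A\<^sup>2 / 2 * exp (2 * x) + A\<^sup>2 * B\<^sup>2 / 18 * exp (3 * x)"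

end

theory Submission imports Defs begin

text \<open>
  Put \<open>\<kappa>\<^sub>i = sqrt (-\<mu>\<^sub>i)\<close>. A solution consists of eigenfunctions \<open>u\<^sub>i\<close>, for the eigenvalues
  \<open>\<mu>\<^sub>i\<close>, of the Schroedinger operator \<open>- d\<^sup>2/dx\<^sup>2 - 2 (u\<^sub>1\<^sup>2 + u\<^sub>2\<^sup>2 + u\<^sub>3\<^sup>2)\<close>, whose potential is built
  from the eigenfunctions themselves. This self-consistency forces the potential to be
  reflectionless, and the eigenfunctions of a reflectionless potential obey algebraic identities
  found by Kay and Moses. With the partial Gram matrix
  \<open>m\<^sub>i\<^sub>j(x) = \<integral> u\<^sub>i u\<^sub>j\<close> over the half-line below \<open>x\<close> they read
  \<open>u\<^sub>i' = \<kappa>\<^sub>i u\<^sub>i - \<Sum>\<^sub>j m\<^sub>i\<^sub>j u\<^sub>j\<close> and \<open>u\<^sub>i u\<^sub>j = (\<kappa>\<^sub>i + \<kappa>\<^sub>j) m\<^sub>i\<^sub>j - \<Sum>\<^sub>k m\<^sub>i\<^sub>k m\<^sub>k\<^sub>j\<close>.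

  They follow from an energy argument (\<open>kay_moses_identities\<close>). Let \<open>Z\<close> and \<open>R\<close> be the defects of the
  two identities, and \<open>Q = |Z|\<^sup>2 + |R|\<^sup>2/2\<close>. The equations for \<open>u\<close> give
  \<open>Q' = - 2 Z \<bullet> (K - m) Z\<close> with \<open>K = diag \<kappa>\<close>, all terms with \<open>R\<close> cancelling. Near \<open>-\<infinity>\<close> the matrix
  \<open>m\<close> is small, so \<open>Q\<close> decreases there; it starts from the limit \<open>0\<close> and is nonnegative, so it
  vanishes near \<open>-\<infinity>\<close>, and then everywhere by Gronwall's inequality.

  At \<open>+\<infinity>\<close> the second identity becomes \<open>K G + G K = G\<^sup>2\<close> for the full Gram matrix \<open>G\<close>. Hence \<open>G\<^sup>2\<close> commutes with \<open>K\<close>, and \<open>G\<close> has no entries between different eigenvalues.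
  Equal eigenvalues have proportional eigenfunctions, as decaying eigenfunctions with the same
  eigenvalue have Wronskian zero; normalization makes these entries \<open>1\<close> or \<open>-1\<close>. The diagonal of the
  equation then says that \<open>2 \<kappa>\<^sub>i\<close> is the multiplicity of \<open>\<mu>\<^sub>i\<close>
  (\<open>normalized_solution_multiplicity\<close>), which leaves multiplicity three with \<open>\<kappa> = 3/2\<close>, or
  multiplicities two and one with \<open>\<kappa> = 1\<close> and \<open>\<kappa> = 1/2\<close>.

  In the first case the identities reduce to the logistic equation \<open>m' = 3 m (1 - m)\<close>, solved by a
  shifted \<open>(1 + tanh (3 x / 2)) / 2\<close>. In the second case restrict \<open>u\<close> and \<open>m\<close> to the first and
  third component. Then \<open>v = (1 - m)\<^sup>-\<^sup>1 u\<close> solves \<open>v' = K v\<close>, so \<open>v\<close> is a pair of exponentials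
  \<open>A e\<^sup>x\<close>, \<open>B e\<^sup>x\<^sup>/\<^sup>2\<close>; and \<open>(1 - m)\<^sup>-\<^sup>1\<close> has derivative \<open>v v\<^sup>T\<close>, so \<open>m\<close> and \<open>u\<close> are explicit.
  Conversely, every solution of the Kay-Moses system for which the diagonal entries of \<open>m\<close> tend to
  \<open>1\<close> at \<open>+\<infinity>\<close> is a normalized solution (\<open>kay_moses_imp_normalized_solution\<close>), so both families are
  verified through this system.
\<close>

section \<open>Weak derivatives\<close>

lemma continuous_on_of_deriv:
  fixes f :: "real \<Rightarrow> real"
  assumes "\<And>x. (f has_real_derivative f' x) (at x)"
  shows "continuous_on UNIV f"
proof (rule continuous_at_imp_continuous_on, rule ballI)
  fix x show "isCont f x" using assms[of x] by (rule DERIV_isCont)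
qed

lemma antiderivative_exists:
  assumes "continuous_on UNIV (u :: real \<Rightarrow> real)"
  obtains U where "\<And>x. (U has_real_derivative u x) (at x)"
  using einterval_antiderivative[of "-\<infinity>" "\<infinity>" u] assms
  by (auto simp: has_real_derivative_iff_has_vector_derivative continuous_on_eq_continuous_at)

lemma locally_integrable_continuous:
  assumes "continuous_on UNIV (u :: real \<Rightarrow> real)"
  shows "locally_integrable u"
  unfolding locally_integrable_def
  by (auto intro!: borel_integrable_atLeastAtMost' continuous_on_subset[OF assms])

lemma test_functionE:
  assumes "test_function \<phi>"
  obtains R where "R > 0" "\<And>x. (\<phi> has_real_derivative deriv \<phi> x) (at x)"
    "continuous_on UNIV (deriv \<phi>)" "\<And>x. \<bar>x\<bar> \<ge> R \<Longrightarrow> \<phi> x = 0" "\<And>x. \<bar>x\<bar> \<ge> R \<Longrightarrow> deriv \<phi> x = 0"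
proof -
  obtain D where D: "\<And>x. (\<phi> has_real_derivative D x) (at x)" "continuous_on UNIV D"
    using assms unfolding test_function_def C1_differentiable_on_def
    by (auto simp: has_real_derivative_iff_has_vector_derivative)
  have DD: "deriv \<phi> = D" using D(1) by (auto intro!: DERIV_imp_deriv)
  have "bounded (closure {x. \<phi> x \<noteq> 0})"
    using assms unfolding test_function_def by (auto intro: compact_imp_bounded)
  then obtain r where r: "r > 0" "\<And>x. x \<in> closure {x. \<phi> x \<noteq> 0} \<Longrightarrow> norm x \<le> r"
    by (auto simp: bounded_pos)
  have z: "\<phi> x = 0" if "\<bar>x\<bar> > r" for x
    using r(2)[of x] that closure_subset[of "{x. \<phi> x \<noteq> 0}"] by force
  have z': "D x = 0" if "\<bar>x\<bar> > r" for x
  proof -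
    have "open {y::real. \<bar>y\<bar> > r}" by (intro open_Collect_less continuous_intros)
    then have "((\<lambda>_. 0) has_real_derivative D x) (at x)"
      by (rule has_field_derivative_transform_within_open[OF D(1)]) (use that z in auto)
    then show ?thesis by (metis DERIV_const DERIV_unique)
  qed
  show ?thesis
    by (rule that[of "r + 1"]) (use r z z' D in \<open>auto simp: DD\<close>)
qed

lemma test_functionI:
  assumes "\<And>x. (\<phi> has_real_derivative D x) (at x)" "continuous_on UNIV D"
    "\<And>x. \<bar>x\<bar> \<ge> R \<Longrightarrow> \<phi> x = 0"
  shows "test_function \<phi>"
proof -
  have "{x. \<phi> x \<noteq> 0} \<subseteq> {-R..R}" using assms(3) by (force simp: abs_le_iff)
  then have "closure {x. \<phi> x \<noteq> 0} \<subseteq> {-R..R}" by (rule closure_minimal) simp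
  then have "compact (closure {x. \<phi> x \<noteq> 0})"
    by (metis closed_closure compact_Icc compact_Int_closed inf.absorb2)
  then show ?thesis unfolding test_function_def C1_differentiable_on_def
    using assms(1,2) by (auto simp: has_real_derivative_iff_has_vector_derivative)
qed

lemma has_weak_deriv_classical:
  assumes u: "\<And>x. (u has_real_derivative v x) (at x)" and v: "continuous_on UNIV v"
  shows "has_weak_deriv u v"
  unfolding has_weak_deriv_def
proof (intro conjI allI impI)
  have cu: "continuous_on UNIV u"
    using u by (rule continuous_on_of_deriv)
  show "locally_integrable u" "locally_integrable v"
    using cu v by (auto intro: locally_integrable_continuous)
  fix \<phi> assume "test_function \<phi>"
  then obtain R where R: "R > 0" "\<And>x. (\<phi> has_real_derivative deriv \<phi> x) (at x)"
    "continuous_on UNIV (deriv \<phi>)" "\<And>x. \<bar>x\<bar> \<ge> R \<Longrightarrow> \<phi> x = 0" "\<And>x. \<bar>x\<bar> \<ge> R \<Longrightarrow> deriv \<phi> x = 0"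
    by (rule test_functionE) blast
  have "(LINT x|lborel. u x * deriv \<phi> x) = (LINT x|lborel. (u x * deriv \<phi> x) * indicator {-R..R} x)"
    by (rule Bochner_Integration.integral_cong) (use R in \<open>auto split: split_indicator\<close>)
  also have "\<dots> = u R * \<phi> R - u (-R) * \<phi> (-R) - (LINT x|lborel. (v x * \<phi> x) * indicator {-R..R} x)"
    by (rule integral_by_parts) (use R u v in \<open>auto simp: continuous_on_eq_continuous_at\<close>)
  also have "\<dots> = - (LINT x|lborel. (v x * \<phi> x) * indicator {-R..R} x)"
    using R by auto
  also have "(LINT x|lborel. (v x * \<phi> x) * indicator {-R..R} x) = (LINT x|lborel. v x * \<phi> x)"
    by (rule Bochner_Integration.integral_cong) (use R in \<open>auto split: split_indicator\<close>)
  finally show "(LINT x|lborel. u x * deriv \<phi> x) = - (LINT x|lborel. v x * \<phi> x)" .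
qed

lemma has_real_derivative_max_power2:
  "((\<lambda>x::real. (max 0 x)\<^sup>2) has_real_derivative 2 * max 0 x) (at x)"
proof (cases "x = 0")
  case True
  have "((\<lambda>h::real. (max 0 h)\<^sup>2 / h) \<longlongrightarrow> 0) (at 0)"
  proof (rule Lim_null_comparison)
    show "\<forall>\<^sub>F h in at (0::real). norm ((max 0 h)\<^sup>2 / h) \<le> \<bar>h\<bar>"
      by (rule always_eventually) (auto simp: max_def power2_eq_square)
    show "((\<lambda>h::real. \<bar>h\<bar>) \<longlongrightarrow> 0) (at 0)"
      by (rule tendsto_rabs_zero) (rule tendsto_ident_at)
  qed
  then show ?thesis using True by (simp add: DERIV_def)
next
  case False
  show ?thesis
  proof (cases "x > 0")
    case True
    have "((\<lambda>x. x\<^sup>2) has_real_derivative 2 * x) (at x)" by (auto intro!: derivative_eq_intros)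
    then have "((\<lambda>x. (max 0 x)\<^sup>2) has_real_derivative 2 * x) (at x)"
      by (rule has_field_derivative_transform_within_open[where S = "{0<..}"]) (use True in auto)
    then show ?thesis using True by simp
  next
    case neg: False
    have "((\<lambda>x. 0) has_real_derivative 0) (at x)" by simp
    then have "((\<lambda>x. (max 0 x)\<^sup>2) has_real_derivative 0) (at x)"
      by (rule has_field_derivative_transform_within_open[where S = "{..<0}"]) (use neg False in auto)
    then show ?thesis using neg by simp
  qed
qed

text \<open>The primitive, vanishing at \<open>-\<infinity>\<close>, of the indicator function of the interval from \<open>a\<close> to
  \<open>a + h\<close>. A difference of two such functions with the same \<open>h\<close> has compact support but is not \<open>C\<^sup>1\<close>, so it is a test
  function only after smoothing.\<close>

definition trapezoid :: "real \<Rightarrow> real \<Rightarrow> real \<Rightarrow> real" where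
  "trapezoid a h x = max 0 (x - a) - max 0 (x - a - h)"

lemma trapezoid_bounds: "h \<ge> 0 \<Longrightarrow> 0 \<le> trapezoid a h x" "h \<ge> 0 \<Longrightarrow> trapezoid a h x \<le> h"
  by (auto simp: trapezoid_def)

text \<open>The four facts needed to apply dominated convergence to a locally integrable function times
  bounded functions that are supported in a fixed interval.\<close>

lemma integrable_dominated_compact:
  assumes v: "locally_integrable v" and f: "f \<in> borel_measurable lborel"
    and C: "\<And>x. \<bar>f x\<bar> \<le> C" and R: "\<And>x. \<bar>x\<bar> \<ge> R \<Longrightarrow> f x = 0"
  shows "integrable lborel (\<lambda>x. v x * f x)"
    and "AE x in lborel. norm (v x * f x) \<le> C * \<bar>indicator {-R..R} x * v x\<bar>"
    and "integrable lborel (\<lambda>x. C * \<bar>indicator {-R..R} x * v x\<bar>)"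
    and "(\<lambda>x. v x * f x) \<in> borel_measurable lborel"
proof -
  have i: "integrable lborel (\<lambda>x. indicator {-R..R} x * v x)"
    using v by (auto simp: locally_integrable_def set_integrable_def)
  then show i2: "integrable lborel (\<lambda>x. C * \<bar>indicator {-R..R} x * v x\<bar>)" by auto
  have eq: "(\<lambda>x. v x * f x) = (\<lambda>x. (indicator {-R..R} x * v x) * f x)"
    using R by (auto simp: fun_eq_iff split: split_indicator)
  show m: "(\<lambda>x. v x * f x) \<in> borel_measurable lborel"
    unfolding eq using borel_measurable_integrable[OF i] f by measurable
  have C0: "C \<ge> 0" using C[of 0] by linarith
  show a: "AE x in lborel. norm (v x * f x) \<le> C * \<bar>indicator {-R..R} x * v x\<bar>"
  proof (rule AE_I2)
    fix x
    have "v x * f x = (indicator {-R..R} x * v x) * f x" using eq by metis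
    then have "norm (v x * f x) = \<bar>f x\<bar> * \<bar>indicator {-R..R} x * v x\<bar>"
      by (metis abs_mult mult.commute real_norm_def)
    also have "\<dots> \<le> C * \<bar>indicator {-R..R} x * v x\<bar>" by (intro mult_right_mono C) auto
    finally show "norm (v x * f x) \<le> C * \<bar>indicator {-R..R} x * v x\<bar>" .
  qed
  show "integrable lborel (\<lambda>x. v x * f x)"
    by (rule Bochner_Integration.integrable_bound[OF i2 m]) (use a in eventually_elim, auto)
qed

lemma integral_mult_tendsto:
  assumes v: "locally_integrable v" and f: "\<And>n::nat. f n \<in> borel_measurable lborel"
    and g: "g \<in> borel_measurable lborel"
    and C: "\<And>n x. \<bar>f n x\<bar> \<le> C" and R: "\<And>n x. \<bar>x\<bar> \<ge> R \<Longrightarrow> f n x = 0"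
    and lim: "\<And>x. (\<lambda>n. f n x) \<longlonglongrightarrow> g x"
  shows "(\<lambda>n. LINT x|lborel. v x * f n x) \<longlonglongrightarrow> (LINT x|lborel. v x * g x)"
proof (rule integral_dominated_convergence[where w = "\<lambda>x. C * \<bar>indicator {-R..R} x * v x\<bar>"])
  have "\<bar>g x\<bar> \<le> C" for x
    using LIMSEQ_le_const2[OF tendsto_rabs[OF lim]] C by blast
  moreover have "g x = 0" if "\<bar>x\<bar> \<ge> R" for x
    using lim[of x] R[OF that] by (simp add: LIMSEQ_const_iff)
  ultimately show "(\<lambda>x. v x * g x) \<in> borel_measurable lborel"
    using integrable_dominated_compact(4)[OF v g] by blast
  show "integrable lborel (\<lambda>x. C * \<bar>indicator {-R..R} x * v x\<bar>)"
    by (rule integrable_dominated_compact(3)[OF v f C R])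
  fix n
  show "(\<lambda>x. v x * f n x) \<in> borel_measurable lborel"
    by (rule integrable_dominated_compact(4)[OF v f C R])
  show "AE x in lborel. norm (v x * f n x) \<le> C * \<bar>indicator {-R..R} x * v x\<bar>"
    by (rule integrable_dominated_compact(2)[OF v f C R])
next
  show "AE x in lborel. (\<lambda>n. v x * f n x) \<longlonglongrightarrow> v x * g x"
    by (intro AE_I2 tendsto_mult_left lim)
qed

text \<open>A \<open>C\<^sup>1\<close> approximation of \<open>max 0\<close>, and (below) its derivative, which is a continuous approximation
  of the Heaviside function.\<close>

definition smooth_ramp :: "real \<Rightarrow> real \<Rightarrow> real" where
  "smooth_ramp e y = ((max 0 y)\<^sup>2 - (max 0 (y - e))\<^sup>2) / (2 * e)"

definition ramp_step :: "real \<Rightarrow> real \<Rightarrow> real" where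
  "ramp_step e y = (max 0 y - max 0 (y - e)) / e"

lemma smooth_ramp_deriv:
  "e > 0 \<Longrightarrow> ((\<lambda>x. smooth_ramp e (x - c)) has_real_derivative ramp_step e (x - c)) (at x)"
proof -
  assume e: "e > 0"
  have "((\<lambda>x. (max 0 (x - d))\<^sup>2) has_real_derivative 2 * max 0 (x - d)) (at x)" for d
    by (rule DERIV_cong[OF DERIV_chain2[OF has_real_derivative_max_power2]])
      (auto intro!: derivative_eq_intros)
  from DERIV_cdivide[OF DERIV_diff[OF this[of c] this[of "c + e"]], of "2 * e"] show ?thesis
    unfolding smooth_ramp_def ramp_step_def using e
    by (simp add: diff_diff_eq diff_divide_distrib)
qed

lemma smooth_ramp_nonpos: "e > 0 \<Longrightarrow> y \<le> 0 \<Longrightarrow> smooth_ramp e y = 0"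
  by (auto simp: smooth_ramp_def)

lemma smooth_ramp_large: "e > 0 \<Longrightarrow> y \<ge> e \<Longrightarrow> smooth_ramp e y = y - e / 2"
  by (auto simp: smooth_ramp_def field_simps power2_eq_square)

lemma smooth_ramp_approx:
  assumes "e > 0" shows "\<bar>smooth_ramp e y - max 0 y\<bar> \<le> e / 2"
proof -
  consider "y \<le> 0" | "0 \<le> y" "y \<le> e" | "y \<ge> e" by linarith
  then show ?thesis
  proof cases
    case 2
    then have "max 0 y - smooth_ramp e y = e / 2 - (e - y)\<^sup>2 / (2 * e)"
      using assms by (auto simp: smooth_ramp_def max_def field_simps power2_eq_square)
    moreover have "(e - y)\<^sup>2 \<le> e\<^sup>2" using 2 by (intro power_mono) auto
    then have "(e - y)\<^sup>2 / (2 * e) \<le> e / 2"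
      using assms by (simp add: field_simps power2_eq_square)
    moreover have "(e - y)\<^sup>2 / (2 * e) \<ge> 0" using assms by simp
    ultimately show ?thesis by linarith
  qed (use assms smooth_ramp_nonpos smooth_ramp_large in auto)
qed

lemma ramp_step_bounds: "e > 0 \<Longrightarrow> 0 \<le> ramp_step e y \<and> ramp_step e y \<le> 1"
  by (auto simp: ramp_step_def field_simps max_def)

lemma ramp_step_nonpos: "e > 0 \<Longrightarrow> y \<le> 0 \<Longrightarrow> ramp_step e y = 0"
  by (auto simp: ramp_step_def)

lemma ramp_step_large: "e > 0 \<Longrightarrow> y \<ge> e \<Longrightarrow> ramp_step e y = 1"
  by (auto simp: ramp_step_def)

lemma ramp_step_tendsto:
  "(\<lambda>n. ramp_step (1 / real (Suc n)) y) \<longlonglongrightarrow> indicator {0<..} y"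
proof (cases "y > 0")
  case True
  have "(\<lambda>n. 1 / real (Suc n)) \<longlonglongrightarrow> 0" using LIMSEQ_inverse_real_of_nat by (simp add: field_simps)
  then have "\<forall>\<^sub>F n in sequentially. 1 / real (Suc n) < y" using True by (rule order_tendstoD)
  then have "\<forall>\<^sub>F n in sequentially. ramp_step (1 / real (Suc n)) y = indicator {0<..} y"
    by eventually_elim (use True in \<open>auto simp: ramp_step_large\<close>)
  then show ?thesis by (rule tendsto_eventually)
qed (auto simp: ramp_step_nonpos)

lemma smooth_ramp_tendsto:
  "(\<lambda>n. smooth_ramp (1 / real (Suc n)) y) \<longlonglongrightarrow> max 0 y"
proof (rule Lim_transform2[OF tendsto_const])
  have l: "(\<lambda>n. 1 / real (Suc n)) \<longlonglongrightarrow> 0"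
    using LIMSEQ_inverse_real_of_nat by (simp add: field_simps)
  show "(\<lambda>n. max 0 y - smooth_ramp (1 / real (Suc n)) y) \<longlonglongrightarrow> 0"
  proof (rule Lim_null_comparison[OF always_eventually[OF allI] l])
    fix n
    have "\<bar>smooth_ramp (1 / real (Suc n)) y - max 0 y\<bar> \<le> 1 / real (Suc n) / 2"
      by (rule smooth_ramp_approx) simp
    also have "\<dots> \<le> 1 / real (Suc n)" by (simp add: field_simps)
    finally show "norm (max 0 y - smooth_ramp (1 / real (Suc n)) y) \<le> 1 / real (Suc n)"
      by (simp only: real_norm_def abs_minus_commute)
  qed
qed

text \<open>The difference of two trapezoids is a limit of test functions whose derivatives tend to the
  difference of two indicator functions. Both intervals have the same length, which is what makes
  the test functions vanish for large arguments.\<close>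

lemma weak_deriv_trapezoid:
  assumes w: "has_weak_deriv u v" and h: "h > 0"
  shows "(LBINT x=a..ereal (a + h). u x) - (LBINT x=b..ereal (b + h). u x)
          = - (LINT x|lborel. v x * (trapezoid a h x - trapezoid b h x))"
proof -
  have lu: "locally_integrable u" and lv: "locally_integrable v"
    using w by (auto simp: has_weak_deriv_def)
  define e where "e n = 1 / real (Suc n)" for n
  have e: "e n > 0" "e n \<le> 1" for n by (auto simp: e_def field_simps)
  define \<phi> where "\<phi> n x = smooth_ramp (e n) (x - a) - smooth_ramp (e n) (x - (a + h))
      - smooth_ramp (e n) (x - b) + smooth_ramp (e n) (x - (b + h))" for n x
  define \<phi>' where "\<phi>' n x = ramp_step (e n) (x - a) - ramp_step (e n) (x - (a + h))
      - ramp_step (e n) (x - b) + ramp_step (e n) (x - (b + h))" for n x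
  define R where "R = \<bar>a\<bar> + \<bar>b\<bar> + h + 1"
  have z: "\<phi> n x = 0 \<and> \<phi>' n x = 0" if x: "\<bar>x\<bar> \<ge> R" for n x
  proof (cases "x < 0")
    case True
    then have "x - a \<le> 0" "x - b \<le> 0" "x - (a + h) \<le> 0" "x - (b + h) \<le> 0"
      using x h by (auto simp: R_def)
    then show ?thesis using e[of n] by (simp add: \<phi>_def \<phi>'_def smooth_ramp_nonpos ramp_step_nonpos)
  next
    case False
    then have "x - a \<ge> e n" "x - b \<ge> e n" "x - (a + h) \<ge> e n" "x - (b + h) \<ge> e n"
      using x h e[of n] by (auto simp: R_def)
    then show ?thesis using e[of n] by (simp add: \<phi>_def \<phi>'_def smooth_ramp_large ramp_step_large)
  qed
  have c': "continuous_on UNIV (\<phi>' n)" for n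
    unfolding \<phi>'_def ramp_step_def using e[of n] by (intro continuous_intros) auto
  have d: "(\<phi> n has_real_derivative \<phi>' n x) (at x)" for n x
    unfolding \<phi>_def[abs_def] \<phi>'_def using e[of n]
    by (intro DERIV_diff DERIV_add smooth_ramp_deriv)
  then have dd: "deriv (\<phi> n) = \<phi>' n" for n by (auto intro!: DERIV_imp_deriv)
  have t: "test_function (\<phi> n)" for n by (rule test_functionI[OF d c']) (use z in blast)
  have c: "continuous_on UNIV (\<phi> n)" for n
    using d by (rule continuous_on_of_deriv)
  have eq: "(LINT x|lborel. u x * \<phi>' n x) = - (LINT x|lborel. v x * \<phi> n x)" for n
    using w t[of n] unfolding has_weak_deriv_def dd[symmetric] by blast
  have L1: "(\<lambda>n. LINT x|lborel. u x * \<phi>' n x) \<longlonglongrightarrow>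
      (LINT x|lborel. u x * (indicator {a<..a+h} x - indicator {b<..b+h} x))"
  proof (rule integral_mult_tendsto[OF lu])
    show "\<bar>\<phi>' n x\<bar> \<le> 2" for n x
      using ramp_step_bounds[OF e(1)[of n], of "x - a"] ramp_step_bounds[OF e(1)[of n], of "x - b"]
       ramp_step_bounds[OF e(1)[of n], of "x - (a+h)"] ramp_step_bounds[OF e(1)[of n], of "x - (b+h)"]
      unfolding \<phi>'_def abs_le_iff by linarith
    show "(\<lambda>n. \<phi>' n x) \<longlonglongrightarrow> (indicator {a<..a+h} x - indicator {b<..b+h} x)" for x
    proof -
      have "(\<lambda>n. \<phi>' n x) \<longlonglongrightarrow> indicator {0<..} (x - a) - indicator {0<..} (x - (a+h))
        - indicator {0<..} (x - b) + indicator {0<..} (x - (b+h))"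
        unfolding \<phi>'_def e_def by (intro tendsto_intros ramp_step_tendsto)
      also have "indicator {0<..} (x - a) - indicator {0<..} (x - (a+h))
        - indicator {0<..} (x - b) + indicator {0<..} (x - (b+h))
        = (indicator {a<..a+h} x - indicator {b<..b+h} x :: real)"
        using h by (auto split: split_indicator)
      finally show ?thesis .
    qed
    show "\<phi>' n \<in> borel_measurable lborel" for n
      using borel_measurable_continuous_onI[OF c'] by simp
  qed (use z in auto)
  have L2: "(\<lambda>n. LINT x|lborel. v x * \<phi> n x) \<longlonglongrightarrow>
      (LINT x|lborel. v x * (trapezoid a h x - trapezoid b h x))"
  proof (rule integral_mult_tendsto[OF lv])
    show "\<bar>\<phi> n x\<bar> \<le> 2 + 2 * h" for n x
    proof -
      have "\<bar>\<phi> n x - (trapezoid a h x - trapezoid b h x)\<bar> \<le> 2"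
        using smooth_ramp_approx[OF e(1)[of n], of "x - a"] smooth_ramp_approx[OF e(1)[of n], of "x - b"]
         smooth_ramp_approx[OF e(1)[of n], of "x - (a+h)"] smooth_ramp_approx[OF e(1)[of n], of "x - (b+h)"]
         e(2)[of n]
        unfolding \<phi>_def trapezoid_def abs_le_iff diff_diff_eq by linarith
      then show ?thesis using trapezoid_bounds[of h a x] trapezoid_bounds[of h b x] h by linarith
    qed
    show "(\<lambda>n. \<phi> n x) \<longlonglongrightarrow> trapezoid a h x - trapezoid b h x" for x
    proof -
      have "(\<lambda>n. \<phi> n x) \<longlonglongrightarrow> max 0 (x - a) - max 0 (x - (a+h)) - max 0 (x - b) + max 0 (x - (b+h))"
        unfolding \<phi>_def e_def by (intro tendsto_intros smooth_ramp_tendsto)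
      then show ?thesis by (simp add: trapezoid_def algebra_simps)
    qed
    show "\<phi> n \<in> borel_measurable lborel" for n
      using borel_measurable_continuous_onI[OF c] by simp
    show "(\<lambda>x. trapezoid a h x - trapezoid b h x) \<in> borel_measurable lborel"
      unfolding trapezoid_def by measurable
  qed (use z in auto)
  have "(LINT x|lborel. u x * (indicator {a<..a+h} x - indicator {b<..b+h} x))
     = - (LINT x|lborel. v x * (trapezoid a h x - trapezoid b h x))"
    by (rule LIMSEQ_unique[OF L1]) (use tendsto_minus[OF L2] eq in simp)
  moreover have i: "integrable lborel (\<lambda>x. u x * indicator {c<..c+h} x)" for c
    by (rule integrable_dominated_compact(1)[OF lu, where C = 1 and R = "\<bar>c\<bar> + h + 1"])
      (use h in \<open>auto split: split_indicator\<close>)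
  have "(LINT x|lborel. u x * (indicator {a<..a+h} x - indicator {b<..b+h} x))
    = (LINT x|lborel. u x * indicator {a<..a+h} x) - (LINT x|lborel. u x * indicator {b<..b+h} x)"
    using i[of a] i[of b] by (simp add: right_diff_distrib)
  moreover have "(LINT x|lborel. u x * indicator {c<..c+h} x) = (LBINT x=c..ereal (c + h). u x)" for c
    using h by (simp add: interval_integral_Ioc set_lebesgue_integral_def mult.commute)
  ultimately show ?thesis by simp
qed

text \<open>Divide \<open>weak_deriv_trapezoid\<close> by \<open>h\<close> and let \<open>h\<close> tend to \<open>0\<close>: the averages on the left converge
  by continuity, and the trapezoids on the right become the indicator function of the interval
  from \<open>a\<close> to \<open>b\<close>.\<close>

lemma weak_deriv_continuous_FTC:
  assumes w: "has_weak_deriv u v" and u: "continuous_on UNIV u" and ab: "a \<le> b"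
  shows "u b - u a = (LBINT x=a..b. v x)"
proof -
  have lv: "locally_integrable v"
    using w by (auto simp: has_weak_deriv_def)
  define h where "h n = 1 / real (Suc n)" for n
  have h: "h n > 0" "h n \<le> 1" for n by (auto simp: h_def field_simps)
  have h0: "h \<longlonglongrightarrow> 0" unfolding h_def using LIMSEQ_inverse_real_of_nat by (simp add: field_simps)
  obtain U where U: "\<And>x. (U has_real_derivative u x) (at x)"
    using antiderivative_exists[OF u] by blast
  have FTC: "(LBINT x=c..ereal (c + t). u x) = U (c + t) - U c" if "t > 0" for c t
    by (rule interval_integral_FTC_finite)
      (use u U in \<open>auto simp: has_real_derivative_iff_has_vector_derivative
         intro: continuous_on_subset has_vector_derivative_at_within\<close>)
  have q: "(\<lambda>n. (U (c + h n) - U c) / h n) \<longlonglongrightarrow> u c" for c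
  proof -
    have "((\<lambda>t. (U (c + t) - U c) / t) \<longlongrightarrow> u c) (at 0)" using U[of c] by (simp add: DERIV_def)
    moreover have "filterlim h (at 0) sequentially"
      using h0 h by (auto simp: filterlim_at intro!: always_eventually) (metis less_irrefl)
    ultimately show ?thesis by (rule filterlim_compose)
  qed
  define f where "f n x = (trapezoid a (h n) x - trapezoid b (h n) x) / h n" for n x
  have eq: "(U (a + h n) - U a) / h n - (U (b + h n) - U b) / h n = - (LINT x|lborel. v x * f n x)" for n
  proof -
    have "(U (a + h n) - U a) - (U (b + h n) - U b)
       = - (LINT x|lborel. v x * (trapezoid a (h n) x - trapezoid b (h n) x))"
      using weak_deriv_trapezoid[OF w h(1), of a n b] FTC[OF h(1)] by simp
    then have "(U (a + h n) - U a) / h n - (U (b + h n) - U b) / h n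
       = - (LINT x|lborel. v x * (trapezoid a (h n) x - trapezoid b (h n) x)) / h n"
      by (metis diff_divide_distrib minus_divide_left)
    then show ?thesis by (simp add: f_def)
  qed
  have "(\<lambda>n. LINT x|lborel. v x * f n x) \<longlonglongrightarrow> (LINT x|lborel. v x * indicator {a<..b} x)"
  proof (rule integral_mult_tendsto[OF lv])
    show "\<bar>f n x\<bar> \<le> 1" for n x
      using trapezoid_bounds[of "h n" a x] trapezoid_bounds[of "h n" b x] h[of n]
      by (auto simp: f_def field_simps abs_le_iff)
    show "f n x = 0" if "\<bar>x\<bar> \<ge> \<bar>a\<bar> + \<bar>b\<bar> + 1" for n x
      using that h[of n] by (auto simp: f_def trapezoid_def max_def)
    show "(\<lambda>n. f n x) \<longlonglongrightarrow> indicator {a<..b} x" for x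
    proof -
      have "f n x = ramp_step (h n) (x - a) - ramp_step (h n) (x - b)" for n
        by (simp add: f_def ramp_step_def trapezoid_def diff_divide_distrib)
      moreover have "(\<lambda>n. ramp_step (h n) (x - a) - ramp_step (h n) (x - b))
         \<longlonglongrightarrow> indicator {0<..} (x - a) - indicator {0<..} (x - b)"
        unfolding h_def by (intro tendsto_intros ramp_step_tendsto)
      moreover have "indicator {0<..} (x - a) - indicator {0<..} (x - b) = (indicator {a<..b} x :: real)"
        using ab by (auto split: split_indicator)
      ultimately show ?thesis by simp
    qed
    show "f n \<in> borel_measurable lborel" for n
      unfolding f_def trapezoid_def by measurable
  qed auto
  then have "(\<lambda>n. (U (a + h n) - U a) / h n - (U (b + h n) - U b) / h n)
     \<longlonglongrightarrow> - (LINT x|lborel. v x * indicator {a<..b} x)"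
    unfolding eq by (rule tendsto_minus)
  moreover have "(\<lambda>n. (U (a + h n) - U a) / h n - (U (b + h n) - U b) / h n) \<longlonglongrightarrow> u a - u b"
    by (intro tendsto_intros q)
  ultimately have "u a - u b = - (LINT x|lborel. v x * indicator {a<..b} x)"
    using LIMSEQ_unique by blast
  also have "(LINT x|lborel. v x * indicator {a<..b} x) = (LBINT x=a..b. v x)"
    using ab by (simp add: interval_integral_Ioc set_lebesgue_integral_def mult.commute)
  finally show ?thesis by simp
qed

text \<open>Averaging \<open>k (s + h) - k s\<close> over \<open>s\<close> between \<open>0\<close> and \<open>1\<close> expresses \<open>k h - k 0\<close> by an antiderivative
  of \<open>k\<close>. So a merely continuous \<open>k\<close> with increments independent of the base point is differentiable,
  and its derivative is constant.\<close>

lemma constant_increments_deriv: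
  assumes k: "continuous_on UNIV (k :: real \<Rightarrow> real)"
    and inc: "\<And>a b h. h > 0 \<Longrightarrow> k (a + h) - k a = k (b + h) - k b"
  shows "(k has_real_derivative k 2 - k 1) (at x)"
proof -
  obtain K where K: "\<And>x. (K has_real_derivative k x) (at x)" using antiderivative_exists[OF k] by blast
  have Kc: "((\<lambda>x. K (x + c)) has_real_derivative k (x + c)) (at x)" for x c
    using K[of "x + c"] by (simp add: DERIV_shift)
  have mean: "k h - k 0 = (K (1 + h) - K h) - (K 1 - K 0)" if h: "h > 0" for h
  proof -
    have "((\<lambda>s. K (s + h) - K s - s * (k h - k 0)) has_real_derivative k (s + h) - k s - (k h - k 0)) (at s)" for s
      using Kc[of h s] K[of s] by (auto intro!: derivative_eq_intros)
    moreover have "k (s + h) - k s - (k h - k 0) = 0" for s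
      using inc[OF h, of s 0] by simp
    ultimately have "((\<lambda>s. K (s + h) - K s - s * (k h - k 0)) has_real_derivative 0) (at s)" for s
      by metis
    then have "K (1 + h) - K 1 - 1 * (k h - k 0) = K (0 + h) - K 0 - 0 * (k h - k 0)"
      by (intro DERIV_isconst_all[of "\<lambda>s. K (s + h) - K s - s * (k h - k 0)" 1 0]) auto
    then show ?thesis by simp
  qed
  \<comment> \<open>Increments are taken from the base point \<open>x - 1\<close>, so that near \<open>x\<close> they have positive length.\<close>
  let ?y = "x - 1"
  have "((\<lambda>t. k ?y + (K (t + (1 - ?y)) - K (t + (- ?y)) - (K 1 - K 0)))
     has_real_derivative k 2 - k 1) (at x)"
    using Kc[of "1 - ?y" x] Kc[of "- ?y" x] by (auto intro!: derivative_eq_intros)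
  then show ?thesis
  proof (rule has_field_derivative_transform_within_open[where S = "{?y<..}"])
    fix t assume "t \<in> {?y<..}"
    then have "t - ?y > 0" by simp
    from inc[OF this, of ?y 0] mean[OF this]
    show "k ?y + (K (t + (1 - ?y)) - K (t + (- ?y)) - (K 1 - K 0)) = k t"
      by (simp add: algebra_simps)
  qed auto
qed

text \<open>Regularity of weak solutions. Compare \<open>u\<close> with a classical second antiderivative \<open>H\<close> of \<open>g\<close>:
  by \<open>weak_deriv_trapezoid\<close> the increments of \<open>u\<close> and of \<open>H\<close> over two intervals of equal length differ
  by the same integral of \<open>g\<close>. Hence \<open>u - H\<close> has increments independent of the base point.\<close>

lemma weak_second_deriv_classical:
  assumes u: "continuous_on UNIV u" and w1: "has_weak_deriv u u'" and w2: "has_weak_deriv u' u''"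
    and g: "continuous_on UNIV g" and ae: "AE x in lborel. u'' x = g x"
  shows "\<exists>w. (\<forall>x. (u has_real_derivative w x) (at x)) \<and> (\<forall>x. (w has_real_derivative g x) (at x))"
proof -
  obtain G where G: "\<And>x. (G has_real_derivative g x) (at x)" using antiderivative_exists[OF g] by blast
  then have cG: "continuous_on UNIV G" by (rule continuous_on_of_deriv)
  obtain H where H: "\<And>x. (H has_real_derivative G x) (at x)" using antiderivative_exists[OF cG] by blast
  then have cH: "continuous_on UNIV H" by (rule continuous_on_of_deriv)
  define k where "k x = u x - H x" for x
  have "k (a + h) - k a = k (b + h) - k b" if h: "h > 0" for a b h
  proof -
    have "(u (a + h) - u a) - (u (b + h) - u b) = - (LINT x|lborel. u'' x * (trapezoid a h x - trapezoid b h x))"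
      using weak_deriv_trapezoid[OF w2 h, of a b] h
        weak_deriv_continuous_FTC[OF w1 u, of a "a + h"] weak_deriv_continuous_FTC[OF w1 u, of b "b + h"] by simp
    also have "(LINT x|lborel. u'' x * (trapezoid a h x - trapezoid b h x))
        = (LINT x|lborel. g x * (trapezoid a h x - trapezoid b h x))"
    proof (rule integral_cong_AE)
      have m: "(\<lambda>x. v x * (trapezoid a h x - trapezoid b h x)) \<in> borel_measurable lborel"
        if "locally_integrable v" for v
      proof (rule integrable_dominated_compact(4)[OF that])
        show "(\<lambda>x. trapezoid a h x - trapezoid b h x) \<in> borel_measurable lborel"
          unfolding trapezoid_def by measurable
        show "\<bar>trapezoid a h x - trapezoid b h x\<bar> \<le> h" for x
          using trapezoid_bounds[of h a x] trapezoid_bounds[of h b x] h by linarith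
        show "trapezoid a h x - trapezoid b h x = 0" if "\<bar>x\<bar> \<ge> \<bar>a\<bar> + \<bar>b\<bar> + h" for x
          using that h by (auto simp: trapezoid_def max_def)
      qed
      show "(\<lambda>x. u'' x * (trapezoid a h x - trapezoid b h x)) \<in> borel_measurable lborel"
        "(\<lambda>x. g x * (trapezoid a h x - trapezoid b h x)) \<in> borel_measurable lborel"
        using m w2 locally_integrable_continuous[OF g] unfolding has_weak_deriv_def by blast+
    qed (use ae in eventually_elim, simp)
    also have "- (LINT x|lborel. g x * (trapezoid a h x - trapezoid b h x)) = (H (a + h) - H a) - (H (b + h) - H b)"
      using weak_deriv_trapezoid[OF has_weak_deriv_classical[OF G g] h, of a b] h
        weak_deriv_continuous_FTC[OF has_weak_deriv_classical[OF H cG] cH, of a "a + h"]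
        weak_deriv_continuous_FTC[OF has_weak_deriv_classical[OF H cG] cH, of b "b + h"] by simp
    finally show ?thesis by (simp add: k_def)
  qed
  then have k': "(k has_real_derivative k 2 - k 1) (at x)" for x
    by (intro constant_increments_deriv) (auto simp: k_def[abs_def] intro!: continuous_intros u cH)
  show ?thesis
  proof (intro exI conjI allI)
    show "(u has_real_derivative G x + (k 2 - k 1)) (at x)" for x
      using DERIV_add[OF H k'] by (simp add: k_def)
    show "((\<lambda>x. G x + (k 2 - k 1)) has_real_derivative g x) (at x)" for x
      using G[of x] by (auto intro!: derivative_eq_intros)
  qed
qed

section \<open>Decay at infinity\<close>

definition integral_below :: "(real \<Rightarrow> real) \<Rightarrow> real \<Rightarrow> real" where
  "integral_below f x = (LINT t|lborel. indicator {..x} t * f t)"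

lemma integral_below_at_top:
  assumes "integrable lborel f"
  shows "(integral_below f \<longlongrightarrow> (LINT t|lborel. f t)) at_top"
  using tendsto_integral_at_top[of lborel f] assms by (simp add: integral_below_def[abs_def])

lemma integral_below_at_bot:
  assumes f: "integrable lborel f"
  shows "(integral_below f \<longlongrightarrow> 0) at_bot"
proof -
  have "((\<lambda>y. LINT t|lborel. indicator {..-y} t * f t) \<longlongrightarrow> integral\<^sup>L lborel (\<lambda>t::real. 0::real)) at_top"
  proof (rule integral_dominated_convergence_at_top[where w = "\<lambda>t. \<bar>f t\<bar>"
        and s = "\<lambda>y t. indicator {..-y} t * f t" and f = "\<lambda>t. 0"])
    show "AE t in lborel. ((\<lambda>y. indicator {..-y} t * f t) \<longlongrightarrow> 0) at_top"
    proof (rule AE_I2)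
      fix t :: real
      have "\<forall>\<^sub>F y in at_top. indicator {..-y} t * f t = 0"
        using eventually_gt_at_top[of "- t"] by eventually_elim (auto split: split_indicator)
      then show "((\<lambda>y. indicator {..-y} t * f t) \<longlongrightarrow> 0) at_top" by (rule tendsto_eventually)
    qed
    show "\<forall>\<^sub>F y in at_top. AE t in lborel. norm (indicator {..-y} t * f t) \<le> \<bar>f t\<bar>"
      by (auto split: split_indicator)
  qed (use f in auto)
  then show ?thesis
    unfolding filterlim_at_bot_mirror by (simp add: integral_below_def)
qed

lemma integral_below_diff:
  assumes f: "integrable lborel f" and ab: "a \<le> b"
  shows "integral_below f b - integral_below f a = (LINT t:{a<..b}|lborel. f t)"
proof -
  have i: "integrable lborel (\<lambda>t. indicator {..x} t * f t)" for x
    using integrable_mult_indicator[OF _ f, of "{..x}"] by simp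
  have "integral_below f b - integral_below f a = (LINT t|lborel. indicator {..b} t * f t - indicator {..a} t * f t)"
    using i unfolding integral_below_def by simp
  also have "\<dots> = (LINT t|lborel. indicator {a<..b} t * f t)"
    by (rule Bochner_Integration.integral_cong) (use ab in \<open>auto split: split_indicator\<close>)
  finally show ?thesis by (simp add: set_lebesgue_integral_def)
qed

lemma integral_below_deriv:
  assumes f: "integrable lborel f" and c: "continuous_on UNIV f"
  shows "(integral_below f has_real_derivative f x) (at x)"
proof -
  obtain F where F: "\<And>x. (F has_real_derivative f x) (at x)" using antiderivative_exists[OF c] by blast
  have FTC: "integral_below f b - integral_below f a = F b - F a" if "a \<le> b" for a b
  proof -
    have "(LBINT x=a..b. f x) = F b - F a"
      by (rule interval_integral_FTC_finite)
        (use c F in \<open>auto simp: has_real_derivative_iff_has_vector_derivative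
         intro: continuous_on_subset has_vector_derivative_at_within\<close>)
    then show ?thesis using that integral_below_diff[OF f that] by (simp add: interval_integral_Ioc)
  qed
  have "integral_below f y = F y + (integral_below f 0 - F 0)" for y
    using FTC[of 0 y] FTC[of y 0] by (cases "y \<ge> 0") auto
  then have "integral_below f = (\<lambda>y. F y + (integral_below f 0 - F 0))" by blast
  moreover have "((\<lambda>y. F y + (integral_below f 0 - F 0)) has_real_derivative f x) (at x)"
    using F[of x] by (auto intro!: derivative_eq_intros)
  ultimately show ?thesis by metis
qed

lemma integral_power2_le:
  fixes v :: "real \<Rightarrow> real"
  assumes v: "set_integrable lborel {a<..b} v" and v2: "set_integrable lborel {a<..b} (\<lambda>x. (v x)\<^sup>2)"
    and ab: "a \<le> b" "b \<le> a + 1"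
  shows "(LINT x:{a<..b}|lborel. v x)\<^sup>2 \<le> (LINT x:{a<..b}|lborel. (v x)\<^sup>2)"
proof -
  define s where "s = (LINT x:{a<..b}|lborel. v x)"
  have c: "set_integrable lborel {a<..b} (\<lambda>x. d)" for d :: real
    using ab by (auto simp: set_integrable_def integrable_indicator_iff)
  have "0 \<le> (LINT x:{a<..b}|lborel. (v x - s)\<^sup>2)"
    unfolding set_lebesgue_integral_def by (rule Bochner_Integration.integral_nonneg) (auto split: split_indicator)
  also have "\<dots> = (LINT x:{a<..b}|lborel. ((v x)\<^sup>2 - 2 * s * v x) + s\<^sup>2)"
    by (rule set_lebesgue_integral_cong) (auto simp: power2_eq_square algebra_simps)
  also have "\<dots> = (LINT x:{a<..b}|lborel. (v x)\<^sup>2 - 2 * s * v x) + (LINT x:{a<..b}|lborel. s\<^sup>2)"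
    using v v2 c by (intro set_integral_add set_integral_diff set_integrable_mult_right) auto
  also have "(LINT x:{a<..b}|lborel. (v x)\<^sup>2 - 2 * s * v x)
     = (LINT x:{a<..b}|lborel. (v x)\<^sup>2) - (LINT x:{a<..b}|lborel. 2 * s * v x)"
    using v v2 c by (intro set_integral_diff set_integrable_mult_right) auto
  also have "(LINT x:{a<..b}|lborel. 2 * s * v x) = 2 * s * s" by (simp add: s_def)
  also have "(LINT x:{a<..b}|lborel. s\<^sup>2) = (b - a) * s\<^sup>2"
    using ab by (simp add: set_lebesgue_integral_def)
  finally have "2 * s * s - (b - a) * s\<^sup>2 \<le> (LINT x:{a<..b}|lborel. (v x)\<^sup>2)" by simp
  moreover have "(b - a) * s\<^sup>2 \<le> 1 * s\<^sup>2" using ab by (intro mult_right_mono) auto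
  ultimately show ?thesis by (simp add: s_def power2_eq_square)
qed

text \<open>For every \<open>x\<close>, the square \<open>u(x)\<^sup>2\<close> is at most twice the integral of \<open>u\<^sup>2 + v\<^sup>2\<close> from \<open>x - 1\<close> to \<open>x\<close>,
  where \<open>v\<close> is the weak derivative: compare \<open>u(x)\<close> with \<open>u(y)\<close> at the point \<open>y\<close> of this interval where
  \<open>u\<^sup>2\<close> is least, and use Cauchy-Schwarz for the increment. These integrals tend to \<open>0\<close>.\<close>

lemma H1_vanishes_at_infinity:
  assumes "u \<in> H1"
  shows "(u \<longlongrightarrow> 0) at_bot" and "(u \<longlongrightarrow> 0) at_top"
proof -
  obtain v where u: "continuous_on UNIV u" and iu: "integrable lborel (\<lambda>x. (u x)\<^sup>2)"
    and iv: "integrable lborel (\<lambda>x. (v x)\<^sup>2)" and w: "has_weak_deriv u v"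
    using assms by (auto simp: H1_def square_integrable_def)
  let ?U = "integral_below (\<lambda>x. (u x)\<^sup>2)" and ?V = "integral_below (\<lambda>x. (v x)\<^sup>2)"
  let ?B = "\<lambda>x. 2 * (?U x - ?U (x - 1)) + 2 * (?V x - ?V (x - 1))"
  have bound: "(u x)\<^sup>2 \<le> ?B x" for x
  proof -
    have "\<exists>y\<in>{x-1..x}. \<forall>z\<in>{x-1..x}. (u y)\<^sup>2 \<le> (u z)\<^sup>2"
      by (rule continuous_attains_inf) (auto intro!: continuous_intros continuous_on_subset[OF u])
    then obtain y where y: "x - 1 \<le> y" "y \<le> x" and min: "\<And>z. z \<in> {x-1..x} \<Longrightarrow> (u y)\<^sup>2 \<le> (u z)\<^sup>2"
      by auto
    have su: "set_integrable lborel A (\<lambda>x. (u x)\<^sup>2)" "set_integrable lborel A (\<lambda>x. (v x)\<^sup>2)"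
      if "A \<in> sets lborel" for A
      unfolding set_integrable_def using integrable_mult_indicator[OF that] iu iv by blast+
    have "(u y)\<^sup>2 = (LINT z:{x-1<..x}|lborel. (u y)\<^sup>2)" by (simp add: set_lebesgue_integral_def)
    also have "\<dots> \<le> (LINT z:{x-1<..x}|lborel. (u z)\<^sup>2)"
      by (rule set_integral_mono) (use min su in \<open>auto simp: set_integrable_def\<close>)
    also have "\<dots> = ?U x - ?U (x - 1)" by (rule integral_below_diff[OF iu, symmetric]) simp
    finally have 1: "(u y)\<^sup>2 \<le> ?U x - ?U (x - 1)" .
    have "set_integrable lborel {y..x} v" using w by (auto simp: has_weak_deriv_def locally_integrable_def)
    then have v: "set_integrable lborel {y<..x} v" by (rule set_integrable_subset) auto
    have "u x - u y = (LINT z:{y<..x}|lborel. v z)"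
      using weak_deriv_continuous_FTC[OF w u y(2)] y(2) by (simp add: interval_integral_Ioc)
    then have "(u x - u y)\<^sup>2 \<le> (LINT z:{y<..x}|lborel. (v z)\<^sup>2)"
      using integral_power2_le[OF v su(2)] y by simp
    also have "\<dots> \<le> (LINT z:{x-1<..x}|lborel. (v z)\<^sup>2)"
      unfolding set_lebesgue_integral_def
      by (rule Bochner_Integration.integral_mono)
        (use su(2) y in \<open>auto simp: set_integrable_def split: split_indicator\<close>)
    also have "\<dots> = ?V x - ?V (x - 1)" by (rule integral_below_diff[OF iv, symmetric]) simp
    finally have 2: "(u x - u y)\<^sup>2 \<le> ?V x - ?V (x - 1)" .
    have "(u x)\<^sup>2 \<le> 2 * (u y)\<^sup>2 + 2 * (u x - u y)\<^sup>2"
      using zero_le_power2[of "u x - 2 * u y"] by (simp add: power2_eq_square algebra_simps)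
    also have "\<dots> \<le> ?B x" using 1 2 by (intro add_mono mult_left_mono) auto
    finally show ?thesis .
  qed
  have null: "(u \<longlongrightarrow> 0) F" if "(?B \<longlongrightarrow> 0) F" for F
  proof -
    have "((\<lambda>x. (u x)\<^sup>2) \<longlongrightarrow> 0) F"
      by (rule Lim_null_comparison[OF _ that]) (use bound in auto)
    then show ?thesis by simp
  qed
  have shift: "filterlim (\<lambda>x::real. x - 1) at_top at_top" "filterlim (\<lambda>x::real. x - 1) at_bot at_bot"
    using filterlim_tendsto_add_at_top[OF tendsto_const filterlim_ident, of "-1 :: real"]
      filterlim_tendsto_add_at_bot_iff[OF tendsto_const, THEN iffD2, OF filterlim_ident, of "-1"]
    by simp_all
  show "(u \<longlongrightarrow> 0) at_top"
  proof (rule null)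
    have "(?B \<longlongrightarrow> 2 * ((LINT x|lborel. (u x)\<^sup>2) - (LINT x|lborel. (u x)\<^sup>2))
       + 2 * ((LINT x|lborel. (v x)\<^sup>2) - (LINT x|lborel. (v x)\<^sup>2))) at_top"
      by (intro tendsto_intros integral_below_at_top iu iv filterlim_compose[OF _ shift(1)])
    then show "(?B \<longlongrightarrow> 0) at_top" by simp
  qed
  show "(u \<longlongrightarrow> 0) at_bot"
  proof (rule null)
    have "(?B \<longlongrightarrow> 2 * (0 - 0) + 2 * (0 - 0)) at_bot"
      by (intro tendsto_intros integral_below_at_bot iu iv filterlim_compose[OF _ shift(2)])
    then show "(?B \<longlongrightarrow> 0) at_bot" by simp
  qed
qed

lemma deriv_vanishes_at_bot:
  fixes u :: "real \<Rightarrow> real"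
  assumes u: "\<And>x. (u has_real_derivative u' x) (at x)" and u': "\<And>x. (u' has_real_derivative u'' x) (at x)"
    and "(u \<longlongrightarrow> 0) at_bot" and "(u'' \<longlongrightarrow> 0) at_bot"
  shows "(u' \<longlongrightarrow> 0) at_bot"
proof (rule tendstoI)
  fix e :: real assume e: "e > 0"
  have "\<forall>\<^sub>F x in at_bot. \<bar>u x\<bar> < e / 3" "\<forall>\<^sub>F x in at_bot. \<bar>u'' x\<bar> < e / 3"
    using tendstoD[OF assms(3), of "e / 3"] tendstoD[OF assms(4), of "e / 3"] e by auto
  then have "\<forall>\<^sub>F x in at_bot. \<bar>u x\<bar> < e / 3 \<and> \<bar>u'' x\<bar> < e / 3" by (rule eventually_conj)
  then obtain X where X: "\<And>x. x \<le> X \<Longrightarrow> \<bar>u x\<bar> < e / 3 \<and> \<bar>u'' x\<bar> < e / 3"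
    by (auto simp: eventually_at_bot_linorder)
  have "\<bar>u' x\<bar> < e" if x: "x \<le> X" for x
  proof -
    obtain y where y: "x - 1 < y" "y < x" "u x - u (x - 1) = (x - (x - 1)) * u' y"
      using MVT2[of "x - 1" x u u'] u by auto
    obtain z where z: "y < z" "z < x" "u' x - u' y = (x - y) * u'' z"
      using MVT2[of y x u' u''] y u' by auto
    have "\<bar>u' x - u' y\<bar> \<le> 1 * \<bar>u'' z\<bar>" unfolding z(3) abs_mult using y by (intro mult_right_mono) auto
    then show ?thesis using X[of x] X[of "x - 1"] X[of z] x y z by auto
  qed
  then show "\<forall>\<^sub>F x in at_bot. dist (u' x) 0 < e"
    by (auto simp: eventually_at_bot_linorder)
qed

section \<open>Differential equations with vanishing data\<close>

lemma gronwall_zero: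
  fixes f :: "real \<Rightarrow> real"
  assumes f: "\<And>x. (f has_real_derivative f' x) (at x)" and bound: "\<And>x. \<bar>f' x\<bar> \<le> C * f x"
    and nonneg: "\<And>x. f x \<ge> 0" and zero: "f a = 0"
  shows "f x = 0"
proof (rule antisym[OF _ nonneg], cases "x \<ge> a")
  case True
  have "f x * exp (- C * x) \<le> f a * exp (- C * a)"
  proof (rule DERIV_nonpos_imp_nonincreasing[OF True])
    fix y
    have "((\<lambda>x. f x * exp (- C * x)) has_real_derivative (f' y - C * f y) * exp (- C * y)) (at y)"
      using f[of y] by (auto intro!: derivative_eq_intros simp: algebra_simps)
    moreover have "(f' y - C * f y) * exp (- C * y) \<le> 0"
      using bound[of y] by (intro mult_nonpos_nonneg) auto
    ultimately show "\<exists>d. ((\<lambda>x. f x * exp (- C * x)) has_real_derivative d) (at y) \<and> d \<le> 0" by blast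
  qed
  then show "f x \<le> 0" by (simp add: zero mult_le_0_iff)
next
  case False
  then have le: "x \<le> a" by simp
  have "f x * exp (C * x) \<le> f a * exp (C * a)"
  proof (rule DERIV_nonneg_imp_nondecreasing[OF le])
    fix y
    have "((\<lambda>x. f x * exp (C * x)) has_real_derivative (f' y + C * f y) * exp (C * y)) (at y)"
      using f[of y] by (auto intro!: derivative_eq_intros simp: algebra_simps)
    moreover have "(f' y + C * f y) * exp (C * y) \<ge> 0"
      using bound[of y] by (intro mult_nonneg_nonneg) auto
    ultimately show "\<exists>d. ((\<lambda>x. f x * exp (C * x)) has_real_derivative d) (at y) \<and> d \<ge> 0" by blast
  qed
  then show "f x \<le> 0" by (simp add: zero mult_le_0_iff)
qed

lemma linear_ode_zero:
  fixes d :: "real \<Rightarrow> real"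
  assumes d: "\<And>x. (d has_real_derivative c x * d x) (at x)" and c: "\<And>x. \<bar>c x\<bar> \<le> C" and "d a = 0"
  shows "d x = 0"
proof -
  have "(d x)\<^sup>2 = 0"
  proof (rule gronwall_zero[of "\<lambda>x. (d x)\<^sup>2" "\<lambda>x. 2 * c x * (d x)\<^sup>2" "2 * C" a])
    show "((\<lambda>x. (d x)\<^sup>2) has_real_derivative 2 * c x * (d x)\<^sup>2) (at x)" for x
      using d[of x] by (auto intro!: derivative_eq_intros simp: power2_eq_square)
    show "\<bar>2 * c x * (d x)\<^sup>2\<bar> \<le> 2 * C * (d x)\<^sup>2" for x
      using c[of x] by (auto simp: abs_mult intro!: mult_right_mono)
  qed (use assms in auto)
  then show ?thesis by simp
qed

lemma second_order_ode_zero: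
  fixes z :: "real \<Rightarrow> real"
  assumes z: "\<And>x. (z has_real_derivative z' x) (at x)" and z': "\<And>x. (z' has_real_derivative q x * z x) (at x)"
    and q: "\<And>x. \<bar>q x\<bar> \<le> C" and "z a = 0" "z' a = 0"
  shows "z x = 0"
proof -
  have "(z x)\<^sup>2 + (z' x)\<^sup>2 = 0"
  proof (rule gronwall_zero[of "\<lambda>x. (z x)\<^sup>2 + (z' x)\<^sup>2" "\<lambda>x. (1 + q x) * (2 * z x * z' x)" "1 + C" a])
    show "((\<lambda>x. (z x)\<^sup>2 + (z' x)\<^sup>2) has_real_derivative (1 + q x) * (2 * z x * z' x)) (at x)" for x
      by (auto intro!: derivative_eq_intros z z' simp: algebra_simps)
    show "\<bar>(1 + q x) * (2 * z x * z' x)\<bar> \<le> (1 + C) * ((z x)\<^sup>2 + (z' x)\<^sup>2)" for x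
    proof -
      have "\<bar>2 * z x * z' x\<bar> \<le> (z x)\<^sup>2 + (z' x)\<^sup>2"
        using sum_squares_bound[of "\<bar>z x\<bar>" "\<bar>z' x\<bar>"] by (simp add: abs_mult)
      moreover have "\<bar>1 + q x\<bar> \<le> 1 + C" using q[of x] by linarith
      ultimately show ?thesis unfolding abs_mult[of "1 + q x"] by (intro mult_mono) auto
    qed
  qed (use assms in auto)
  then show ?thesis by (simp add: sum_power2_eq_zero_iff)
qed

section \<open>The Kay-Moses identities\<close>

text \<open>With the defects \<open>Z\<close> and \<open>R\<close> of the two identities, direct computation gives
  \<open>Z' = - K Z + m Z + R u\<close> and \<open>R' = - (Z u\<^sup>T + u Z\<^sup>T)\<close>. The contributions of \<open>R u\<close> to \<open>(|Z|\<^sup>2)'\<close> and of \<open>R'\<close>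
  to \<open>(|R|\<^sup>2/2)'\<close> are \<open>2 Z \<bullet> R u\<close> and, since \<open>R\<close> is symmetric, \<open>- 2 Z \<bullet> R u\<close>, so they
  cancel in the derivative of \<open>Q = |Z|\<^sup>2 + |R|\<^sup>2/2\<close>.\<close>

lemma kay_moses_identities:
  fixes \<kappa> :: "'n::finite \<Rightarrow> real" and u w :: "'n \<Rightarrow> real \<Rightarrow> real"
  assumes \<kappa>: "\<And>i. \<kappa> i > 0"
    and u: "\<And>i x. (u i has_real_derivative w i x) (at x)"
    and w: "\<And>i x. (w i has_real_derivative (\<kappa> i)\<^sup>2 * u i x - 2 * (\<Sum>j\<in>UNIV. (u j x)\<^sup>2) * u i x) (at x)"
    and m: "\<And>i j x. (m i j has_real_derivative u i x * u j x) (at x)"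
    and sym: "\<And>i j x. m i j x = m j i x"
    and B: "\<And>i j x. \<bar>m i j x\<bar> \<le> B"
    and u0: "\<And>i. (u i \<longlongrightarrow> 0) at_bot" and w0: "\<And>i. (w i \<longlongrightarrow> 0) at_bot"
    and m0: "\<And>i j. (m i j \<longlongrightarrow> 0) at_bot"
  shows "w i x = \<kappa> i * u i x - (\<Sum>j\<in>UNIV. m i j x * u j x)"
    and "u i x * u j x = (\<kappa> i + \<kappa> j) * m i j x - (\<Sum>k\<in>UNIV. m i k x * m k j x)"
proof -
  define Z where "Z i x = w i x - \<kappa> i * u i x + (\<Sum>j\<in>UNIV. m i j x * u j x)" for i x
  define R where "R i j x = (\<kappa> i + \<kappa> j) * m i j x - (\<Sum>k\<in>UNIV. m i k x * m k j x) - u i x * u j x" for i j x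
  define Q where "Q x = (\<Sum>i\<in>UNIV. (Z i x)\<^sup>2) + (\<Sum>i\<in>UNIV. \<Sum>j\<in>UNIV. (R i j x)\<^sup>2) / 2" for x
  define N where "N x = (\<Sum>i\<in>UNIV. (Z i x)\<^sup>2)" for x
  define Q' where "Q' x = 2 * (\<Sum>i\<in>UNIV. Z i x * (- \<kappa> i * Z i x + (\<Sum>j\<in>UNIV. m i j x * Z j x)))" for x
  have R_sym: "R i j x = R j i x" for i j x
    unfolding R_def using sym by (simp add: mult.commute add.commute)
  have w_eq: "w i x = Z i x + \<kappa> i * u i x - (\<Sum>j\<in>UNIV. m i j x * u j x)" for i x
    by (simp add: Z_def)
  have Z': "(Z i has_real_derivative - \<kappa> i * Z i x + (\<Sum>j\<in>UNIV. m i j x * Z j x)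
      + (\<Sum>j\<in>UNIV. R i j x * u j x)) (at x)" for i x
  proof -
    define S where "S = (\<Sum>j\<in>UNIV. (u j x)\<^sup>2)"
    have "(Z i has_real_derivative ((\<kappa> i)\<^sup>2 * u i x - 2 * S * u i x) - \<kappa> i * w i x
        + (\<Sum>j\<in>UNIV. u i x * (u j x)\<^sup>2 + m i j x * w j x)) (at x)"
      unfolding Z_def[abs_def] S_def
      by (auto intro!: derivative_eq_intros u w m DERIV_sum simp: algebra_simps power2_eq_square)
    moreover have "(\<Sum>j\<in>UNIV. u i x * (u j x)\<^sup>2 + m i j x * w j x)
        = u i x * S + (\<Sum>j\<in>UNIV. m i j x * w j x)"
      by (simp add: S_def sum.distrib sum_distrib_left)
    moreover have "(\<Sum>j\<in>UNIV. m i j x * w j x) = (\<Sum>j\<in>UNIV. m i j x * Z j x)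
        + (\<Sum>j\<in>UNIV. \<kappa> j * m i j x * u j x) - (\<Sum>j\<in>UNIV. m i j x * (\<Sum>k\<in>UNIV. m j k x * u k x))"
      by (simp add: w_eq ring_distribs sum.distrib sum_subtractf mult.left_commute mult.assoc)
    moreover have "(\<Sum>j\<in>UNIV. R i j x * u j x) = \<kappa> i * (\<Sum>j\<in>UNIV. m i j x * u j x)
        + (\<Sum>j\<in>UNIV. \<kappa> j * m i j x * u j x) - (\<Sum>j\<in>UNIV. (\<Sum>k\<in>UNIV. m i k x * m k j x) * u j x)
        - u i x * S"
      by (simp add: R_def S_def algebra_simps sum.distrib sum_subtractf sum_distrib_left power2_eq_square)
    moreover have "(\<Sum>j\<in>UNIV. m i j x * (\<Sum>k\<in>UNIV. m j k x * u k x))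
       = (\<Sum>j\<in>UNIV. (\<Sum>k\<in>UNIV. m i k x * m k j x) * u j x)"
      unfolding sum_distrib_left sum_distrib_right by (subst sum.swap) (simp add: mult.assoc)
    moreover have "w i x = Z i x + \<kappa> i * u i x - (\<Sum>j\<in>UNIV. m i j x * u j x)" by (rule w_eq)
    ultimately show ?thesis by (elim DERIV_cong) (simp only:, simp add: field_simps power2_eq_square)
  qed
  have R': "(R i j has_real_derivative - (Z i x * u j x + u i x * Z j x)) (at x)" for i j x
  proof -
    have "(R i j has_real_derivative (\<kappa> i + \<kappa> j) * (u i x * u j x)
       - (\<Sum>k\<in>UNIV. u i x * u k x * m k j x + m i k x * (u k x * u j x)) - (w i x * u j x + u i x * w j x)) (at x)"
      unfolding R_def[abs_def]
      by (auto intro!: derivative_eq_intros u w m DERIV_sum simp: algebra_simps)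
    moreover have "m k j x = m j k x" for k by (rule sym)
    ultimately show ?thesis
      by (simp add: w_eq sum.distrib sum_distrib_left sum_distrib_right algebra_simps)
  qed
  have "(Q has_real_derivative (\<Sum>i\<in>UNIV. 2 * Z i x * (- \<kappa> i * Z i x + (\<Sum>j\<in>UNIV. m i j x * Z j x)
      + (\<Sum>j\<in>UNIV. R i j x * u j x)))
      + (\<Sum>i\<in>UNIV. \<Sum>j\<in>UNIV. 2 * R i j x * (- (Z i x * u j x + u i x * Z j x))) / 2) (at x)" for x
    unfolding Q_def[abs_def]
    by (auto intro!: derivative_eq_intros Z' R' DERIV_sum simp: algebra_simps)
  moreover have "(\<Sum>i\<in>UNIV. 2 * Z i x * (- \<kappa> i * Z i x + (\<Sum>j\<in>UNIV. m i j x * Z j x)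
      + (\<Sum>j\<in>UNIV. R i j x * u j x)))
      + (\<Sum>i\<in>UNIV. \<Sum>j\<in>UNIV. 2 * R i j x * (- (Z i x * u j x + u i x * Z j x))) / 2 = Q' x" for x
  proof -
    define T where "T = (\<Sum>i\<in>UNIV. \<Sum>j\<in>UNIV. R i j x * (Z i x * u j x))"
    have T': "(\<Sum>i\<in>UNIV. \<Sum>j\<in>UNIV. R i j x * (u i x * Z j x)) = T"
      unfolding T_def by (subst sum.swap) (simp add: R_sym mult_ac)
    have "(\<Sum>i\<in>UNIV. \<Sum>j\<in>UNIV. 2 * R i j x * (- (Z i x * u j x + u i x * Z j x)))
      = (\<Sum>i\<in>UNIV. \<Sum>j\<in>UNIV. (- 2) * (R i j x * (Z i x * u j x)) + (- 2) * (R i j x * (u i x * Z j x)))"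
      by (intro sum.cong refl) (simp add: algebra_simps)
    also have "\<dots> = (- 2) * T + (- 2) * (\<Sum>i\<in>UNIV. \<Sum>j\<in>UNIV. R i j x * (u i x * Z j x))"
      unfolding sum.distrib sum_distrib_left[symmetric] T_def ..
    finally have 1: "(\<Sum>i\<in>UNIV. \<Sum>j\<in>UNIV. 2 * R i j x * (- (Z i x * u j x + u i x * Z j x))) = - 4 * T"
      unfolding T' by simp
    have "(\<Sum>i\<in>UNIV. 2 * Z i x * (- \<kappa> i * Z i x + (\<Sum>j\<in>UNIV. m i j x * Z j x) + (\<Sum>j\<in>UNIV. R i j x * u j x)))
      = (\<Sum>i\<in>UNIV. 2 * (Z i x * (- \<kappa> i * Z i x + (\<Sum>j\<in>UNIV. m i j x * Z j x)))
          + 2 * (\<Sum>j\<in>UNIV. R i j x * (Z i x * u j x)))"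
      by (intro sum.cong refl) (simp add: ring_distribs sum_distrib_left mult_ac)
    also have "\<dots> = Q' x + 2 * T"
      unfolding sum.distrib sum_distrib_left[symmetric] T_def Q'_def ..
    finally show ?thesis unfolding 1 by simp
  qed
  ultimately have Q_deriv: "(Q has_real_derivative Q' x) (at x)" for x by simp
  have N0: "N x \<ge> 0" and NQ: "N x \<le> Q x" and Q0: "Q x \<ge> 0" for x
    by (auto simp: N_def Q_def intro!: sum_nonneg add_nonneg_nonneg)
  have le_N: "(Z i x)\<^sup>2 \<le> N x" for i x
    unfolding N_def by (rule member_le_sum) auto
  have quad: "\<bar>\<Sum>i\<in>UNIV. Z i x * (\<Sum>j\<in>UNIV. m i j x * Z j x)\<bar> \<le> b * (real CARD('n))\<^sup>2 * N x"
    if b: "\<And>i j. \<bar>m i j x\<bar> \<le> b" for b x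
  proof -
    have ij: "\<bar>Z i x * (m i j x * Z j x)\<bar> \<le> b * N x" for i j
    proof -
      have "\<bar>Z i x * Z j x\<bar> \<le> ((Z i x)\<^sup>2 + (Z j x)\<^sup>2) / 2"
        using sum_squares_bound[of "\<bar>Z i x\<bar>" "\<bar>Z j x\<bar>"] by (simp add: abs_mult)
      then have "\<bar>Z i x * Z j x\<bar> \<le> N x"
        by (rule order_trans) (use add_mono[OF le_N[of i x] le_N[of j x]] in simp)
      then have "\<bar>m i j x\<bar> * \<bar>Z i x * Z j x\<bar> \<le> b * N x" using b[of i j] by (intro mult_mono) auto
      then show ?thesis by (simp add: abs_mult mult_ac)
    qed
    have "\<bar>\<Sum>i\<in>UNIV. Z i x * (\<Sum>j\<in>UNIV. m i j x * Z j x)\<bar> \<le> (\<Sum>i\<in>(UNIV::'n set). \<Sum>j\<in>(UNIV::'n set). b * N x)"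
      unfolding sum_distrib_left
      by (rule order_trans[OF sum_abs]) (intro sum_mono order_trans[OF sum_abs] ij)
    then show ?thesis by (simp add: power2_eq_square mult_ac)
  qed
  have Q'_eq: "Q' x = 2 * ((\<Sum>i\<in>UNIV. Z i x * (\<Sum>j\<in>UNIV. m i j x * Z j x)) - (\<Sum>i\<in>UNIV. \<kappa> i * (Z i x)\<^sup>2))" for x
    unfolding Q'_def by (simp add: algebra_simps sum.distrib sum_subtractf sum_negf power2_eq_square)
  have Q'_bound: "\<bar>Q' x\<bar> \<le> 2 * (B * (real CARD('n))\<^sup>2 + (\<Sum>i\<in>UNIV. \<kappa> i)) * Q x" for x
  proof -
    have k: "(\<Sum>i\<in>UNIV. \<kappa> i * (Z i x)\<^sup>2) \<le> (\<Sum>i\<in>UNIV. \<kappa> i) * N x"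
      unfolding sum_distrib_right using \<kappa> le_N by (intro sum_mono mult_left_mono) (auto intro: less_imp_le)
    have nonneg: "0 \<le> (\<Sum>i\<in>UNIV. \<kappa> i * (Z i x)\<^sup>2)"
      using \<kappa> by (intro sum_nonneg mult_nonneg_nonneg) (auto intro: less_imp_le)
    have split: "\<bar>2 * (p - q)\<bar> \<le> 2 * (p' + q')" if "\<bar>p\<bar> \<le> p'" "0 \<le> q" "q \<le> q'" for p q p' q' :: real
    proof -
      have "\<bar>p - q\<bar> \<le> p' + q'"
        by (rule order_trans[OF abs_triangle_ineq4 add_mono]) (use that in simp_all)
      then show ?thesis by simp
    qed
    have "\<bar>Q' x\<bar> \<le> 2 * (B * (real CARD('n))\<^sup>2 * N x + (\<Sum>i\<in>UNIV. \<kappa> i) * N x)"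
      unfolding Q'_eq by (rule split[OF quad[OF B] nonneg k])
    also have "\<dots> = 2 * (B * (real CARD('n))\<^sup>2 + (\<Sum>i\<in>UNIV. \<kappa> i)) * N x" by (simp add: algebra_simps)
    also have "\<dots> \<le> 2 * (B * (real CARD('n))\<^sup>2 + (\<Sum>i\<in>UNIV. \<kappa> i)) * Q x"
    proof (rule mult_left_mono[OF NQ])
      have "B \<ge> 0" using B[of undefined undefined 0] by linarith
      moreover have "(\<Sum>i\<in>UNIV. \<kappa> i) \<ge> 0" by (intro sum_nonneg less_imp_le \<kappa>)
      ultimately show "0 \<le> 2 * (B * (real CARD('n))\<^sup>2 + (\<Sum>i\<in>UNIV. \<kappa> i))" by simp
    qed
    finally show ?thesis .
  qed
  \<comment> \<open>Below \<open>X\<close> the entries of \<open>m\<close> are so small that the quadratic form of \<open>m\<close> is dominated by that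
    of \<open>K\<close>.\<close>
  define k where "k = Min (range \<kappa>)"
  have k: "k > 0" "\<And>i. k \<le> \<kappa> i" using \<kappa> by (auto simp: k_def)
  define b where "b = k / (real CARD('n))\<^sup>2"
  have b: "b > 0" using k by (simp add: b_def)
  have "\<forall>\<^sub>F x in at_bot. \<bar>m i j x\<bar> < b" for i j using tendstoD[OF m0 b, of i j] by simp
  then have "\<forall>\<^sub>F x in at_bot. \<forall>i j. \<bar>m i j x\<bar> < b"
    by (intro eventually_all_finite)
  then obtain X where "\<forall>x\<le>X. \<forall>i j. \<bar>m i j x\<bar> < b"
    unfolding eventually_at_bot_linorder by blast
  then have X: "\<bar>m i j x\<bar> \<le> b" if "x \<le> X" for x i j using that less_imp_le by blast
  have Q'_neg: "Q' x \<le> 0" if "x \<le> X" for x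
  proof -
    have low: "k * N x \<le> (\<Sum>i\<in>UNIV. \<kappa> i * (Z i x)\<^sup>2)"
      unfolding N_def sum_distrib_left using k by (intro sum_mono mult_right_mono) auto
    have b_eq: "b * (real CARD('n))\<^sup>2 * N x = k * N x" by (simp add: b_def)
    have "(\<Sum>i\<in>UNIV. Z i x * (\<Sum>j\<in>UNIV. m i j x * Z j x)) \<le> (\<Sum>i\<in>UNIV. \<kappa> i * (Z i x)\<^sup>2)"
      using order_trans[OF abs_ge_self order_trans[OF quad[OF X[OF that]] low[folded b_eq]]] .
    then show ?thesis unfolding Q'_eq by simp
  qed
  have Z0: "(Z i \<longlongrightarrow> 0) at_bot" for i
    unfolding Z_def[abs_def] by (rule tendsto_eq_intros u0 w0 m0 | simp)+
  have R0: "(R i j \<longlongrightarrow> 0) at_bot" for i j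
    unfolding R_def[abs_def] by (rule tendsto_eq_intros u0 w0 m0 | simp)+
  have Q_lim: "(Q \<longlongrightarrow> 0) at_bot"
    unfolding Q_def[abs_def] by (rule tendsto_eq_intros Z0 R0 | simp)+
  have "Q X \<le> Q y" if "y \<le> X" for y
    by (rule DERIV_nonpos_imp_nonincreasing[OF that]) (use Q_deriv Q'_neg in blast)
  then have "Q X \<le> 0"
    by (intro tendsto_lowerbound[OF Q_lim]) (auto simp: eventually_at_bot_linorder)
  then have "Q X = 0" using Q0[of X] by linarith
  then have Q_zero: "Q x = 0" for x by (rule gronwall_zero[OF Q_deriv Q'_bound Q0])
  then have N_zero: "N x = 0" for x using NQ[of x] N0[of x] by simp
  then have "Z i x = 0" for i x using le_N[of i x] by simp
  then show "w i x = \<kappa> i * u i x - (\<Sum>j\<in>UNIV. m i j x * u j x)" by (simp add: w_eq)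
  have "(\<Sum>i\<in>UNIV. \<Sum>j\<in>UNIV. (R i j x)\<^sup>2) = 0" using Q_zero[of x] N_zero[of x]
    by (simp add: Q_def N_def)
  then have "R i j x = 0"
    by (simp add: sum_nonneg_eq_0_iff sum_nonneg)
  then show "u i x * u j x = (\<kappa> i + \<kappa> j) * m i j x - (\<Sum>k\<in>UNIV. m i k x * m k j x)"
    by (simp add: R_def)
qed

text \<open>The identities, taken as a system of equations for a pair \<open>(u, m)\<close>. The derivative
  of \<open>m\<close> and its limit at \<open>-\<infinity>\<close> make it the partial Gram matrix of \<open>u\<close>. Together with the limits \<open>1\<close> of \<open>m\<^sub>i\<^sub>i\<close> at \<open>+\<infinity>\<close> the system is equivalent to the original normalized problem, but it is
  of first order.\<close>

definition kay_moses_system ::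
  "('n::finite \<Rightarrow> real) \<Rightarrow> ('n \<Rightarrow> real \<Rightarrow> real) \<Rightarrow> ('n \<Rightarrow> 'n \<Rightarrow> real \<Rightarrow> real) \<Rightarrow> bool" where
  "kay_moses_system \<kappa> u m \<longleftrightarrow>
    (\<forall>i x. (u i has_real_derivative \<kappa> i * u i x - (\<Sum>j\<in>UNIV. m i j x * u j x)) (at x)) \<and>
    (\<forall>i j x. (m i j has_real_derivative u i x * u j x) (at x)) \<and>
    (\<forall>i j x. u i x * u j x = (\<kappa> i + \<kappa> j) * m i j x - (\<Sum>k\<in>UNIV. m i k x * m k j x)) \<and>
    (\<forall>i j x. m i j x = m j i x) \<and> (\<forall>i j. (m i j \<longlongrightarrow> 0) at_bot)"

lemma kay_moses_systemD:
  assumes "kay_moses_system \<kappa> u m"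
  shows "(u i has_real_derivative \<kappa> i * u i x - (\<Sum>j\<in>UNIV. m i j x * u j x)) (at x)"
    and "(m i j has_real_derivative u i x * u j x) (at x)"
    and "u i x * u j x = (\<kappa> i + \<kappa> j) * m i j x - (\<Sum>k\<in>UNIV. m i k x * m k j x)"
    and "m i j x = m j i x" and "(m i j \<longlongrightarrow> 0) at_bot"
  using assms unfolding kay_moses_system_def by blast+

text \<open>Differentiate the first identity, insert it again for the derivatives \<open>u\<^sub>j'\<close>, and remove the
  quadratic terms in \<open>m\<close> with the second identity.\<close>

lemma kay_moses_second_derivative:
  assumes sys: "kay_moses_system \<kappa> u m"
  shows "((\<lambda>x. \<kappa> i * u i x - (\<Sum>j\<in>UNIV. m i j x * u j x)) has_real_derivative
    (\<kappa> i)\<^sup>2 * u i x - 2 * (\<Sum>j\<in>UNIV. (u j x)\<^sup>2) * u i x) (at x)"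
proof -
  note D = kay_moses_systemD[OF sys]
  define S where "S = (\<Sum>j\<in>UNIV. (u j x)\<^sup>2)"
  define w where "w i = \<kappa> i * u i x - (\<Sum>j\<in>UNIV. m i j x * u j x)" for i
  have "((\<lambda>x. \<kappa> i * u i x - (\<Sum>j\<in>UNIV. m i j x * u j x)) has_real_derivative
    \<kappa> i * w i - (\<Sum>j\<in>UNIV. u i x * (u j x)\<^sup>2 + m i j x * w j)) (at x)"
    unfolding w_def
    by (auto intro!: derivative_eq_intros D(1,2) DERIV_sum simp: algebra_simps power2_eq_square)
  moreover have "(\<Sum>j\<in>UNIV. u i x * (u j x)\<^sup>2 + m i j x * w j) = u i x * S + (\<Sum>j\<in>UNIV. m i j x * w j)"
    by (simp add: S_def sum.distrib sum_distrib_left)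
  moreover have "(\<Sum>j\<in>UNIV. m i j x * w j) = (\<Sum>j\<in>UNIV. \<kappa> j * m i j x * u j x)
      - (\<Sum>j\<in>UNIV. m i j x * (\<Sum>k\<in>UNIV. m j k x * u k x))"
    by (simp add: w_def ring_distribs sum.distrib sum_subtractf mult.left_commute mult.assoc)
  moreover have "(\<Sum>j\<in>UNIV. m i j x * (\<Sum>k\<in>UNIV. m j k x * u k x))
     = (\<Sum>j\<in>UNIV. (\<Sum>k\<in>UNIV. m i k x * m k j x) * u j x)"
    unfolding sum_distrib_left sum_distrib_right by (subst sum.swap) (simp add: mult.assoc)
  moreover have "u i x * S = \<kappa> i * (\<Sum>j\<in>UNIV. m i j x * u j x)
      + (\<Sum>j\<in>UNIV. \<kappa> j * m i j x * u j x) - (\<Sum>j\<in>UNIV. (\<Sum>k\<in>UNIV. m i k x * m k j x) * u j x)"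
  proof -
    have "u i x * S = (\<Sum>j\<in>UNIV. (u i x * u j x) * u j x)"
      by (simp add: S_def sum_distrib_left power2_eq_square mult_ac)
    also have "\<dots> = (\<Sum>j\<in>UNIV. \<kappa> i * (m i j x * u j x) + \<kappa> j * m i j x * u j x
        - (\<Sum>k\<in>UNIV. m i k x * m k j x) * u j x)"
      by (intro sum.cong refl) (subst D(3), simp add: algebra_simps)
    finally show ?thesis by (simp add: sum.distrib sum_subtractf sum_distrib_left)
  qed
  moreover have "w i = \<kappa> i * u i x - (\<Sum>j\<in>UNIV. m i j x * u j x)" by (rule w_def)
  ultimately show ?thesis
    unfolding S_def[symmetric] by (elim DERIV_cong) (simp only:, simp add: field_simps power2_eq_square)
qed

text \<open>The diagonal part of the second identity is \<open>u\<^sub>i\<^sup>2 + \<Sum>\<^sub>k m\<^sub>i\<^sub>k\<^sup>2 = 2 \<kappa>\<^sub>i m\<^sub>i\<^sub>i\<close>, which bounds first \<open>m\<^sub>i\<^sub>i\<close> and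
  then everything else.\<close>

lemma kay_moses_bounds:
  assumes sys: "kay_moses_system \<kappa> u m" and \<kappa>: "\<kappa> i > 0"
  shows "\<bar>m i j x\<bar> \<le> 2 * \<kappa> i" and "(u i x)\<^sup>2 \<le> (2 * \<kappa> i)\<^sup>2"
proof -
  note D = kay_moses_systemD[OF sys]
  have eq: "(u i x)\<^sup>2 = 2 * \<kappa> i * m i i x - (\<Sum>k\<in>UNIV. (m i k x)\<^sup>2)"
  proof -
    have "(\<Sum>k\<in>UNIV. m i k x * m k i x) = (\<Sum>k\<in>UNIV. (m i k x)\<^sup>2)"
      unfolding power2_eq_square by (intro sum.cong refl arg_cong2[where f = "(*)"] D(4))
    then show ?thesis using D(3)[of i x i] by (simp add: power2_eq_square)
  qed
  then have le: "(\<Sum>k\<in>UNIV. (m i k x)\<^sup>2) \<le> 2 * \<kappa> i * m i i x" using zero_le_power2[of "u i x"] by linarith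
  have mem: "(m i k x)\<^sup>2 \<le> (\<Sum>k\<in>UNIV. (m i k x)\<^sup>2)" for k by (rule member_le_sum) auto
  have nn: "0 \<le> (\<Sum>k\<in>UNIV. (m i k x)\<^sup>2)" by (rule sum_nonneg) simp
  have "m i i x * m i i x \<le> 2 * \<kappa> i * m i i x" using mem[of i] le by (simp add: power2_eq_square)
  then have mii: "m i i x \<le> 2 * \<kappa> i"
    using \<kappa> by (cases "m i i x > 0") (auto simp: mult_le_cancel_right)
  have "2 * \<kappa> i * m i i x \<le> 2 * \<kappa> i * (2 * \<kappa> i)" using mii \<kappa> by (intro mult_left_mono) auto
  then have up: "2 * \<kappa> i * m i i x \<le> (2 * \<kappa> i)\<^sup>2" by (simp add: power2_eq_square)
  have "(m i j x)\<^sup>2 \<le> (2 * \<kappa> i)\<^sup>2" using mem[of j] le up by (meson order_trans)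
  then show "\<bar>m i j x\<bar> \<le> 2 * \<kappa> i"
    using \<kappa> power2_le_imp_le[of "\<bar>m i j x\<bar>" "2 * \<kappa> i"] by simp
  show "(u i x)\<^sup>2 \<le> (2 * \<kappa> i)\<^sup>2" using order_trans[OF _ up, of "(u i x)\<^sup>2"] eq nn by simp
qed

lemma kay_moses_system_shift:
  assumes "kay_moses_system \<kappa> u m"
  shows "kay_moses_system \<kappa> (\<lambda>i x. u i (x + c)) (\<lambda>i j x. m i j (x + c))"
proof -
  note D = kay_moses_systemD[OF assms]
  have "filterlim (\<lambda>x. x + c) at_bot at_bot"
    using filterlim_tendsto_add_at_bot_iff[OF tendsto_const, THEN iffD2, OF filterlim_ident, of c]
    by (simp add: add.commute)
  then have "((\<lambda>x. m i j (x + c)) \<longlongrightarrow> 0) at_bot" for i j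
    using D(5) filterlim_compose by blast
  then show ?thesis
    unfolding kay_moses_system_def
    by (intro conjI allI DERIV_shift[THEN iffD1, OF D(1)] DERIV_shift[THEN iffD1, OF D(2)] D(3,4))
qed

section \<open>Normalized solutions and the Kay-Moses system\<close>

lemma square_integrable_mult:
  assumes "square_integrable f" "square_integrable g"
  shows "integrable lborel (\<lambda>x. f x * g x)"
    and "\<bar>LINT x|lborel. indicator A x * (f x * g x)\<bar> \<le> ((LINT x|lborel. (f x)\<^sup>2) + (LINT x|lborel. (g x)\<^sup>2)) / 2"
proof -
  have i: "integrable lborel (\<lambda>x. ((f x)\<^sup>2 + (g x)\<^sup>2) / 2)"
    using assms by (auto simp: square_integrable_def)
  have le: "\<bar>f x * g x\<bar> \<le> ((f x)\<^sup>2 + (g x)\<^sup>2) / 2" for x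
    using sum_squares_bound[of "\<bar>f x\<bar>" "\<bar>g x\<bar>"] by (simp add: abs_mult)
  have nn: "0 \<le> ((f x)\<^sup>2 + (g x)\<^sup>2) / 2" for x by simp
  show "integrable lborel (\<lambda>x. f x * g x)"
  proof (rule Bochner_Integration.integrable_bound[OF i])
    show "(\<lambda>x. f x * g x) \<in> borel_measurable lborel"
      using assms unfolding square_integrable_def by (blast intro: borel_measurable_times)
    show "AE x in lborel. norm (f x * g x) \<le> norm (((f x)\<^sup>2 + (g x)\<^sup>2) / 2)"
      unfolding real_norm_def abs_of_nonneg[OF nn] by (intro AE_I2 le)
  qed
  have le': "\<bar>indicator A x * (f x * g x)\<bar> \<le> ((f x)\<^sup>2 + (g x)\<^sup>2) / 2" for x
    using le[of x] nn[of x] by (auto split: split_indicator)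
  have "\<bar>LINT x|lborel. indicator A x * (f x * g x)\<bar> \<le> (LINT x|lborel. \<bar>indicator A x * (f x * g x)\<bar>)"
    by (rule integral_abs_bound)
  also have "\<dots> \<le> (LINT x|lborel. ((f x)\<^sup>2 + (g x)\<^sup>2) / 2)"
    by (rule integral_mono_AE'[OF i]) (intro AE_I2 le' nn)+
  finally show "\<bar>LINT x|lborel. indicator A x * (f x * g x)\<bar> \<le> ((LINT x|lborel. (f x)\<^sup>2) + (LINT x|lborel. (g x)\<^sup>2)) / 2"
    using assms by (simp add: square_integrable_def)
qed

lemma square_integrable_add:
  assumes "square_integrable f" "square_integrable g"
  shows "square_integrable (\<lambda>x. f x + g x)"
proof -
  have "integrable lborel (\<lambda>x. (f x)\<^sup>2 + 2 * (f x * g x) + (g x)\<^sup>2)"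
    using assms square_integrable_mult(1)[OF assms] by (auto simp: square_integrable_def)
  moreover have "(\<lambda>x. (f x + g x)\<^sup>2) = (\<lambda>x. (f x)\<^sup>2 + 2 * (f x * g x) + (g x)\<^sup>2)"
    by (simp add: fun_eq_iff power2_sum)
  ultimately show ?thesis using assms by (auto simp: square_integrable_def)
qed

lemma square_integrable_sum:
  "finite A \<Longrightarrow> (\<And>i. i \<in> A \<Longrightarrow> square_integrable (f i)) \<Longrightarrow> square_integrable (\<lambda>x. \<Sum>i\<in>A. f i x)"
proof (induction A rule: finite_induct)
  case empty
  then show ?case by (simp add: square_integrable_def)
qed (auto intro: square_integrable_add)

lemma square_integrable_bounded_mult:
  assumes f: "square_integrable f" and c: "c \<in> borel_measurable lborel" and C: "\<And>x. \<bar>c x\<bar> \<le> C"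
  shows "square_integrable (\<lambda>x. c x * f x)"
proof -
  have i: "integrable lborel (\<lambda>x. C\<^sup>2 * (f x)\<^sup>2)" using f by (auto simp: square_integrable_def)
  have "(c x)\<^sup>2 \<le> C\<^sup>2" for x
    using C[of x] by (metis abs_ge_zero order_trans abs_le_square_iff abs_of_nonneg)
  then have le: "(c x * f x)\<^sup>2 \<le> C\<^sup>2 * (f x)\<^sup>2" for x
    by (simp add: power_mult_distrib mult_right_mono)
  have "integrable lborel (\<lambda>x. (c x * f x)\<^sup>2)"
  proof (rule Bochner_Integration.integrable_bound[OF i])
    show "(\<lambda>x. (c x * f x)\<^sup>2) \<in> borel_measurable lborel"
      using f c unfolding square_integrable_def
      by (intro borel_measurable_power borel_measurable_times) auto
    show "AE x in lborel. norm ((c x * f x)\<^sup>2) \<le> norm (C\<^sup>2 * (f x)\<^sup>2)"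
      using le by (intro AE_I2) simp
  qed
  then show ?thesis using f c by (auto simp: square_integrable_def)
qed

text \<open>As \<open>m\<^sub>i\<^sub>i\<close> is a primitive of \<open>u\<^sub>i\<^sup>2\<close>, its limits at both ends give square integrability and the
  normalization together.\<close>

lemma kay_moses_imp_normalized_solution:
  fixes \<mu> :: "3 \<Rightarrow> real"
  assumes sys: "kay_moses_system \<kappa> u m" and \<kappa>: "\<And>i. \<kappa> i > 0" and \<mu>: "\<And>i. \<mu> i = - (\<kappa> i)\<^sup>2"
    and lim: "\<And>i. (m i i \<longlongrightarrow> 1) at_top"
  shows "normalized_solution \<mu> u"
proof -
  note D = kay_moses_systemD[OF sys]
  define w where "w i x = \<kappa> i * u i x - (\<Sum>j\<in>UNIV. m i j x * u j x)" for i x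
  define g where "g i x = (\<kappa> i)\<^sup>2 * u i x - 2 * (\<Sum>j\<in>UNIV. (u j x)\<^sup>2) * u i x" for i x
  have u': "(u i has_real_derivative w i x) (at x)" for i x unfolding w_def by (rule D(1))
  have w': "(w i has_real_derivative g i x) (at x)" for i x
    unfolding w_def[abs_def] g_def by (rule kay_moses_second_derivative[OF sys])
  have cu: "continuous_on UNIV (u i)" for i using u' by (rule continuous_on_of_deriv)
  have cw: "continuous_on UNIV (w i)" for i using w' by (rule continuous_on_of_deriv)
  have cm: "continuous_on UNIV (m i j)" for i j using D(2) by (rule continuous_on_of_deriv)
  have cg: "continuous_on UNIV (g i)" for i
    unfolding g_def[abs_def] by (intro continuous_intros cu)
  have FTC: "set_integrable lborel (einterval (-\<infinity>) \<infinity>) (\<lambda>x. (u i x)\<^sup>2)"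
    "(LBINT x=-\<infinity>..\<infinity>. (u i x)\<^sup>2) = 1 - 0" for i
  proof -
    have l: "((m i i \<circ> real_of_ereal) \<longlongrightarrow> 0) (at_right (-\<infinity>))"
      using D(5)[of i i] by (simp add: at_right_MInf filterlim_filtermap comp_def)
    have r: "((m i i \<circ> real_of_ereal) \<longlongrightarrow> 1) (at_left \<infinity>)"
      using lim[of i] by (simp add: at_left_PInf filterlim_filtermap comp_def)
    have d: "(m i i has_real_derivative (u i x)\<^sup>2) (at x)" for x
      using D(2)[of i i x] by (simp add: power2_eq_square)
    have c: "isCont (\<lambda>x. (u i x)\<^sup>2) x" for x
      using cu[of i] by (intro continuous_intros) (simp add: continuous_on_eq_continuous_at)
    show "set_integrable lborel (einterval (-\<infinity>) \<infinity>) (\<lambda>x. (u i x)\<^sup>2)"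
      by (rule interval_integral_FTC_nonneg(1)[OF _ d c _ l r]) auto
    show "(LBINT x=-\<infinity>..\<infinity>. (u i x)\<^sup>2) = 1 - 0"
      by (rule interval_integral_FTC_nonneg(2)[OF _ d c _ l r]) auto
  qed
  have sq: "square_integrable (u i)" and norm1: "(LINT x|lborel. (u i x)\<^sup>2) = 1" for i
    using FTC[of i] borel_measurable_continuous_onI[OF cu[of i]]
    by (auto simp: square_integrable_def set_integrable_def interval_lebesgue_integral_def
        set_lebesgue_integral_def einterval_def)
  have "square_integrable (\<lambda>x. \<kappa> i * u i x + (\<Sum>j\<in>UNIV. (- m i j x) * u j x))" for i
  proof (intro square_integrable_add square_integrable_sum square_integrable_bounded_mult sq)
    show "\<bar>\<kappa> i\<bar> \<le> \<bar>\<kappa> i\<bar>" by simp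
    show "\<bar>- m i j x\<bar> \<le> 2 * \<kappa> i" for j x using kay_moses_bounds(1)[OF sys \<kappa>] by simp
    show "(\<lambda>x. - m i j x) \<in> borel_measurable lborel" for j
      using borel_measurable_continuous_onI[OF cm] by auto
  qed auto
  then have sqw: "square_integrable (w i)" for i by (simp add: w_def[abs_def] sum_negf)
  have wu: "has_weak_deriv (u i) (w i)" and ww: "has_weak_deriv (w i) (g i)" for i
    using has_weak_deriv_classical u' cw w' cg by auto
  have "u i \<in> H1" for i
    using cu sq sqw wu unfolding H1_def by blast
  moreover have "is_solution \<mu> u"
    unfolding is_solution_def
  proof (intro allI exI conjI)
    fix i
    show "has_weak_deriv (u i) (w i)" "has_weak_deriv (w i) (g i)" by (rule wu ww)+
    show "AE x in lborel. g i x + 2 * ((u 1 x)\<^sup>2 + (u 2 x)\<^sup>2 + (u 3 x)\<^sup>2) * u i x = - \<mu> i * u i x"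
      by (simp add: g_def sum_3 \<mu> algebra_simps)
  qed
  ultimately show ?thesis using norm1 by (auto simp: normalized_solution_def)
qed

text \<open>The last conclusion is the simplicity of the eigenvalues of a one-dimensional Schroedinger
  operator: the Wronskian of two decaying eigenfunctions with the same eigenvalue vanishes, so they
  agree up to a factor by uniqueness for second-order equations, and the normalization makes this
  factor \<open>1\<close> or \<open>-1\<close>.\<close>

lemma normalized_solution_imp_kay_moses:
  fixes \<mu> \<kappa> :: "3 \<Rightarrow> real"
  assumes sol: "normalized_solution \<mu> u" and \<kappa>: "\<And>i. \<kappa> i > 0" and \<mu>: "\<And>i. \<mu> i = - (\<kappa> i)\<^sup>2"
  defines "m \<equiv> \<lambda>i j. integral_below (\<lambda>t. u i t * u j t)"
  shows "kay_moses_system \<kappa> u m"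
    and "(m i j \<longlongrightarrow> (LINT x|lborel. u i x * u j x)) at_top"
    and "(u i \<longlongrightarrow> 0) at_top"
    and "\<kappa> i = \<kappa> j \<Longrightarrow> \<exists>s\<in>{1, - 1}. \<forall>x. u j x = s * u i x"
proof -
  have H: "u i \<in> H1" and sq: "square_integrable (u i)" and cu: "continuous_on UNIV (u i)"
    and norm1: "(LINT x|lborel. (u i x)\<^sup>2) = 1" for i
    using sol by (auto simp: normalized_solution_def H1_def)
  note u_bot = H1_vanishes_at_infinity(1)[OF H] and u_top = H1_vanishes_at_infinity(2)[OF H]
  show "(u i \<longlongrightarrow> 0) at_top" by (rule u_top)
  define g where "g i x = (\<kappa> i)\<^sup>2 * u i x - 2 * (\<Sum>j\<in>UNIV. (u j x)\<^sup>2) * u i x" for i x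
  have cg: "continuous_on UNIV (g i)" for i
    unfolding g_def[abs_def] by (intro continuous_intros cu)
  have "\<exists>w. (\<forall>x. (u i has_real_derivative w x) (at x)) \<and> (\<forall>x. (w has_real_derivative g i x) (at x))" for i
  proof -
    obtain u' u'' where 1: "has_weak_deriv (u i) u'" and 2: "has_weak_deriv u' u''"
      and ae: "AE x in lborel. u'' x + 2 * ((u 1 x)\<^sup>2 + (u 2 x)\<^sup>2 + (u 3 x)\<^sup>2) * u i x = - \<mu> i * u i x"
      using sol unfolding normalized_solution_def is_solution_def by blast
    have "AE x in lborel. u'' x = g i x"
      using ae by eventually_elim (simp add: g_def \<mu> sum_3 algebra_simps)
    then show ?thesis by (rule weak_second_deriv_classical[OF cu 1 2 cg])
  qed
  then obtain w where u': "\<And>i x. (u i has_real_derivative w i x) (at x)"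
    and w': "\<And>i x. (w i has_real_derivative g i x) (at x)" by metis
  have g_bot: "(g i \<longlongrightarrow> 0) at_bot" for i
  proof -
    have "(g i \<longlongrightarrow> (\<kappa> i)\<^sup>2 * 0 - 2 * (\<Sum>j\<in>(UNIV::3 set). 0\<^sup>2) * 0) at_bot"
      unfolding g_def[abs_def] by (intro tendsto_intros u_bot)
    then show ?thesis by simp
  qed
  have w_bot: "(w i \<longlongrightarrow> 0) at_bot" for i
    by (rule deriv_vanishes_at_bot[OF u' w' u_bot g_bot])
  have int: "integrable lborel (\<lambda>t. u i t * u j t)" for i j by (rule square_integrable_mult(1)[OF sq sq])
  have m': "(m i j has_real_derivative u i x * u j x) (at x)" for i j x
    unfolding m_def by (rule integral_below_deriv[OF int]) (intro continuous_intros cu)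
  have m_bot: "(m i j \<longlongrightarrow> 0) at_bot" for i j
    unfolding m_def by (rule integral_below_at_bot[OF int])
  show "(m i j \<longlongrightarrow> (LINT x|lborel. u i x * u j x)) at_top"
    unfolding m_def by (rule integral_below_at_top[OF int])
  have m_sym: "m i j x = m j i x" for i j x by (simp add: m_def mult.commute)
  have m_bound: "\<bar>m i j x\<bar> \<le> 1" for i j x
    using square_integrable_mult(2)[OF sq sq, of "{..x}" i j] norm1 by (simp add: m_def integral_below_def)
  note km = kay_moses_identities[where \<kappa> = \<kappa> and u = u and w = w and m = m, OF \<kappa> u'
      w'[unfolded g_def] m' m_sym m_bound u_bot w_bot m_bot]
  show sys: "kay_moses_system \<kappa> u m"
    unfolding kay_moses_system_def using u' km(1) m' km(2) m_sym m_bot by simp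
  assume ij: "\<kappa> i = \<kappa> j"
  define W where "W x = u i x * w j x - u j x * w i x" for x
  have "(W has_real_derivative 0) (at x)" for x
    unfolding W_def[abs_def]
    by (auto intro!: derivative_eq_intros u' w' simp: g_def ij algebra_simps)
  then have W_const: "W x = W 0" for x by (intro DERIV_isconst_all) auto
  have "(W \<longlongrightarrow> 0 * 0 - 0 * 0) at_bot"
    unfolding W_def[abs_def] by (intro tendsto_intros u_bot w_bot)
  moreover have "W = (\<lambda>x. W 0)" using W_const by blast
  ultimately have "((\<lambda>x::real. W 0) \<longlongrightarrow> 0) at_bot" by simp
  then have "W 0 = 0" using tendsto_unique[OF trivial_limit_at_bot_linorder tendsto_const] by blast
  then have W0: "W x = 0" for x using W_const by simp
  obtain a where a: "u i a \<noteq> 0"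
  proof (rule ccontr)
    assume "\<not> thesis"
    then have "u i x = 0" for x using that by blast
    then show False using norm1[of i] by simp
  qed
  define c where "c = u j a / u i a"
  define q where "q x = (\<kappa> i)\<^sup>2 - 2 * (\<Sum>j\<in>UNIV. (u j x)\<^sup>2)" for x
  have diff: "u j x - c * u i x = 0" for x
  proof (rule second_order_ode_zero[where z = "\<lambda>x. u j x - c * u i x" and z' = "\<lambda>x. w j x - c * w i x" and q = q and a = a])
    show "((\<lambda>x. u j x - c * u i x) has_real_derivative w j x - c * w i x) (at x)" for x
      by (auto intro!: derivative_eq_intros u')
    show "((\<lambda>x. w j x - c * w i x) has_real_derivative q x * (u j x - c * u i x)) (at x)" for x
      by (auto intro!: derivative_eq_intros w' simp: g_def q_def ij algebra_simps)
    show "u j a - c * u i a = 0" using a by (simp add: c_def)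
    show "w j a - c * w i a = 0" using a W0[of a] by (simp add: c_def W_def field_simps)
    show "\<bar>q x\<bar> \<le> (\<kappa> i)\<^sup>2 + 2 * (\<Sum>j\<in>UNIV. (2 * \<kappa> j)\<^sup>2)" for x
    proof -
      have upper: "(\<Sum>j\<in>UNIV. (u j x)\<^sup>2) \<le> (\<Sum>j\<in>UNIV. (2 * \<kappa> j)\<^sup>2)"
        by (intro sum_mono kay_moses_bounds(2)[OF sys \<kappa>])
      have nonneg: "0 \<le> (\<Sum>j\<in>UNIV. (u j x)\<^sup>2)" by (rule sum_nonneg) simp
      have "\<bar>k - 2 * p\<bar> \<le> k + 2 * p'" if "p \<le> p'" "0 \<le> p" "0 \<le> k" for k p p' :: real
        by (rule order_trans[OF abs_triangle_ineq4 add_mono]) (use that in simp_all)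
      from this[OF upper nonneg zero_le_power2] show ?thesis unfolding q_def .
    qed
  qed
  then have uj: "u j x = c * u i x" for x by simp
  have "1 = (LINT x|lborel. c\<^sup>2 * (u i x)\<^sup>2)"
    using norm1[of j] by (simp add: uj power_mult_distrib)
  then have "c\<^sup>2 = 1" using norm1[of i] by simp
  then show "\<exists>s\<in>{1, - 1}. \<forall>x. u j x = s * u i x" using uj by (auto simp: power2_eq_1_iff)
qed

section \<open>Eigenvalues and their multiplicities\<close>

text \<open>In matrix form the hypothesis is \<open>G\<^sup>2 = K G + G K\<close> with \<open>K = diag \<kappa>\<close>. The matrix \<open>G\<close> commutes with
  \<open>G\<^sup>2\<close>, so \<open>G (K G + G K) = (K G + G K) G\<close>, that is \<open>G\<^sup>2 K = K G\<^sup>2\<close>. So \<open>G\<^sup>2\<close>, and by the hypothesis also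
  \<open>G\<close>, vanishes wherever \<open>\<kappa>\<^sub>i\<close> and \<open>\<kappa>\<^sub>j\<close> differ.\<close>

lemma spectral_blocks:
  fixes G :: "'n::finite \<Rightarrow> 'n \<Rightarrow> real"
  assumes \<kappa>: "\<And>i. \<kappa> i > 0" and G: "\<And>i j. (\<Sum>k\<in>UNIV. G i k * G k j) = (\<kappa> i + \<kappa> j) * G i j"
    and ij: "\<kappa> i \<noteq> \<kappa> j"
  shows "G i j = 0"
proof -
  define P where "P i j = (\<Sum>k\<in>UNIV. G i k * G k j)" for i j
  define K where "K = (\<Sum>k\<in>UNIV. \<kappa> k * (G i k * G k j))"
  have P: "P i j = (\<kappa> i + \<kappa> j) * G i j" for i j using G by (simp add: P_def)
  have "(\<Sum>k\<in>UNIV. G i k * P k j) = (\<Sum>k\<in>UNIV. P i k * G k j)"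
    unfolding P_def sum_distrib_left sum_distrib_right by (subst sum.swap) (simp add: mult.assoc)
  moreover have "(\<Sum>k\<in>UNIV. G i k * P k j)
      = (\<Sum>k\<in>UNIV. \<kappa> k * (G i k * G k j) + \<kappa> j * (G i k * G k j))"
    by (intro sum.cong refl) (simp add: P algebra_simps)
  moreover have "(\<Sum>k\<in>UNIV. P i k * G k j)
      = (\<Sum>k\<in>UNIV. \<kappa> k * (G i k * G k j) + \<kappa> i * (G i k * G k j))"
    by (intro sum.cong refl) (simp add: P algebra_simps)
  moreover have K: "(\<Sum>k\<in>UNIV. \<kappa> k * (G i k * G k j) + c * (G i k * G k j)) = K + c * P i j" for c
    by (simp add: K_def P_def sum.distrib sum_distrib_left)
  ultimately have "K + \<kappa> i * P i j = K + \<kappa> j * P i j" unfolding K by metis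
  then have "P i j = 0" using ij by simp
  then show ?thesis using P[of i j] \<kappa>[of i] \<kappa>[of j] by auto
qed

text \<open>Let \<open>x\<close> tend to \<open>+\<infinity>\<close> in the second Kay-Moses identity: the products \<open>u\<^sub>i u\<^sub>j\<close> vanish, and \<open>m\<close> tends
  to the Gram matrix \<open>G\<close>, so \<open>K G + G K = G\<^sup>2\<close>. As \<open>G\<close> has entries \<open>1\<close> or \<open>-1\<close> within a group of equal
  eigenvalues and \<open>0\<close> elsewhere, the diagonal of \<open>G\<^sup>2\<close> counts multiplicities, while that of
  \<open>K G + G K\<close> is \<open>2 \<kappa>\<close>.\<close>

lemma normalized_solution_multiplicity:
  fixes \<mu> \<kappa> :: "3 \<Rightarrow> real"
  assumes sol: "normalized_solution \<mu> u" and \<kappa>: "\<And>i. \<kappa> i > 0" and \<mu>: "\<And>i. \<mu> i = - (\<kappa> i)\<^sup>2"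
  shows "2 * \<kappa> i = real (card {j. \<kappa> j = \<kappa> i})"
proof -
  define m where "m i j = integral_below (\<lambda>t. u i t * u j t)" for i j
  define G where "G i j = (LINT x|lborel. u i x * u j x)" for i j
  note km0 = normalized_solution_imp_kay_moses[where \<kappa> = \<kappa>, OF sol \<kappa> \<mu>]
  have sys: "kay_moses_system \<kappa> u m" using km0(1) by (simp add: m_def[abs_def])
  have m_lim: "(m i j \<longlongrightarrow> G i j) at_top" for i j using km0(2) by (simp add: m_def G_def)
  have G: "(\<Sum>k\<in>UNIV. G i k * G k j) = (\<kappa> i + \<kappa> j) * G i j" for i j
  proof -
    have lim: "((\<lambda>x. (\<kappa> i + \<kappa> j) * m i j x - (\<Sum>k\<in>UNIV. m i k x * m k j x)) \<longlongrightarrow>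
        (\<kappa> i + \<kappa> j) * G i j - (\<Sum>k\<in>UNIV. G i k * G k j)) at_top"
      by (intro tendsto_intros m_lim)
    have "((\<lambda>x. u i x * u j x) \<longlongrightarrow> 0 * 0) at_top" by (intro tendsto_intros km0(3))
    then have "((\<lambda>x. (\<kappa> i + \<kappa> j) * m i j x - (\<Sum>k\<in>UNIV. m i k x * m k j x)) \<longlongrightarrow> 0) at_top"
      using kay_moses_systemD(3)[OF sys] by simp
    then have "(\<kappa> i + \<kappa> j) * G i j - (\<Sum>k\<in>UNIV. G i k * G k j) = 0"
      by (rule tendsto_unique[OF trivial_limit_at_top_linorder lim])
    then show ?thesis by simp
  qed
  have norm1: "(LINT x|lborel. (u i x)\<^sup>2) = 1" for i using sol by (simp add: normalized_solution_def)
  have Gsq: "G i j * G j i = (if \<kappa> j = \<kappa> i then 1 else 0)" for j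
  proof (cases "\<kappa> j = \<kappa> i")
    case True
    then obtain s where s: "s \<in> {1, - 1}" "\<And>x. u j x = s * u i x" using km0(4)[of i j] by metis
    have "G i j = s * (LINT x|lborel. (u i x)\<^sup>2)" "G j i = s * (LINT x|lborel. (u i x)\<^sup>2)"
      unfolding G_def by (simp_all add: s(2) power2_eq_square mult_ac flip: integral_mult_right_zero)
    then show ?thesis using True s(1) by (auto simp: norm1)
  next
    case False
    then show ?thesis using spectral_blocks[of \<kappa> G i j] \<kappa> G by auto
  qed
  have "G i i = 1" unfolding G_def using norm1[of i] by (simp add: power2_eq_square)
  then have "2 * \<kappa> i = (\<Sum>k\<in>UNIV. G i k * G k i)" using G[of i i] by simp
  also have "\<dots> = real (card {j. \<kappa> j = \<kappa> i})" unfolding Gsq by (simp add: sum.If_cases)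
  finally show ?thesis .
qed

lemma eigenvalues_3:
  fixes \<kappa> :: "3 \<Rightarrow> real"
  assumes mult: "\<And>i. 2 * \<kappa> i = real (card {j. \<kappa> j = \<kappa> i})"
    and ord: "\<kappa> 2 \<le> \<kappa> 1" "\<kappa> 3 \<le> \<kappa> 2"
  shows "(\<kappa> 1 = 3/2 \<and> \<kappa> 2 = 3/2 \<and> \<kappa> 3 = 3/2) \<or> (\<kappa> 1 = 1 \<and> \<kappa> 2 = 1 \<and> \<kappa> 3 = 1/2)"
proof -
  have "2 * \<kappa> i = (\<Sum>j\<in>UNIV. if \<kappa> j = \<kappa> i then 1 else 0)" for i
    using mult[of i] by (simp add: sum.If_cases)
  then have "2 * \<kappa> i = (if \<kappa> 1 = \<kappa> i then 1 else 0) + (if \<kappa> 2 = \<kappa> i then 1 else 0)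
      + (if \<kappa> 3 = \<kappa> i then 1 else 0)" for i by (simp only: sum_3)
  from this[of 1] this[of 2] this[of 3] ord show ?thesis by (auto split: if_splits)
qed

section \<open>One triple eigenvalue\<close>

text \<open>The solution of \<open>m' = 3 m (1 - m)\<close> with \<open>m(0) = 1/2\<close>; it equals \<open>1 / (1 + exp (- 3 x))\<close>.\<close>

definition logistic :: "real \<Rightarrow> real" where
  "logistic x = (1 + tanh (3 * x / 2)) / 2"

lemma logistic_deriv: "(logistic has_real_derivative 3 * logistic x * (1 - logistic x)) (at x)"
proof -
  have "((\<lambda>x. (1 + tanh (3 * x / 2)) / 2) has_real_derivative 3 / 4 * (1 - (tanh (3 * x / 2))\<^sup>2)) (at x)"
    by (auto intro!: derivative_eq_intros simp: field_simps)
  then show ?thesis unfolding logistic_def[abs_def]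
    by (rule DERIV_cong) (simp add: field_simps power2_eq_square)
qed

lemma logistic_at_bot: "(logistic \<longlongrightarrow> 0) at_bot"
proof -
  have f: "filterlim (\<lambda>x::real. 3 * x / 2) at_bot at_bot"
    using filterlim_tendsto_pos_mult_at_bot[OF tendsto_const _ filterlim_ident, of "3 / 2 :: real"] by simp
  have "(logistic \<longlongrightarrow> (1 + (- 1)) / 2) at_bot"
    unfolding logistic_def[abs_def] by (intro tendsto_intros filterlim_compose[OF tanh_real_at_bot f]) simp
  then show ?thesis by simp
qed

lemma logistic_at_top: "(logistic \<longlongrightarrow> 1) at_top"
proof -
  have f: "filterlim (\<lambda>x::real. 3 * x / 2) at_top at_top"
    using filterlim_tendsto_pos_mult_at_top[OF tendsto_const _ filterlim_ident, of "3 / 2 :: real"] by simp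
  have "(logistic \<longlongrightarrow> (1 + 1) / 2) at_top"
    unfolding logistic_def[abs_def] by (intro tendsto_intros filterlim_compose[OF tanh_real_at_top f]) simp
  then show ?thesis by simp
qed

lemma logistic_bounds: "0 \<le> logistic x" "logistic x \<le> 1"
  using tanh_real_bounds[of "3 * x / 2"] by (auto simp: logistic_def)

lemma logistic_sech: "(sqrt 3 / (2 * cosh (3 * x / 2)))\<^sup>2 = 3 * logistic x * (1 - logistic x)"
proof -
  have "(sqrt 3 / (2 * cosh (3 * x / 2)))\<^sup>2 = 3 / (4 * (cosh (3 * x / 2))\<^sup>2)"
    by (simp add: power_divide power_mult_distrib)
  also have "\<dots> = 3 / 4 * (1 - (tanh (3 * x / 2))\<^sup>2)"
  proof -
    have "1 - (tanh (3 * x / 2))\<^sup>2 = ((cosh (3 * x / 2))\<^sup>2 - (sinh (3 * x / 2))\<^sup>2) / (cosh (3 * x / 2))\<^sup>2"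
      by (simp add: tanh_def power_divide diff_divide_distrib)
    also have "\<dots> = 1 / (cosh (3 * x / 2))\<^sup>2" using hyperbolic_pythagoras[of "3 * x / 2"] by simp
    finally show ?thesis by simp
  qed
  finally show ?thesis by (simp add: logistic_def field_simps power2_eq_square)
qed

text \<open>Match the solutions at a point where \<open>m = 1/2\<close>, which exists by the intermediate value theorem.
  The difference of two solutions of the logistic equation satisfies a linear equation.\<close>

lemma logistic_unique:
  fixes m :: "real \<Rightarrow> real"
  assumes m: "\<And>x. (m has_real_derivative 3 * m x * (1 - m x)) (at x)"
    and bounds: "\<And>x. 0 \<le> m x" "\<And>x. m x \<le> 1" and lim: "(m \<longlongrightarrow> 0) at_bot" "(m \<longlongrightarrow> 1) at_top"
  shows "\<exists>x0. \<forall>x. m (x + x0) = logistic x"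
proof -
  have "\<forall>\<^sub>F x in at_bot. m x < 1 / 2" using lim(1) by (rule order_tendstoD) simp
  then obtain a where a: "m a < 1 / 2" using eventually_happens'[OF trivial_limit_at_bot_linorder] by blast
  have "\<forall>\<^sub>F x in at_top. m x > 1 / 2" using lim(2) by (rule order_tendstoD) simp
  then have "\<forall>\<^sub>F x in at_top. m x > 1 / 2 \<and> x \<ge> a" by (intro eventually_conj eventually_ge_at_top)
  then obtain b where b: "m b > 1 / 2" "a \<le> b" using eventually_happens'[OF trivial_limit_at_top_linorder] by blast
  obtain x0 where x0: "m x0 = 1 / 2"
    using IVT'[of m a "1 / 2" b] a b continuous_on_of_deriv[OF m] continuous_on_subset by force
  have "m (x + x0) - logistic x = 0" for x
  proof (rule linear_ode_zero[where d = "\<lambda>x. m (x + x0) - logistic x"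
        and c = "\<lambda>x. 3 * (1 - m (x + x0) - logistic x)" and C = 3 and a = 0])
    fix x
    have "((\<lambda>x. m (x + x0)) has_real_derivative 3 * m (x + x0) * (1 - m (x + x0))) (at x)"
      using m[of "x + x0"] by (simp add: DERIV_shift)
    from DERIV_diff[OF this logistic_deriv[of x]]
    show "((\<lambda>x. m (x + x0) - logistic x) has_real_derivative
        3 * (1 - m (x + x0) - logistic x) * (m (x + x0) - logistic x)) (at x)"
      by (rule DERIV_cong) (simp add: algebra_simps)
    show "\<bar>3 * (1 - m (x + x0) - logistic x)\<bar> \<le> 3"
      using bounds[of "x + x0"] logistic_bounds[of x] by (auto simp: abs_le_iff)
  next
    show "m (0 + x0) - logistic 0 = 0" by (simp add: x0 logistic_def)
  qed
  then show ?thesis by (intro exI[of _ x0]) simp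
qed

lemma continuous_square_root_sign:
  fixes f g :: "real \<Rightarrow> real"
  assumes f: "continuous_on UNIV f" and g: "\<And>x. g x > 0" and sq: "\<And>x. (f x)\<^sup>2 = (g x)\<^sup>2"
  shows "\<exists>s\<in>{1, - 1}. \<forall>x. f x = s * g x"
proof -
  have f0: "f x \<noteq> 0" for x using sq[of x] g[of x] by (metis less_irrefl power_zero_numeral zero_eq_power2)
  have pm: "f x = g x \<or> f x = - g x" for x using sq[of x] by (simp add: power2_eq_iff)
  have "\<not> (f x < 0 \<and> f y > 0)" for x y
  proof
    assume *: "f x < 0 \<and> f y > 0"
    have cont: "continuous_on A f" for A using f continuous_on_subset by blast
    show False
    proof (cases "x \<le> y")
      case True
      then show False using IVT'[of f x 0 y] * f0 cont by force
    next
      case False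
      then show False using IVT2'[of f x 0 y] * f0 cont by force
    qed
  qed
  then have "(\<forall>x. f x > 0) \<or> (\<forall>x. f x < 0)" using f0 by (metis linorder_neqE_linordered_idom)
  then show ?thesis
  proof
    assume "\<forall>x. f x > 0"
    then have "\<forall>x. f x = 1 * g x" using pm g by (metis less_asym mult_1 neg_less_0_iff_less)
    then show ?thesis by blast
  next
    assume "\<forall>x. f x < 0"
    then have "\<forall>x. f x = - 1 * g x" using pm g by (metis less_asym mult_minus1)
    then show ?thesis by blast
  qed
qed

text \<open>All three functions agree up to signs, \<open>u\<^sub>i = s\<^sub>i u\<^sub>1\<close>, so \<open>m\<^sub>i\<^sub>j = s\<^sub>i s\<^sub>j m\<^sub>1\<^sub>1\<close> and the second Kay-Moses
  identity becomes \<open>u\<^sub>1\<^sup>2 = 3 m\<^sub>1\<^sub>1 (1 - m\<^sub>1\<^sub>1)\<close>. As \<open>u\<^sub>1\<^sup>2\<close> is the derivative of \<open>m\<^sub>1\<^sub>1\<close>, this is the logistic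
  equation.\<close>

lemma equal_eigenvalues_solutions:
  fixes \<mu> :: "3 \<Rightarrow> real"
  assumes \<mu>: "\<And>i. \<mu> i = - 9 / 4"
  shows "normalized_solution \<mu> u \<longleftrightarrow>
    (\<exists>x0 s. (\<forall>i. s i \<in> {1, - 1}) \<and> (\<forall>i x. u i (x + x0) = s i * (sqrt 3 / (2 * cosh (3 * x / 2)))))"
    (is "_ \<longleftrightarrow> (\<exists>x0 s. _ \<and> (\<forall>i x. _ = s i * ?g x))")
proof
  let ?\<kappa> = "\<lambda>i::3. 3 / 2 :: real"
  have \<kappa>: "\<And>i. ?\<kappa> i > 0" and \<mu>': "\<And>i. \<mu> i = - (?\<kappa> i)\<^sup>2" by (simp_all add: \<mu> power2_eq_square)
  {
    assume sol: "normalized_solution \<mu> u"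
    define m where "m i j = integral_below (\<lambda>t. u i t * u j t)" for i j
    note km0 = normalized_solution_imp_kay_moses[where \<kappa> = ?\<kappa>, OF sol \<kappa> \<mu>']
    have sys: "kay_moses_system ?\<kappa> u m" using km0(1) by (simp add: m_def[abs_def])
    note D = kay_moses_systemD[OF sys]
    have "\<exists>s. s \<in> {1, - 1} \<and> (\<forall>x. u i x = s * u 1 x)" for i using km0(4)[of 1 i] by auto
    then obtain s where s: "\<And>i. s i \<in> {1, - 1}" "\<And>i x. u i x = s i * u 1 x" by metis
    have m1: "m 1 i x = s i * m 1 1 x" for i x
    proof -
      have "(\<lambda>t. indicator {..x} t * (u 1 t * u i t)) = (\<lambda>t. s i * (indicator {..x} t * (u 1 t * u 1 t)))"
        by (simp add: fun_eq_iff s(2)[of i] mult_ac)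
      then show ?thesis by (simp add: m_def integral_below_def)
    qed
    have mm: "m 1 i x * m i 1 x = (m 1 1 x)\<^sup>2" for i x
      using m1[of i x] D(4)[of i 1 x] s(1)[of i] by (auto simp: power2_eq_square)
    have u1sq: "(u 1 x)\<^sup>2 = 3 * m 1 1 x * (1 - m 1 1 x)" for x
    proof -
      have "(\<Sum>k\<in>(UNIV::3 set). m 1 k x * m k 1 x) = 3 * (m 1 1 x)\<^sup>2" unfolding mm by simp
      then show ?thesis unfolding power2_eq_square[of "u 1 x"] D(3)[of 1 x 1]
        by (simp add: power2_eq_square algebra_simps)
    qed
    have b: "0 \<le> m 1 1 x \<and> m 1 1 x \<le> 1" for x
    proof -
      have "0 \<le> m 1 1 x * (1 - m 1 1 x)" using u1sq[of x] zero_le_power2[of "u 1 x"] by simp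
      then show ?thesis by (auto simp: zero_le_mult_iff)
    qed
    have "\<exists>x0. \<forall>x. m 1 1 (x + x0) = logistic x"
    proof (rule logistic_unique)
      show "(m 1 1 has_real_derivative 3 * m 1 1 x * (1 - m 1 1 x)) (at x)" for x
        using D(2)[of 1 1 x] u1sq[of x] by (simp add: power2_eq_square)
      have "(LINT x|lborel. u 1 x * u 1 x) = 1"
        using sol by (simp add: normalized_solution_def power2_eq_square)
      then show "(m 1 1 \<longlongrightarrow> 1) at_top" using km0(2)[of 1 1] by (simp add: m_def)
    qed (use b D(5) in auto)
    then obtain x0 where x0: "\<And>x. m 1 1 (x + x0) = logistic x" by blast
    have "\<exists>r\<in>{1, - 1}. \<forall>x. u 1 (x + x0) = r * ?g x"
    proof (rule continuous_square_root_sign)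
      have "continuous_on UNIV (u 1)" using D(1) by (rule continuous_on_of_deriv)
      then show "continuous_on UNIV (\<lambda>x. u 1 (x + x0))"
        by (rule continuous_on_compose2) (auto intro!: continuous_intros)
      show "(u 1 (x + x0))\<^sup>2 = (?g x)\<^sup>2" for x unfolding u1sq x0 logistic_sech ..
    qed simp
    then obtain r where r: "r \<in> {1, - 1}" "\<And>x. u 1 (x + x0) = r * ?g x" by blast
    show "\<exists>x0 s. (\<forall>i. s i \<in> {1, - 1}) \<and> (\<forall>i x. u i (x + x0) = s i * ?g x)"
    proof (intro exI[of _ x0] exI[of _ "\<lambda>i. s i * r"] conjI allI)
      show "s i * r \<in> {1, - 1}" for i using s(1)[of i] r(1) by auto
      show "u i (x + x0) = s i * r * ?g x" for i x using s(2)[of i "x + x0"] r(2) by simp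
    qed
  }
  assume "\<exists>x0 s. (\<forall>i. s i \<in> {1, - 1}) \<and> (\<forall>i x. u i (x + x0) = s i * ?g x)"
  then obtain x0 s where s: "\<And>i. s i \<in> {1, - 1}" and u: "\<And>i x. u i (x + x0) = s i * ?g x" by blast
  have ss: "s i * s i = 1" for i using s[of i] by auto
  have g': "(?g has_real_derivative 3 / 2 * ?g x - 3 * logistic x * ?g x) (at x)" for x
  proof -
    have "(?g has_real_derivative - (sqrt 3 * (2 * (sinh (3 * x / 2) * (3 / 2))) / (2 * cosh (3 * x / 2))\<^sup>2)) (at x)"
      by (auto intro!: derivative_eq_intros simp: power2_eq_square)
    then show ?thesis
      by (rule DERIV_cong) (simp add: logistic_def tanh_def field_simps power2_eq_square)
  qed
  have "kay_moses_system ?\<kappa> (\<lambda>i x. s i * ?g x) (\<lambda>i j x. s i * s j * logistic x)"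
    unfolding kay_moses_system_def
  proof (intro conjI allI)
    fix i j :: 3 and x :: real
    have "(\<Sum>j\<in>UNIV. s i * s j * logistic x * (s j * ?g x)) = (\<Sum>j\<in>(UNIV::3 set). s i * logistic x * ?g x)"
      by (intro sum.cong refl) (use ss in \<open>simp add: mult.left_commute mult.assoc\<close>)
    then show "((\<lambda>x. s i * ?g x) has_real_derivative 3 / 2 * (s i * ?g x)
        - (\<Sum>j\<in>UNIV. s i * s j * logistic x * (s j * ?g x))) (at x)"
      using DERIV_cmult[OF g', of "s i"] by (simp add: algebra_simps)
    have gg: "?g x * ?g x = 3 * logistic x * (1 - logistic x)"
      using logistic_sech[of x] by (simp only: power2_eq_square)
    have sg: "s i * ?g x * (s j * ?g x) = s i * s j * (3 * logistic x * (1 - logistic x))"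
      unfolding gg[symmetric] by (simp only: mult_ac)
    show "((\<lambda>x. s i * s j * logistic x) has_real_derivative s i * ?g x * (s j * ?g x)) (at x)"
      unfolding sg by (rule DERIV_cmult[OF logistic_deriv])
    have "(\<Sum>k\<in>UNIV. s i * s k * logistic x * (s k * s j * logistic x))
       = (\<Sum>k\<in>(UNIV::3 set). s i * s j * (logistic x)\<^sup>2)"
    proof (intro sum.cong refl)
      fix k
      have "s i * s k * logistic x * (s k * s j * logistic x) = (s k * s k) * (s i * s j * (logistic x)\<^sup>2)"
        by (simp add: power2_eq_square mult_ac)
      then show "s i * s k * logistic x * (s k * s j * logistic x) = s i * s j * (logistic x)\<^sup>2"
        by (simp add: ss)
    qed
    then show "s i * ?g x * (s j * ?g x) = (3 / 2 + 3 / 2) * (s i * s j * logistic x)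
        - (\<Sum>k\<in>UNIV. s i * s k * logistic x * (s k * s j * logistic x))"
      unfolding sg by (simp add: algebra_simps power2_eq_square)
    show "s i * s j * logistic x = s j * s i * logistic x" by simp
    show "((\<lambda>x. s i * s j * logistic x) \<longlongrightarrow> 0) at_bot"
      by (rule tendsto_eq_intros logistic_at_bot | simp)+
  qed
  then have "kay_moses_system ?\<kappa> u (\<lambda>i j x. s i * s j * logistic (x + - x0))"
  proof -
    have "u = (\<lambda>i x. s i * ?g (x + - x0))"
    proof (intro ext)
      fix i x show "u i x = s i * ?g (x + - x0)" using u[of i "x + - x0"] by (simp only: add.assoc) simp
    qed
    then show ?thesis using kay_moses_system_shift[OF \<open>kay_moses_system _ (\<lambda>i x. s i * ?g x) _\<close>, of "- x0"]
      by (simp only:)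
  qed
  then show "normalized_solution \<mu> u"
  proof (rule kay_moses_imp_normalized_solution[OF _ \<kappa> \<mu>'])
    have "filterlim (\<lambda>x. x + - x0) at_top at_top"
      using filterlim_tendsto_add_at_top[OF tendsto_const filterlim_ident, of "- x0"] by (simp add: add.commute)
    then have "((\<lambda>x. logistic (x + - x0)) \<longlongrightarrow> 1) at_top" by (rule filterlim_compose[OF logistic_at_top])
    then show "((\<lambda>x. s i * s i * logistic (x + - x0)) \<longlongrightarrow> 1) at_top" for i unfolding ss by simp
  qed
qed

section \<open>A double and a simple eigenvalue\<close>

lemma eq_of_deriv_limit:
  fixes f g :: "real \<Rightarrow> real"
  assumes f: "\<And>x. (f has_real_derivative d x) (at x)" and g: "\<And>x. (g has_real_derivative d x) (at x)"
    and lim: "(f \<longlongrightarrow> l) at_bot" "(g \<longlongrightarrow> l) at_bot"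
  shows "f x = g x"
proof -
  have "((\<lambda>x. f x - g x) has_real_derivative 0) (at x)" for x
    using DERIV_diff[OF f g] by simp
  then have "f y - g y = f x - g x" for y by (intro DERIV_isconst_all[of "\<lambda>x. f x - g x"]) auto
  then have const: "(\<lambda>y. f y - g y) = (\<lambda>y. f x - g x)" by (rule ext)
  have "((\<lambda>y. f y - g y) \<longlongrightarrow> l - l) at_bot" by (intro tendsto_intros lim)
  then have "((\<lambda>y::real. f x - g x) \<longlongrightarrow> 0) at_bot" unfolding const by simp
  then have "f x - g x = 0" by (rule tendsto_unique[OF trivial_limit_at_bot_linorder tendsto_const])
  then show ?thesis by simp
qed

lemma exp_ode_unique:
  fixes v :: "real \<Rightarrow> real"
  assumes v: "\<And>x. (v has_real_derivative k * v x) (at x)"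
  shows "v x = v 0 * exp (k * x)"
proof -
  have "((\<lambda>x. v x * exp (- (k * x))) has_real_derivative 0) (at x)" for x
    by (rule DERIV_cong) (auto intro!: derivative_eq_intros v)
  then have "v x * exp (- (k * x)) = v 0 * exp (- (k * 0))" by (intro DERIV_isconst_all) auto
  then show ?thesis by (simp add: exp_minus field_simps)
qed

lemma tendsto_exp_mult_at_bot: "k > 0 \<Longrightarrow> ((\<lambda>x::real. exp (k * x)) \<longlongrightarrow> 0) at_bot"
  by (rule filterlim_compose[OF exp_at_bot])
    (simp add: filterlim_tendsto_pos_mult_at_bot[OF tendsto_const] filterlim_ident)

lemma exp_half_powers:
  fixes x :: real
  shows "exp x = exp (x / 2) ^ 2" "exp (3 / 2 * x) = exp (x / 2) ^ 3" "exp (2 * x) = exp (x / 2) ^ 4"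
    "exp (3 * x) = exp (x / 2) ^ 6"
  by (simp_all flip: exp_of_nat_mult)

text \<open>The functions \<open>u1\<close> and \<open>u3\<close> stand for the first and third component, and \<open>a\<close>, \<open>b\<close>, \<open>c\<close> for
  \<open>m\<^sub>1\<^sub>1\<close>, \<open>m\<^sub>3\<^sub>3\<close>, \<open>m\<^sub>1\<^sub>3\<close>; the factors \<open>2\<close> account for the second component, which is \<open>u1\<close> up to sign.
  Let \<open>N\<close> be the symmetric matrix with diagonal \<open>1 - a\<close>, \<open>1 - b\<close> and off-diagonal entry \<open>- c\<close>. Its
  determinant \<open>D\<close> satisfies the linear equation \<open>D' = - (2 a + b) D\<close> and tends to \<open>1\<close> at \<open>-\<infinity>\<close>, hence
  never vanishes. The vector \<open>v = N\<^sup>-\<^sup>1 (u1, u3)\<close>, with entries \<open>n1 / D\<close> and \<open>n3 / D\<close>, satisfies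
  \<open>v\<^sub>1' = v\<^sub>1\<close> and \<open>v\<^sub>3' = v\<^sub>3 / 2\<close>. From \<open>N' = - u u\<^sup>T\<close> follows \<open>(N\<^sup>-\<^sup>1)' = v v\<^sup>T\<close>, and \<open>N\<^sup>-\<^sup>1\<close> tends to the unit
  matrix, so its entries are known. Finally \<open>u = N v\<close>, and the denominator \<open>soliton_denom\<close> is the
  determinant of \<open>N\<^sup>-\<^sup>1\<close>.\<close>

lemma two_soliton_unique:
  fixes u1 u3 a b c :: "real \<Rightarrow> real"
  assumes u1: "\<And>x. (u1 has_real_derivative u1 x - 2 * a x * u1 x - c x * u3 x) (at x)"
    and u3: "\<And>x. (u3 has_real_derivative u3 x / 2 - 2 * c x * u1 x - b x * u3 x) (at x)"
    and a: "\<And>x. (a has_real_derivative (u1 x)\<^sup>2) (at x)"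
    and b: "\<And>x. (b has_real_derivative (u3 x)\<^sup>2) (at x)"
    and c: "\<And>x. (c has_real_derivative u1 x * u3 x) (at x)"
    and R1: "\<And>x. (u1 x)\<^sup>2 = 2 * a x - 2 * (a x)\<^sup>2 - (c x)\<^sup>2"
    and R3: "\<And>x. (u3 x)\<^sup>2 = b x - 2 * (c x)\<^sup>2 - (b x)\<^sup>2"
    and R13: "\<And>x. u1 x * u3 x = 3 / 2 * c x - 2 * a x * c x - c x * b x"
    and lim: "(a \<longlongrightarrow> 0) at_bot" "(b \<longlongrightarrow> 0) at_bot" "(c \<longlongrightarrow> 0) at_bot"
    and bound: "\<And>x. \<bar>2 * a x + b x\<bar> \<le> C"
  shows "\<exists>p q. \<forall>x. u1 x = p * exp x / soliton_denom p q x * (1 + q\<^sup>2 / 3 * exp x) \<and>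
                   u3 x = q * exp (x / 2) / soliton_denom p q x * (1 - p\<^sup>2 / 6 * exp (2 * x))"
proof -
  define D where "D x = (1 - a x) * (1 - b x) - (c x)\<^sup>2" for x
  define t where "t x = 2 * a x + b x" for x
  have D': "(D has_real_derivative - t x * D x) (at x)" for x
  proof -
    have "(D has_real_derivative - (u1 x)\<^sup>2 * (1 - b x) - (1 - a x) * (u3 x)\<^sup>2 - 2 * c x * (u1 x * u3 x)) (at x)"
      unfolding D_def[abs_def] by (auto intro!: derivative_eq_intros a b c)
    moreover have "- (u1 x)\<^sup>2 * (1 - b x) - (1 - a x) * (u3 x)\<^sup>2 - 2 * c x * (u1 x * u3 x) = - t x * D x"
      unfolding R1 R3 R13 D_def t_def by algebra
    ultimately show ?thesis by simp
  qed
  have D_lim: "(D \<longlongrightarrow> 1) at_bot"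
    unfolding D_def[abs_def] by (rule tendsto_eq_intros lim | simp)+
  have D0: "D x \<noteq> 0" for x
  proof
    assume "D x = 0"
    moreover have "\<bar>- t y\<bar> \<le> C" for y using bound[of y] by (simp only: abs_minus_cancel t_def)
    ultimately have "D y = 0" for y by (intro linear_ode_zero[of D "\<lambda>x. - t x" C x y] D')
    then have "D = (\<lambda>y. 0)" by (rule ext)
    then have "((\<lambda>y::real. 0::real) \<longlongrightarrow> 1) at_bot" using D_lim by simp
    then have "0 = (1::real)" by (rule tendsto_unique[OF trivial_limit_at_bot_linorder tendsto_const])
    then show False by simp
  qed
  define n1 where "n1 x = (1 - b x) * u1 x + c x * u3 x" for x
  define n3 where "n3 x = c x * u1 x + (1 - a x) * u3 x" for x
  \<comment> \<open>In the next two proofs, the difference of both sides is an explicit combination of the relations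
    \<open>R3\<close> and \<open>R13\<close>, respectively \<open>R1\<close> and \<open>R13\<close>.\<close>
  have n1': "(n1 has_real_derivative (1 - t x) * n1 x) (at x)" for x
  proof -
    have "(n1 has_real_derivative - (u3 x)\<^sup>2 * u1 x + (1 - b x) * (u1 x - 2 * a x * u1 x - c x * u3 x)
        + (u1 x * u3 x * u3 x + c x * (u3 x / 2 - 2 * c x * u1 x - b x * u3 x))) (at x)"
      unfolding n1_def[abs_def] by (auto intro!: derivative_eq_intros u1 u3 b c)
    then show ?thesis
    proof (rule DERIV_cong)
      have "- (u3 x)\<^sup>2 * u1 x + (1 - b x) * (u1 x - 2 * a x * u1 x - c x * u3 x)
          + (u1 x * u3 x * u3 x + c x * (u3 x / 2 - 2 * c x * u1 x - b x * u3 x))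
        = (1 - t x) * n1 x - u1 x * ((u3 x)\<^sup>2 - (b x - 2 * (c x)\<^sup>2 - (b x)\<^sup>2))
          + u3 x * (u1 x * u3 x - (3 / 2 * c x - 2 * a x * c x - c x * b x))"
        by (simp add: n1_def t_def field_simps power2_eq_square)
      then show "- (u3 x)\<^sup>2 * u1 x + (1 - b x) * (u1 x - 2 * a x * u1 x - c x * u3 x)
          + (u1 x * u3 x * u3 x + c x * (u3 x / 2 - 2 * c x * u1 x - b x * u3 x)) = (1 - t x) * n1 x"
        using R3[of x] R13[of x] by simp
    qed
  qed
  have n3': "(n3 has_real_derivative (1 / 2 - t x) * n3 x) (at x)" for x
  proof -
    have "(n3 has_real_derivative u1 x * u3 x * u1 x + c x * (u1 x - 2 * a x * u1 x - c x * u3 x)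
        + (- (u1 x)\<^sup>2 * u3 x + (1 - a x) * (u3 x / 2 - 2 * c x * u1 x - b x * u3 x))) (at x)"
      unfolding n3_def[abs_def] by (auto intro!: derivative_eq_intros u1 u3 a c)
    then show ?thesis
    proof (rule DERIV_cong)
      have "u1 x * u3 x * u1 x + c x * (u1 x - 2 * a x * u1 x - c x * u3 x)
          + (- (u1 x)\<^sup>2 * u3 x + (1 - a x) * (u3 x / 2 - 2 * c x * u1 x - b x * u3 x))
        = (1 / 2 - t x) * n3 x - u3 x * ((u1 x)\<^sup>2 - (2 * a x - 2 * (a x)\<^sup>2 - (c x)\<^sup>2))
          + u1 x * (u1 x * u3 x - (3 / 2 * c x - 2 * a x * c x - c x * b x))"
        by (simp add: n3_def t_def field_simps power2_eq_square)
      then show "u1 x * u3 x * u1 x + c x * (u1 x - 2 * a x * u1 x - c x * u3 x)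
          + (- (u1 x)\<^sup>2 * u3 x + (1 - a x) * (u3 x / 2 - 2 * c x * u1 x - b x * u3 x))
        = (1 / 2 - t x) * n3 x"
        using R1[of x] R13[of x] by simp
    qed
  qed
  have quot: "((\<lambda>x. f x / D x) has_real_derivative (f' + t x * f x) / D x) (at x)"
    if "(f has_real_derivative f') (at x)" for f f' x
  proof -
    have "((\<lambda>x. f x / D x) has_real_derivative (f' * D x - f x * (- t x * D x)) / (D x * D x)) (at x)"
      by (rule DERIV_divide[OF that D' D0])
    then show ?thesis by (rule DERIV_cong) (use D0[of x] in \<open>simp add: field_simps\<close>)
  qed
  have "((\<lambda>x. n1 x / D x) has_real_derivative 1 * (n1 x / D x)) (at x)" for x
    using quot[OF n1'] by (simp add: field_simps)
  then have v1: "n1 x / D x = n1 0 / D 0 * exp (1 * x)" for x by (rule exp_ode_unique)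
  have "((\<lambda>x. n3 x / D x) has_real_derivative 1/2 * (n3 x / D x)) (at x)" for x
    using quot[OF n3'] by (simp add: field_simps)
  then have v3: "n3 x / D x = n3 0 / D 0 * exp (1/2 * x)" for x by (rule exp_ode_unique)
  define p where "p = n1 0 / D 0"
  define q where "q = n3 0 / D 0"
  have n1: "n1 x = p * exp x * D x" and n3: "n3 x = q * exp (x / 2) * D x" for x
    using v1[of x] v3[of x] D0[of x] by (simp_all add: p_def q_def field_simps)
  have lims: "((\<lambda>x. (1 - b x) / D x) \<longlongrightarrow> 1) at_bot" "((\<lambda>x. (1 - a x) / D x) \<longlongrightarrow> 1) at_bot"
    "((\<lambda>x. c x / D x) \<longlongrightarrow> 0) at_bot"
    by (rule tendsto_eq_intros lim D_lim | simp)+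
  have exps: "((\<lambda>x. r + s * exp (k * x)) \<longlongrightarrow> r) at_bot" if "k > 0" for r s k :: real
    by (rule tendsto_eq_intros tendsto_exp_mult_at_bot[OF that] | simp)+
  have cancel: "K / D x = r" if "D x * r * D x = D x * K" for K r x
    using that D0[of x] by (metis mult.assoc mult_left_cancel nonzero_mult_div_cancel_right)
  \<comment> \<open>The entries of \<open>N\<^sup>-\<^sup>1\<close>.\<close>
  have t11: "(1 - b x) / D x = 1 + p\<^sup>2 / 2 * exp (2 * x)" for x
  proof (rule eq_of_deriv_limit[OF _ _ lims(1) exps])
    fix x
    have "((\<lambda>x. 1 - b x) has_real_derivative - (u3 x)\<^sup>2) (at x)" by (auto intro!: derivative_eq_intros b)
    from quot[OF this] show "((\<lambda>x. (1 - b x) / D x) has_real_derivative (p * exp x)\<^sup>2) (at x)"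
    proof (rule DERIV_cong)
      have "(n1 x)\<^sup>2 = D x * (- (u3 x)\<^sup>2 + t x * (1 - b x))"
      proof -
        have "(n1 x)\<^sup>2 = (1 - b x)\<^sup>2 * (u1 x)\<^sup>2 + 2 * (1 - b x) * c x * (u1 x * u3 x) + (c x)\<^sup>2 * (u3 x)\<^sup>2"
          by (simp add: n1_def power2_eq_square algebra_simps)
        also have "\<dots> = D x * (- (u3 x)\<^sup>2 + t x * (1 - b x))"
          unfolding R1 R3 R13 D_def t_def by (simp add: field_simps power2_eq_square)
        finally show ?thesis .
      qed
      then show "(- (u3 x)\<^sup>2 + t x * (1 - b x)) / D x = (p * exp x)\<^sup>2"
        unfolding n1 by (intro cancel) (simp add: power2_eq_square mult_ac)
    qed
    show "((\<lambda>x. 1 + p\<^sup>2 / 2 * exp (2 * x)) has_real_derivative (p * exp x)\<^sup>2) (at x)"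
      by (auto intro!: derivative_eq_intros simp: exp_double power2_eq_square)
  qed simp
  have t33: "(1 - a x) / D x = 1 + q\<^sup>2 * exp (1 * x)" for x
  proof (rule eq_of_deriv_limit[OF _ _ lims(2) exps])
    fix x
    have "((\<lambda>x. 1 - a x) has_real_derivative - (u1 x)\<^sup>2) (at x)" by (auto intro!: derivative_eq_intros a)
    from quot[OF this] show "((\<lambda>x. (1 - a x) / D x) has_real_derivative (q * exp (x / 2))\<^sup>2) (at x)"
    proof (rule DERIV_cong)
      have "(n3 x)\<^sup>2 = D x * (- (u1 x)\<^sup>2 + t x * (1 - a x))"
      proof -
        have "(n3 x)\<^sup>2 = (1 - a x)\<^sup>2 * (u3 x)\<^sup>2 + 2 * (1 - a x) * c x * (u1 x * u3 x) + (c x)\<^sup>2 * (u1 x)\<^sup>2"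
          by (simp add: n3_def power2_eq_square algebra_simps)
        also have "\<dots> = D x * (- (u1 x)\<^sup>2 + t x * (1 - a x))"
          unfolding R1 R3 R13 D_def t_def by (simp add: field_simps power2_eq_square)
        finally show ?thesis .
      qed
      then show "(- (u1 x)\<^sup>2 + t x * (1 - a x)) / D x = (q * exp (x / 2))\<^sup>2"
        unfolding n3 by (intro cancel) (simp add: power2_eq_square mult_ac)
    qed
    show "((\<lambda>x. 1 + q\<^sup>2 * exp (1 * x)) has_real_derivative (q * exp (x / 2))\<^sup>2) (at x)"
      by (auto intro!: derivative_eq_intros simp: exp_half_powers(1)[of x] power2_eq_square)
  qed simp
  have t13: "c x / D x = 0 + 2 / 3 * (p * q) * exp (3 / 2 * x)" for x
  proof (rule eq_of_deriv_limit[OF _ _ lims(3) exps])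
    fix x
    from quot[OF c] show "((\<lambda>x. c x / D x) has_real_derivative (p * exp x) * (q * exp (x / 2))) (at x)"
    proof (rule DERIV_cong)
      have "n1 x * n3 x = D x * (u1 x * u3 x + t x * c x)"
      proof -
        have "n1 x * n3 x = (1 - b x) * c x * (u1 x)\<^sup>2 + ((1 - a x) * (1 - b x) + (c x)\<^sup>2) * (u1 x * u3 x)
            + (1 - a x) * c x * (u3 x)\<^sup>2"
          by (simp add: n1_def n3_def power2_eq_square algebra_simps)
        also have "\<dots> = D x * (u1 x * u3 x + t x * c x)"
          unfolding R1 R3 R13 D_def t_def by (simp add: field_simps power2_eq_square)
        finally show ?thesis .
      qed
      then show "(u1 x * u3 x + t x * c x) / D x = (p * exp x) * (q * exp (x / 2))"
        unfolding n1 n3 by (intro cancel) (simp add: mult_ac)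
    qed
    show "((\<lambda>x. 0 + 2 / 3 * (p * q) * exp (3 / 2 * x)) has_real_derivative (p * exp x) * (q * exp (x / 2))) (at x)"
      by (auto intro!: derivative_eq_intros simp: exp_half_powers(1)[of x] exp_half_powers(2)[of x, simplified] power2_eq_square power3_eq_cube)
  qed simp
  have "u1 x = p * exp x / soliton_denom p q x * (1 + q\<^sup>2 / 3 * exp x) \<and>
        u3 x = q * exp (x / 2) / soliton_denom p q x * (1 - p\<^sup>2 / 6 * exp (2 * x))" for x
  proof -
    define E where "E = exp (x / 2)"
    have e: "exp x = E ^ 2" "exp (3 / 2 * x) = E ^ 3" "exp (2 * x) = E ^ 4" "exp (3 * x) = E ^ 6"
      unfolding E_def by (rule exp_half_powers)+
    have A: "1 - a x = (1 + q\<^sup>2 * E ^ 2) * D x" and B: "1 - b x = (1 + p\<^sup>2 / 2 * E ^ 4) * D x"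
      and C: "c x = 2 / 3 * (p * q) * E ^ 3 * D x"
      using t11[of x] t33[of x] t13[of x] D0[of x] unfolding e mult_1 by (simp_all add: field_simps)
    define F where "F = soliton_denom p q x"
    have "D x = D x * D x * F"
    proof -
      have "D x = (1 - a x) * (1 - b x) - (c x)\<^sup>2" by (rule D_def)
      also have "\<dots> = D x * D x * F"
        unfolding A B C F_def soliton_denom_def e by (simp add: field_simps power2_eq_square eval_nat_numeral)
      finally show ?thesis .
    qed
    then have DF: "D x * F = 1" using D0[of x] by simp
    then have DF': "D x = 1 / F" by (metis nonzero_eq_divide_eq mult_zero_right zero_neq_one)
    have "u1 x * D x = (1 - a x) * n1 x - c x * n3 x"
      unfolding n1_def n3_def D_def by algebra
    then have "u1 x * D x = ((1 - a x) * (p * E ^ 2) - c x * (q * E)) * D x"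
      unfolding n1 n3 e E_def[symmetric] by (simp add: algebra_simps)
    then have "u1 x = (1 - a x) * (p * E ^ 2) - c x * (q * E)" by (rule mult_right_cancel[OF D0, THEN iffD1])
    then have "u1 x = p * E ^ 2 * (1 + q\<^sup>2 / 3 * E ^ 2) * D x"
      unfolding A C by (simp add: field_simps power2_eq_square eval_nat_numeral)
    then have r1: "u1 x = p * E ^ 2 / F * (1 + q\<^sup>2 / 3 * E ^ 2)" unfolding DF' by simp
    have "u3 x * D x = (1 - b x) * n3 x - c x * n1 x"
      unfolding n1_def n3_def D_def by algebra
    then have "u3 x * D x = ((1 - b x) * (q * E) - c x * (p * E ^ 2)) * D x"
      unfolding n1 n3 e E_def[symmetric] by (simp add: algebra_simps)
    then have "u3 x = (1 - b x) * (q * E) - c x * (p * E ^ 2)" by (rule mult_right_cancel[OF D0, THEN iffD1])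
    then have "u3 x = q * E * (1 - p\<^sup>2 / 6 * E ^ 4) * D x"
      unfolding B C by (simp add: field_simps power2_eq_square eval_nat_numeral)
    then have "u3 x = q * E / F * (1 - p\<^sup>2 / 6 * E ^ 4)" unfolding DF' by simp
    then show ?thesis using r1 unfolding F_def E_def[symmetric] e by blast
  qed
  then show ?thesis by blast
qed

definition soliton1 :: "real \<Rightarrow> real \<Rightarrow> real \<Rightarrow> real" where
  "soliton1 A B x = A * exp x / soliton_denom A B x * (1 + B\<^sup>2 / 3 * exp x)"

definition soliton3 :: "real \<Rightarrow> real \<Rightarrow> real \<Rightarrow> real" where
  "soliton3 A B x = B * exp (x / 2) / soliton_denom A B x * (1 - A\<^sup>2 / 6 * exp (2 * x))"

text \<open>The partial Gram matrix of the two functions, read off from the solution of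
  \<open>two_soliton_unique\<close>.\<close>

definition gram11 :: "real \<Rightarrow> real \<Rightarrow> real \<Rightarrow> real" where
  "gram11 A B x = (A\<^sup>2 / 2 * exp (2 * x) + A\<^sup>2 * B\<^sup>2 / 18 * exp (3 * x)) / soliton_denom A B x"

definition gram33 :: "real \<Rightarrow> real \<Rightarrow> real \<Rightarrow> real" where
  "gram33 A B x = (B\<^sup>2 * exp x + A\<^sup>2 * B\<^sup>2 / 18 * exp (3 * x)) / soliton_denom A B x"

definition gram13 :: "real \<Rightarrow> real \<Rightarrow> real \<Rightarrow> real" where
  "gram13 A B x = 2 / 3 * (A * B) * exp (3 / 2 * x) / soliton_denom A B x"

lemma soliton_denom_pos: "soliton_denom A B x > 0"
  unfolding soliton_denom_def by (intro add_pos_nonneg) auto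

text \<open>With everything written in powers of the single exponential \<open>e\<^sup>x\<^sup>/\<^sup>2\<close>, the identities below are
  identities of polynomials.\<close>

lemma soliton_eqs:
  shows "soliton1 A B x = (A * exp (x/2) ^ 2 + A * B\<^sup>2 / 3 * exp (x/2) ^ 4) / soliton_denom A B x"
    and "soliton3 A B x = (B * exp (x/2) - A\<^sup>2 * B / 6 * exp (x/2) ^ 5) / soliton_denom A B x"
    and "gram11 A B x = (A\<^sup>2 / 2 * exp (x/2) ^ 4 + A\<^sup>2 * B\<^sup>2 / 18 * exp (x/2) ^ 6) / soliton_denom A B x"
    and "gram33 A B x = (B\<^sup>2 * exp (x/2) ^ 2 + A\<^sup>2 * B\<^sup>2 / 18 * exp (x/2) ^ 6) / soliton_denom A B x"
    and "gram13 A B x = (2 / 3 * (A * B) * exp (x/2) ^ 3) / soliton_denom A B x"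
    and "soliton_denom A B x
      = 1 + B\<^sup>2 * exp (x/2) ^ 2 + A\<^sup>2 / 2 * exp (x/2) ^ 4 + A\<^sup>2 * B\<^sup>2 / 18 * exp (x/2) ^ 6"
proof -
  define E where "E = exp (x / 2)"
  define F where "F = soliton_denom A B x"
  have e: "exp x = E ^ 2" "exp (3 / 2 * x) = E ^ 3" "exp (2 * x) = E ^ 4" "exp (3 * x) = E ^ 6"
    unfolding E_def by (rule exp_half_powers)+
  show "soliton1 A B x = (A * exp (x/2) ^ 2 + A * B\<^sup>2 / 3 * exp (x/2) ^ 4) / soliton_denom A B x"
    unfolding soliton1_def E_def[symmetric] e F_def[symmetric]
    by (simp add: add_divide_distrib algebra_simps eval_nat_numeral)
  show "soliton3 A B x = (B * exp (x/2) - A\<^sup>2 * B / 6 * exp (x/2) ^ 5) / soliton_denom A B x"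
    unfolding soliton3_def E_def[symmetric] e F_def[symmetric]
    by (simp add: diff_divide_distrib algebra_simps eval_nat_numeral)
  show "gram11 A B x = (A\<^sup>2 / 2 * exp (x/2) ^ 4 + A\<^sup>2 * B\<^sup>2 / 18 * exp (x/2) ^ 6) / soliton_denom A B x"
    "gram33 A B x = (B\<^sup>2 * exp (x/2) ^ 2 + A\<^sup>2 * B\<^sup>2 / 18 * exp (x/2) ^ 6) / soliton_denom A B x"
    "gram13 A B x = (2 / 3 * (A * B) * exp (x/2) ^ 3) / soliton_denom A B x"
    "soliton_denom A B x
      = 1 + B\<^sup>2 * exp (x/2) ^ 2 + A\<^sup>2 / 2 * exp (x/2) ^ 4 + A\<^sup>2 * B\<^sup>2 / 18 * exp (x/2) ^ 6"
    unfolding gram11_def gram33_def gram13_def soliton_denom_def e E_def[symmetric] by simp_all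
qed

text \<open>The quotient rule for the common denominator, whose derivative is the bracketed factor. The
  numerator \<open>M\<close> of the derivative is a parameter, so that each use leaves one polynomial identity
  to check.\<close>

lemma soliton_quotient_deriv:
  assumes N: "(N has_real_derivative N') (at x)"
    and eq: "N' * soliton_denom A B x
      - N x * (B\<^sup>2 * exp (x/2) ^ 2 + A\<^sup>2 * exp (x/2) ^ 4 + A\<^sup>2 * B\<^sup>2 / 6 * exp (x/2) ^ 6) = M"
  shows "((\<lambda>x. N x / soliton_denom A B x) has_real_derivative M / (soliton_denom A B x)\<^sup>2) (at x)"
proof -
  have "(soliton_denom A B has_real_derivative
      B\<^sup>2 * exp x + A\<^sup>2 * exp (2 * x) + A\<^sup>2 * B\<^sup>2 / 6 * exp (3 * x)) (at x)"
    unfolding soliton_denom_def[abs_def] by (auto intro!: derivative_eq_intros)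
  then have "(soliton_denom A B has_real_derivative
      B\<^sup>2 * exp (x/2) ^ 2 + A\<^sup>2 * exp (x/2) ^ 4 + A\<^sup>2 * B\<^sup>2 / 6 * exp (x/2) ^ 6) (at x)"
    by (simp only: exp_half_powers[of x])
  moreover have "soliton_denom A B x \<noteq> 0" using soliton_denom_pos[of A B x] by simp
  ultimately show ?thesis
    using DERIV_divide[OF N] unfolding eq[symmetric] power2_eq_square[of "soliton_denom A B x"] by blast
qed

lemma exp_half_power_deriv:
  "((\<lambda>x. c * exp (x / 2) ^ n) has_real_derivative c * (real n / 2) * exp (x / 2) ^ n) (at x)"
  unfolding exp_of_nat_mult[symmetric] by (auto intro!: derivative_eq_intros)

lemma soliton_system:
  fixes A B :: real
  defines "p \<equiv> soliton1 A B" and "r \<equiv> soliton3 A B" and "a \<equiv> gram11 A B" and "b \<equiv> gram33 A B" and "c \<equiv> gram13 A B"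
  shows "(p has_real_derivative p x - 2 * a x * p x - c x * r x) (at x)"
    and "(r has_real_derivative r x / 2 - 2 * c x * p x - b x * r x) (at x)"
    and "(a has_real_derivative (p x)\<^sup>2) (at x)"
    and "(b has_real_derivative (r x)\<^sup>2) (at x)"
    and "(c has_real_derivative p x * r x) (at x)"
    and "(p x)\<^sup>2 = 2 * a x - 2 * (a x)\<^sup>2 - (c x)\<^sup>2"
    and "(r x)\<^sup>2 = b x - 2 * (c x)\<^sup>2 - (b x)\<^sup>2"
    and "p x * r x = 3 / 2 * c x - 2 * a x * c x - c x * b x"
proof -
  define E where "E = exp (x / 2)"
  define F where "F = soliton_denom A B x"
  have F: "F = 1 + B\<^sup>2 * E ^ 2 + A\<^sup>2 / 2 * E ^ 4 + A\<^sup>2 * B\<^sup>2 / 18 * E ^ 6"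
    unfolding F_def E_def by (rule soliton_eqs)
  have F0: "F \<noteq> 0" using soliton_denom_pos[of A B x] by (simp add: F_def)
  define P where "P = A * E ^ 2 + A * B\<^sup>2 / 3 * E ^ 4"
  define R where "R = B * E - A\<^sup>2 * B / 6 * E ^ 5"
  define a' where "a' = A\<^sup>2 / 2 * E ^ 4 + A\<^sup>2 * B\<^sup>2 / 18 * E ^ 6"
  define b' where "b' = B\<^sup>2 * E ^ 2 + A\<^sup>2 * B\<^sup>2 / 18 * E ^ 6"
  define c' where "c' = 2 / 3 * (A * B) * E ^ 3"
  note defs = P_def R_def a'_def b'_def c'_def F
  have at_x: "p x = P / F" "r x = R / F" "a x = a' / F" "b x = b' / F" "c x = c' / F"
    unfolding p_def r_def a_def b_def c_def soliton_eqs(1-5) F_def P_def R_def a'_def b'_def c'_def E_def by simp_all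
  note d = exp_half_power_deriv[of _ _ x]
  have d1: "((\<lambda>x. c * exp (x / 2)) has_real_derivative c / 2 * exp (x / 2)) (at x)" for c
    using d[of c 1] by simp
  have "(p has_real_derivative (P * F - 2 * a' * P - c' * R) / F\<^sup>2) (at x)"
    unfolding p_def soliton_eqs(1) F_def
    by (rule soliton_quotient_deriv[OF DERIV_add[OF d d]])
      (fold E_def F_def, simp add: defs field_simps eval_nat_numeral)
  then show "(p has_real_derivative p x - 2 * a x * p x - c x * r x) (at x)"
    unfolding at_x by (rule DERIV_cong) (use F0 in \<open>simp add: field_simps power2_eq_square\<close>)
  have "(r has_real_derivative (R * F / 2 - 2 * c' * P - b' * R) / F\<^sup>2) (at x)"
    unfolding r_def soliton_eqs(2) F_def
    by (rule soliton_quotient_deriv[OF DERIV_diff[OF d1 d]])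
      (fold E_def F_def, simp add: defs field_simps eval_nat_numeral)
  then show "(r has_real_derivative r x / 2 - 2 * c x * p x - b x * r x) (at x)"
    unfolding at_x by (rule DERIV_cong) (use F0 in \<open>simp add: field_simps power2_eq_square\<close>)
  have "(a has_real_derivative (P\<^sup>2) / F\<^sup>2) (at x)"
    unfolding a_def soliton_eqs(3) F_def
    by (rule soliton_quotient_deriv[OF DERIV_add[OF d d]])
      (fold E_def F_def, simp add: defs field_simps eval_nat_numeral)
  then show "(a has_real_derivative (p x)\<^sup>2) (at x)"
    unfolding at_x by (simp add: power_divide)
  have "(b has_real_derivative (R\<^sup>2) / F\<^sup>2) (at x)"
    unfolding b_def soliton_eqs(4) F_def
    by (rule soliton_quotient_deriv[OF DERIV_add[OF d d]])
      (fold E_def F_def, simp add: defs field_simps eval_nat_numeral)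
  then show "(b has_real_derivative (r x)\<^sup>2) (at x)"
    unfolding at_x by (simp add: power_divide)
  have "(c has_real_derivative (P * R) / F\<^sup>2) (at x)"
    unfolding c_def soliton_eqs(5) F_def
    by (rule soliton_quotient_deriv[OF d])
      (fold E_def F_def, simp add: defs field_simps eval_nat_numeral)
  then show "(c has_real_derivative p x * r x) (at x)"
    unfolding at_x by (simp add: power2_eq_square)
  have "P\<^sup>2 = 2 * a' * F - 2 * a'\<^sup>2 - c'\<^sup>2"
    by (simp add: defs field_simps eval_nat_numeral)
  moreover have "2 * (a' / F) - 2 * (a' / F)\<^sup>2 - (c' / F)\<^sup>2 = (2 * a' * F - 2 * a'\<^sup>2 - c'\<^sup>2) / F\<^sup>2"
    using F0 by (simp add: field_simps power2_eq_square)
  ultimately show "(p x)\<^sup>2 = 2 * a x - 2 * (a x)\<^sup>2 - (c x)\<^sup>2"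
    unfolding at_x by (simp add: power_divide)
  have "R\<^sup>2 = b' * F - 2 * c'\<^sup>2 - b'\<^sup>2"
    by (simp add: defs field_simps eval_nat_numeral)
  moreover have "b' / F - 2 * (c' / F)\<^sup>2 - (b' / F)\<^sup>2 = (b' * F - 2 * c'\<^sup>2 - b'\<^sup>2) / F\<^sup>2"
    using F0 by (simp add: field_simps power2_eq_square)
  ultimately show "(r x)\<^sup>2 = b x - 2 * (c x)\<^sup>2 - (b x)\<^sup>2"
    unfolding at_x by (simp add: power_divide)
  have "P * R = 3 / 2 * c' * F - 2 * a' * c' - c' * b'"
    by (simp add: defs field_simps eval_nat_numeral)
  moreover have "3 / 2 * (c' / F) - 2 * (a' / F) * (c' / F) - (c' / F) * (b' / F) = (3 / 2 * c' * F - 2 * a' * c' - c' * b') / F\<^sup>2"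
    using F0 by (simp add: field_simps power2_eq_square)
  ultimately show "p x * r x = 3 / 2 * c x - 2 * a x * c x - c x * b x"
    unfolding at_x by (simp add: power2_eq_square)
qed

lemma soliton_denom_at_bot: "(soliton_denom A B \<longlongrightarrow> 1) at_bot"
proof -
  have "(soliton_denom A B \<longlongrightarrow> 1 + B\<^sup>2 * 0 + A\<^sup>2 / 2 * 0 + A\<^sup>2 * B\<^sup>2 / 18 * 0) at_bot"
    unfolding soliton_denom_def[abs_def]
    by (intro tendsto_intros exp_at_bot tendsto_exp_mult_at_bot) simp_all
  then show ?thesis by simp
qed

lemma gram_at_bot:
  "(gram11 A B \<longlongrightarrow> 0) at_bot" "(gram33 A B \<longlongrightarrow> 0) at_bot" "(gram13 A B \<longlongrightarrow> 0) at_bot"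
proof -
  note i = tendsto_intros exp_at_bot tendsto_exp_mult_at_bot soliton_denom_at_bot
  have "(gram11 A B \<longlongrightarrow> (A\<^sup>2 / 2 * 0 + A\<^sup>2 * B\<^sup>2 / 18 * 0) / 1) at_bot"
    unfolding gram11_def[abs_def] by (intro i) simp_all
  then show "(gram11 A B \<longlongrightarrow> 0) at_bot" by simp
  have "(gram33 A B \<longlongrightarrow> (B\<^sup>2 * 0 + A\<^sup>2 * B\<^sup>2 / 18 * 0) / 1) at_bot"
    unfolding gram33_def[abs_def] by (intro i) simp_all
  then show "(gram33 A B \<longlongrightarrow> 0) at_bot" by simp
  have "(gram13 A B \<longlongrightarrow> 2 / 3 * (A * B) * 0 / 1) at_bot"
    unfolding gram13_def[abs_def] by (intro i) simp_all
  then show "(gram13 A B \<longlongrightarrow> 0) at_bot" by simp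
qed

lemma soliton_asymptotics:
  "((\<lambda>x. exp (- x) * soliton1 A B x) \<longlongrightarrow> A) at_bot"
  "((\<lambda>x. exp (- (x / 2)) * soliton3 A B x) \<longlongrightarrow> B) at_bot"
proof -
  note i = tendsto_intros exp_at_bot tendsto_exp_mult_at_bot soliton_denom_at_bot
  have "((\<lambda>x. A / soliton_denom A B x * (1 + B\<^sup>2 / 3 * exp x)) \<longlongrightarrow> A / 1 * (1 + B\<^sup>2 / 3 * 0)) at_bot"
    by (intro i) simp_all
  moreover have "exp (- x) * soliton1 A B x = A / soliton_denom A B x * (1 + B\<^sup>2 / 3 * exp x)" for x
    by (simp add: soliton1_def exp_minus)
  ultimately show "((\<lambda>x. exp (- x) * soliton1 A B x) \<longlongrightarrow> A) at_bot" by simp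
  have "((\<lambda>x. B / soliton_denom A B x * (1 - A\<^sup>2 / 6 * exp (2 * x))) \<longlongrightarrow> B / 1 * (1 - A\<^sup>2 / 6 * 0)) at_bot"
    by (intro i) simp_all
  moreover have "exp (- (x / 2)) * soliton3 A B x = B / soliton_denom A B x * (1 - A\<^sup>2 / 6 * exp (2 * x))" for x
    by (simp add: soliton3_def exp_minus)
  ultimately show "((\<lambda>x. exp (- (x / 2)) * soliton3 A B x) \<longlongrightarrow> B) at_bot" by simp
qed

text \<open>After division by \<open>e\<^sup>3\<^sup>x\<close>, numerator and denominator are polynomials in \<open>e\<^sup>-\<^sup>x\<close> with the same
  constant term \<open>A\<^sup>2 B\<^sup>2 / 18\<close>. So both limits are \<open>1\<close> if this term does not vanish.\<close>

lemma gram_at_top: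
  assumes "A \<noteq> 0" "B \<noteq> 0"
  shows "(gram11 A B \<longlongrightarrow> 1) at_top" "(gram33 A B \<longlongrightarrow> 1) at_top"
proof -
  define y where "y x = exp (- x)" for x :: real
  have y: "(y \<longlongrightarrow> 0) at_top"
    unfolding y_def[abs_def] by (rule filterlim_compose[OF exp_at_bot filterlim_uminus_at_bot_at_top])
  define F where "F x = y x ^ 3 + B\<^sup>2 * y x ^ 2 + A\<^sup>2 / 2 * y x + A\<^sup>2 * B\<^sup>2 / 18" for x
  have e: "exp (2 * x) = y x * exp (3 * x)" "exp x = y x ^ 2 * exp (3 * x)" "1 = y x ^ 3 * exp (3 * x)" for x
    by (simp_all add: y_def flip: exp_of_nat_mult exp_add)
  have F: "soliton_denom A B x = F x * exp (3 * x)" for x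
    unfolding soliton_denom_def F_def using e[of x] by (simp add: algebra_simps)
  have "(F \<longlongrightarrow> 0 ^ 3 + B\<^sup>2 * 0 ^ 2 + A\<^sup>2 / 2 * 0 + A\<^sup>2 * B\<^sup>2 / 18) at_top"
    unfolding F_def[abs_def] by (intro tendsto_intros y)
  then have F_lim: "(F \<longlongrightarrow> A\<^sup>2 * B\<^sup>2 / 18) at_top" by simp
  have nz: "A\<^sup>2 * B\<^sup>2 / 18 \<noteq> 0" using assms by simp
  have "gram11 A B = (\<lambda>x. (A\<^sup>2 / 2 * y x + A\<^sup>2 * B\<^sup>2 / 18) / F x)"
  proof (rule ext)
    fix x
    have "A\<^sup>2 / 2 * exp (2 * x) + A\<^sup>2 * B\<^sup>2 / 18 * exp (3 * x) = (A\<^sup>2 / 2 * y x + A\<^sup>2 * B\<^sup>2 / 18) * exp (3 * x)"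
      using e(1)[of x] by (simp add: algebra_simps)
    then show "gram11 A B x = (A\<^sup>2 / 2 * y x + A\<^sup>2 * B\<^sup>2 / 18) / F x" unfolding gram11_def F by simp
  qed
  moreover have "((\<lambda>x. (A\<^sup>2 / 2 * y x + A\<^sup>2 * B\<^sup>2 / 18) / F x) \<longlongrightarrow>
      (A\<^sup>2 / 2 * 0 + A\<^sup>2 * B\<^sup>2 / 18) / (A\<^sup>2 * B\<^sup>2 / 18)) at_top"
    by (intro tendsto_intros y F_lim nz)
  ultimately show "(gram11 A B \<longlongrightarrow> 1) at_top" using assms by simp
  have "gram33 A B = (\<lambda>x. (B\<^sup>2 * y x ^ 2 + A\<^sup>2 * B\<^sup>2 / 18) / F x)"
  proof (rule ext)
    fix x
    have "B\<^sup>2 * exp x + A\<^sup>2 * B\<^sup>2 / 18 * exp (3 * x) = (B\<^sup>2 * y x ^ 2 + A\<^sup>2 * B\<^sup>2 / 18) * exp (3 * x)"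
      using e(2)[of x] by (simp add: algebra_simps)
    then show "gram33 A B x = (B\<^sup>2 * y x ^ 2 + A\<^sup>2 * B\<^sup>2 / 18) / F x" unfolding gram33_def F by simp
  qed
  moreover have "((\<lambda>x. (B\<^sup>2 * y x ^ 2 + A\<^sup>2 * B\<^sup>2 / 18) / F x) \<longlongrightarrow>
      (B\<^sup>2 * 0 ^ 2 + A\<^sup>2 * B\<^sup>2 / 18) / (A\<^sup>2 * B\<^sup>2 / 18)) at_top"
    by (intro tendsto_intros y F_lim nz)
  ultimately show "(gram33 A B \<longlongrightarrow> 1) at_top" using assms by simp
qed

text \<open>The first two functions agree up to a sign \<open>s\<close>, so the Kay-Moses system reduces to the equations
  solved by \<open>two_soliton_unique\<close>. The amplitudes \<open>A\<close> and \<open>B\<close> found there absorb the translation. For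
  the converse, \<open>gram11\<close>, \<open>gram33\<close>, \<open>gram13\<close> and the sign give the full matrix \<open>m\<close>.\<close>

lemma split_eigenvalues_solutions:
  fixes \<mu> :: "3 \<Rightarrow> real"
  assumes \<mu>: "\<mu> 1 = - 1" "\<mu> 2 = - 1" "\<mu> 3 = - 1 / 4"
  shows "normalized_solution \<mu> u \<longleftrightarrow>
    (\<exists>x0 A B s. A \<noteq> 0 \<and> B \<noteq> 0 \<and> s \<in> {1, - 1} \<and>
      (\<forall>x. u 1 (x + x0) = soliton1 A B x \<and> u 2 (x + x0) = s * soliton1 A B x \<and> u 3 (x + x0) = soliton3 A B x))"
proof
  define \<kappa> :: "3 \<Rightarrow> real" where "\<kappa> i = (if i = 3 then 1 / 2 else 1)" for i
  have \<kappa>: "\<kappa> i > 0" for i by (simp add: \<kappa>_def)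
  have \<mu>': "\<mu> i = - (\<kappa> i)\<^sup>2" for i
    using \<mu> exhaust_3[of i] by (auto simp: \<kappa>_def power2_eq_square)
  {
    assume sol: "normalized_solution \<mu> u"
    define m where "m i j = integral_below (\<lambda>t. u i t * u j t)" for i j
    note km0 = normalized_solution_imp_kay_moses[where \<kappa> = \<kappa>, OF sol \<kappa> \<mu>']
    have sys: "kay_moses_system \<kappa> u m" using km0(1) by (simp add: m_def[abs_def])
    note D = kay_moses_systemD[OF sys]
    have "\<kappa> 1 = \<kappa> 2" by (simp add: \<kappa>_def)
    then obtain s where s: "s \<in> {1, - 1}" and u2: "\<And>x. u 2 x = s * u 1 x" using km0(4)[of 1 2] by metis
    have u2': "u 2 = (\<lambda>x. s * u 1 x)" using u2 by blast
    have ss: "s * s = 1" using s by auto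
    have m2: "m 1 2 x = s * m 1 1 x" "m 2 1 x = s * m 1 1 x" "m 2 3 x = s * m 1 3 x" "m 3 2 x = s * m 1 3 x"
      "m 3 1 x = m 1 3 x" for x
    proof -
      have pull: "(\<lambda>t. indicator {..x} t * (u 1 t * (s * u 1 t))) = (\<lambda>t. s * (indicator {..x} t * (u 1 t * u 1 t)))"
        "(\<lambda>t. indicator {..x} t * (s * u 1 t * u 3 t)) = (\<lambda>t. s * (indicator {..x} t * (u 1 t * u 3 t)))"
        by (simp_all add: fun_eq_iff mult_ac)
      show 12: "m 1 2 x = s * m 1 1 x" by (simp add: m_def integral_below_def u2' pull)
      show 23: "m 2 3 x = s * m 1 3 x" by (simp add: m_def integral_below_def u2' pull)
      show "m 2 1 x = s * m 1 1 x" using 12 D(4)[of 2 1 x] by simp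
      show "m 3 2 x = s * m 1 3 x" using 23 D(4)[of 3 2 x] by simp
      show "m 3 1 x = m 1 3 x" by (rule D(4))
    qed
    have \<kappa>s: "\<kappa> 1 = 1" "\<kappa> 3 = 1 / 2" by (simp_all add: \<kappa>_def)
    have sq: "s * y * (s * z) = y * z" "s * (s * z) = z" for y z
      using ss by (metis mult.assoc mult.commute mult_1)+
    have "\<exists>p q. \<forall>x. u 1 x = p * exp x / soliton_denom p q x * (1 + q\<^sup>2 / 3 * exp x) \<and>
                   u 3 x = q * exp (x / 2) / soliton_denom p q x * (1 - p\<^sup>2 / 6 * exp (2 * x))"
    proof (rule two_soliton_unique[where a = "m 1 1" and b = "m 3 3" and c = "m 1 3"])
      show "(u 1 has_real_derivative u 1 x - 2 * m 1 1 x * u 1 x - m 1 3 x * u 3 x) (at x)" for x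
        using D(1)[of 1 x] by (simp add: sum_3 \<kappa>s m2 u2 sq algebra_simps)
      show "(u 3 has_real_derivative u 3 x / 2 - 2 * m 1 3 x * u 1 x - m 3 3 x * u 3 x) (at x)" for x
        using D(1)[of 3 x] by (simp add: sum_3 \<kappa>s m2 u2 sq algebra_simps)
      show "(m 1 1 has_real_derivative (u 1 x)\<^sup>2) (at x)" "(m 3 3 has_real_derivative (u 3 x)\<^sup>2) (at x)"
        "(m 1 3 has_real_derivative u 1 x * u 3 x) (at x)" for x
        unfolding power2_eq_square by (rule D(2))+
      show "(u 1 x)\<^sup>2 = 2 * m 1 1 x - 2 * (m 1 1 x)\<^sup>2 - (m 1 3 x)\<^sup>2" for x
        unfolding power2_eq_square[of "u 1 x"] D(3)[of 1 x 1]
        by (simp add: sum_3 \<kappa>s m2 sq power2_eq_square)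
      show "(u 3 x)\<^sup>2 = m 3 3 x - 2 * (m 1 3 x)\<^sup>2 - (m 3 3 x)\<^sup>2" for x
        unfolding power2_eq_square[of "u 3 x"] D(3)[of 3 x 3]
        by (simp add: sum_3 \<kappa>s m2 sq power2_eq_square)
      show "u 1 x * u 3 x = 3 / 2 * m 1 3 x - 2 * m 1 1 x * m 1 3 x - m 1 3 x * m 3 3 x" for x
        unfolding D(3)[of 1 x 3] by (simp add: sum_3 \<kappa>s m2 sq)
      show "(m 1 1 \<longlongrightarrow> 0) at_bot" "(m 3 3 \<longlongrightarrow> 0) at_bot" "(m 1 3 \<longlongrightarrow> 0) at_bot" by (rule D(5))+
      show "\<bar>2 * m 1 1 x + m 3 3 x\<bar> \<le> 2 * (2 * \<kappa> 1) + 2 * \<kappa> 3" for x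
        using kay_moses_bounds(1)[OF sys \<kappa>, of 1 1 x] kay_moses_bounds(1)[OF sys \<kappa>, of 3 3 x] by linarith
    qed
    then obtain p q where pq: "\<And>x. u 1 x = soliton1 p q x" "\<And>x. u 3 x = soliton3 p q x"
      unfolding soliton1_def soliton3_def by blast
    have norm1: "(LINT x|lborel. (u i x)\<^sup>2) = 1" for i using sol by (simp add: normalized_solution_def)
    have "p \<noteq> 0"
    proof
      assume "p = 0"
      then have "u 1 x = 0" for x by (simp add: pq soliton1_def)
      then show False using norm1[of 1] by simp
    qed
    moreover have "q \<noteq> 0"
    proof
      assume "q = 0"
      then have "u 3 x = 0" for x by (simp add: pq soliton3_def)
      then show False using norm1[of 3] by simp
    qed
    ultimately show "\<exists>x0 A B s. A \<noteq> 0 \<and> B \<noteq> 0 \<and> s \<in> {1, - 1} \<and>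
      (\<forall>x. u 1 (x + x0) = soliton1 A B x \<and> u 2 (x + x0) = s * soliton1 A B x \<and> u 3 (x + x0) = soliton3 A B x)"
      using s pq u2 by (intro exI[of _ 0] exI[of _ p] exI[of _ q] exI[of _ s]) simp
  }
  assume "\<exists>x0 A B s. A \<noteq> 0 \<and> B \<noteq> 0 \<and> s \<in> {1, - 1} \<and>
      (\<forall>x. u 1 (x + x0) = soliton1 A B x \<and> u 2 (x + x0) = s * soliton1 A B x \<and> u 3 (x + x0) = soliton3 A B x)"
  then obtain x0 A B s where AB: "A \<noteq> 0" "B \<noteq> 0" and s: "s \<in> {1, - 1}"
    and u: "\<And>x. u 1 (x + x0) = soliton1 A B x" "\<And>x. u 2 (x + x0) = s * soliton1 A B x"
      "\<And>x. u 3 (x + x0) = soliton3 A B x" by blast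
  have ss: "s * s = 1" using s by auto
  have sq: "s * y * (s * z) = y * z" "s * (s * z) = z" for y z
    using ss by (metis mult.assoc mult.commute mult_1)+
  define U where "U i = (if i = 3 then soliton3 A B else if i = 2 then (\<lambda>x. s * soliton1 A B x) else soliton1 A B)"
    for i :: 3
  define M where "M i j =
    (if i = 3 then (if j = 3 then gram33 A B else if j = 2 then (\<lambda>x. s * gram13 A B x) else gram13 A B)
     else if i = 2 then (if j = 3 then (\<lambda>x. s * gram13 A B x) else if j = 2 then gram11 A B else (\<lambda>x. s * gram11 A B x))
     else (if j = 3 then gram13 A B else if j = 2 then (\<lambda>x. s * gram11 A B x) else gram11 A B))" for i j :: 3
  have U: "U 1 = soliton1 A B" "U 2 = (\<lambda>x. s * soliton1 A B x)" "U 3 = soliton3 A B" by (simp_all add: U_def)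
  have M: "M 1 1 = gram11 A B" "M 1 2 = (\<lambda>x. s * gram11 A B x)" "M 1 3 = gram13 A B"
    "M 2 1 = (\<lambda>x. s * gram11 A B x)" "M 2 2 = gram11 A B" "M 2 3 = (\<lambda>x. s * gram13 A B x)"
    "M 3 1 = gram13 A B" "M 3 2 = (\<lambda>x. s * gram13 A B x)" "M 3 3 = gram33 A B" by (simp_all add: M_def)
  have \<kappa>s: "\<kappa> 1 = 1" "\<kappa> 2 = 1" "\<kappa> 3 = 1 / 2" by (simp_all add: \<kappa>_def)
  note S = soliton_system[of A B]
  have S2: "soliton1 A B x * soliton1 A B x = 2 * gram11 A B x - 2 * (gram11 A B x * gram11 A B x) - gram13 A B x * gram13 A B x"
    "soliton3 A B x * soliton3 A B x = gram33 A B x - 2 * (gram13 A B x * gram13 A B x) - gram33 A B x * gram33 A B x" for x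
    using S(6,7)[of x] by (simp_all only: power2_eq_square)
  have cm: "((\<lambda>x. s * f x) has_real_derivative d) (at x)" if "(f has_real_derivative e) (at x)" "d = s * e" for f d e x
    using DERIV_cmult[OF that(1), of s] that(2) by simp
  have "kay_moses_system \<kappa> U M"
    unfolding kay_moses_system_def
  proof (intro conjI)
    show "\<forall>i x. (U i has_real_derivative \<kappa> i * U i x - (\<Sum>j\<in>UNIV. M i j x * U j x)) (at x)"
      unfolding forall_3 sum_3 U M \<kappa>s
      by (intro conjI allI cm[OF S(1)] DERIV_cong[OF S(1)] DERIV_cong[OF S(2)])
        (simp_all add: sq algebra_simps)
    show "\<forall>i j x. (M i j has_real_derivative U i x * U j x) (at x)"
      unfolding forall_3 U M sq(1)
      by (intro conjI allI cm[OF S(3)] cm[OF S(5)] DERIV_cong[OF S(3)] DERIV_cong[OF S(4)] DERIV_cong[OF S(5)])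
        (simp_all add: power2_eq_square)
    show "\<forall>i j x. U i x * U j x = (\<kappa> i + \<kappa> j) * M i j x - (\<Sum>k\<in>UNIV. M i k x * M k j x)"
      unfolding forall_3 sum_3 U M \<kappa>s sq(1)
      using S2 S(8) arg_cong[OF S2(1), of "(*) s"] arg_cong[OF S(8), of "(*) s"]
      by (simp add: sq algebra_simps)
    show "\<forall>i j x. M i j x = M j i x" unfolding forall_3 M by simp
    show "\<forall>i j. (M i j \<longlongrightarrow> 0) at_bot"
      unfolding forall_3 M by (intro conjI gram_at_bot tendsto_mult_right_zero)
  qed
  then have "kay_moses_system \<kappa> u (\<lambda>i j x. M i j (x + - x0))"
  proof -
    have "u i x = U i (x + - x0)" for i x
      using exhaust_3[of i] u[of "x + - x0"] U by (auto simp: U)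
    then have "u = (\<lambda>i x. U i (x + - x0))" by blast
    then show ?thesis using kay_moses_system_shift[OF \<open>kay_moses_system \<kappa> U M\<close>, of "- x0"] by (simp only:)
  qed
  then show "normalized_solution \<mu> u"
  proof (rule kay_moses_imp_normalized_solution[OF _ \<kappa> \<mu>'])
    fix i
    have "filterlim (\<lambda>x. x + - x0) at_top at_top"
      using filterlim_tendsto_add_at_top[OF tendsto_const filterlim_ident, of "- x0"] by (simp add: add.commute)
    moreover have "(M i i \<longlongrightarrow> 1) at_top" using exhaust_3[of i] gram_at_top[OF AB] M by auto
    ultimately show "((\<lambda>x. M i i (x + - x0)) \<longlongrightarrow> 1) at_top" by (rule filterlim_compose[rotated])
  qed
qed

text \<open>The amplitudes at \<open>-\<infinity>\<close> are read off from \<open>soliton_asymptotics\<close>. A translation by \<open>x0\<close> multiplies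
  the amplitude \<open>1\<close> of the third component by \<open>e\<^sup>x\<^sup>0\<^sup>/\<^sup>2\<close>, which forces \<open>x0 = 0\<close>.\<close>

lemma soliton_translation_classes:
  assumes "\<And>x. soliton1 A' 1 x = soliton1 A 1 (x + x0)" and "\<And>x. soliton3 A' 1 x = soliton3 A 1 (x + x0)"
  shows "A' = A"
proof -
  have shift: "filterlim (\<lambda>x. x + x0) at_bot at_bot"
    using filterlim_tendsto_add_at_bot_iff[OF tendsto_const, THEN iffD2, OF filterlim_ident, of x0]
    by (simp add: add.commute)
  have "((\<lambda>x. exp (x0 / 2) * (exp (- ((x + x0) / 2)) * soliton3 A 1 (x + x0))) \<longlongrightarrow> exp (x0 / 2) * 1) at_bot"
    by (intro tendsto_mult_left filterlim_compose[OF soliton_asymptotics(2) shift])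
  moreover have "exp (x0 / 2) * (exp (- ((x + x0) / 2)) * soliton3 A 1 (x + x0)) = exp (- (x / 2)) * soliton3 A' 1 x" for x
    unfolding assms(2) mult.assoc[symmetric] exp_add[symmetric] by (simp add: field_simps)
  ultimately have "((\<lambda>x. exp (- (x / 2)) * soliton3 A' 1 x) \<longlongrightarrow> exp (x0 / 2) * 1) at_bot" by simp
  then have "exp (x0 / 2) * 1 = 1"
    by (rule tendsto_unique[OF trivial_limit_at_bot_linorder _ soliton_asymptotics(2)])
  then have "x0 = 0" by simp
  then have "(\<lambda>x. exp (- x) * soliton1 A' 1 x) = (\<lambda>x. exp (- x) * soliton1 A 1 x)"
    using assms(1) by simp
  then show "A' = A"
    using tendsto_unique[OF trivial_limit_at_bot_linorder soliton_asymptotics(1)[of A' 1]]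
      soliton_asymptotics(1)[of A 1] by simp
qed

lemma infinite_translation_classes:
  fixes \<mu> :: "3 \<Rightarrow> real"
  assumes \<mu>: "\<mu> 1 = - 1" "\<mu> 2 = - 1" "\<mu> 3 = - 1 / 4"
  shows "infinite ({u. normalized_solution \<mu> u} // translation_rel)"
proof -
  \<comment> \<open>The solutions with \<open>B = 1\<close> and \<open>A = n + 1\<close> are pairwise inequivalent.\<close>
  define w where "w n = (\<lambda>i::3. if i = 3 then soliton3 (real (Suc n)) 1 else soliton1 (real (Suc n)) 1)" for n
  have w: "w n 1 = soliton1 (real (Suc n)) 1" "w n 2 = soliton1 (real (Suc n)) 1" "w n 3 = soliton3 (real (Suc n)) 1" for n
    by (simp_all add: w_def)
  have "normalized_solution \<mu> (w n)" for n
    unfolding split_eigenvalues_solutions[OF \<mu>]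
    by (intro exI[of _ 0] exI[of _ "real (Suc n)"] exI[of _ 1]) (simp add: w)
  then have "range (\<lambda>n. translation_rel `` {w n}) \<subseteq> {u. normalized_solution \<mu> u} // translation_rel"
    by (auto intro: quotientI)
  moreover have "inj (\<lambda>n. translation_rel `` {w n})"
  proof (rule injI)
    fix n k assume eq: "translation_rel `` {w n} = translation_rel `` {w k}"
    have "w k \<in> translation_rel `` {w k}" by (auto simp: translation_rel_def intro: exI[of _ 0])
    then obtain x0 where x0: "\<And>i x. w k i x = w n i (x + x0)"
      unfolding eq[symmetric] by (auto simp: translation_rel_def)
    have "real (Suc k) = real (Suc n)"
      by (rule soliton_translation_classes[of _ _ x0]) (use x0[of 1] x0[of 3] in \<open>simp_all add: w\<close>)
    then show "n = k" by simp
  qed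
  ultimately show ?thesis using range_inj_infinite infinite_super by blast
qed

section \<open>The classification\<close>

theorem theorem1p2:
  fixes \<mu> :: "3 \<Rightarrow> real"
  assumes "\<mu> 1 \<le> \<mu> 2" and "\<mu> 2 \<le> \<mu> 3" and "\<mu> 3 < 0"
  shows
    "((\<exists>u. normalized_solution \<mu> u) \<longleftrightarrow>
        (\<mu> 1 = - 9/4 \<and> \<mu> 2 = - 9/4 \<and> \<mu> 3 = - 9/4) \<or>
        (\<mu> 1 = - 1 \<and> \<mu> 2 = - 1 \<and> \<mu> 3 = - 1/4))
     \<and>
     (\<mu> 1 = - 9/4 \<and> \<mu> 2 = - 9/4 \<and> \<mu> 3 = - 9/4 \<longrightarrow>
        (\<forall>u. normalized_solution \<mu> u \<longleftrightarrow>
           (\<exists>x0 s. (\<forall>i. s i \<in> {1, - 1}) \<and>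
              (\<forall>i x. u i (x + x0) = s i * (sqrt 3 / (2 * cosh (3 * x / 2)))))))
     \<and>
     (\<mu> 1 = - 1 \<and> \<mu> 2 = - 1 \<and> \<mu> 3 = - 1/4 \<longrightarrow>
        infinite ({u. normalized_solution \<mu> u} // translation_rel) \<and>
        (\<forall>u. normalized_solution \<mu> u \<longleftrightarrow>
           (\<exists>x0 A B s. A \<noteq> 0 \<and> B \<noteq> 0 \<and> s \<in> {1, - 1} \<and>
              (\<forall>x. u 1 (x + x0) =
                     A * exp x / soliton_denom A B x * (1 + B\<^sup>2 / 3 * exp x) \<and>
                   u 2 (x + x0) =
                     s * (A * exp x / soliton_denom A B x * (1 + B\<^sup>2 / 3 * exp x)) \<and>
                   u 3 (x + x0) =
                     B * exp (x / 2) / soliton_denom A B x * (1 - A\<^sup>2 / 6 * exp (2 * x))))))"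
    (is "(?ex \<longleftrightarrow> ?i \<or> ?ii) \<and> (?i \<longrightarrow> ?sol_i) \<and> (?ii \<longrightarrow> ?inf \<and> ?sol_ii)")
proof -
  have i: ?sol_i if ?i
    using equal_eigenvalues_solutions[of \<mu>] that exhaust_3 by metis
  have ii: "?inf \<and> ?sol_ii" if ?ii
    using infinite_translation_classes[of \<mu>] split_eigenvalues_solutions[of \<mu>] that
    unfolding soliton1_def soliton3_def by blast
  have "?i \<or> ?ii" if ex: ?ex
  proof -
    obtain u where sol: "normalized_solution \<mu> u" using ex by blast
    define \<kappa> where "\<kappa> i = sqrt (- \<mu> i)" for i
    have neg: "\<mu> i < 0" for i using assms exhaust_3[of i] by auto
    have \<kappa>: "\<kappa> i > 0" and \<mu>: "\<mu> i = - (\<kappa> i)\<^sup>2" for i using neg[of i] by (simp_all add: \<kappa>_def)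
    have "\<kappa> 2 \<le> \<kappa> 1" "\<kappa> 3 \<le> \<kappa> 2" using assms by (simp_all add: \<kappa>_def)
    then have "(\<kappa> 1 = 3/2 \<and> \<kappa> 2 = 3/2 \<and> \<kappa> 3 = 3/2) \<or> (\<kappa> 1 = 1 \<and> \<kappa> 2 = 1 \<and> \<kappa> 3 = 1/2)"
      by (intro eigenvalues_3 normalized_solution_multiplicity[OF sol \<kappa> \<mu>])
    then show ?thesis unfolding \<mu>[of 1] \<mu>[of 2] \<mu>[of 3]
      by (elim disjE conjE) (simp_all only:, simp_all add: power2_eq_square)
  qed
  moreover have ?ex if ?i
  proof -
    have "normalized_solution \<mu> (\<lambda>i x. sqrt 3 / (2 * cosh (3 * x / 2)))"
      using i[OF that] by (auto intro!: exI[of _ 0] exI[of _ "\<lambda>i. 1"])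
    then show ?thesis by blast
  qed
  moreover have ?ex if ?ii
  proof -
    have "infinite ({u. normalized_solution \<mu> u} // translation_rel)" using ii[OF that] by blast
    then have "{u. normalized_solution \<mu> u} \<noteq> {}" by (metis finite.emptyI quotient_empty)
    then show ?thesis by blast
  qed
  ultimately show ?thesis using i ii by blast
qed

end
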